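(* Let $\mathcal{C}$ be a dg category over $\mathbf{k}$, let $X,Y$ be objects of $\mathcal{C}$ and let $v\in\mathrm{Hom}_{\mathcal{C}}(X,Y)_n$ be a closed morphism. For every dg category $\mathcal{D}$ supplied with a dg functor $F:\mathcal{C}\to\mathcal{D}$ there is a natural isomorphism of sets $$\kappa_v(\mathcal{D})\cong[\mathcal{C}/v,\mathcal{D}]_{\mathcal{C}\downarrow\mathrm{dgCat}},$$ where the right hand side denotes homotopy classes of maps in $\mathcal{C}\downarrow\mathrm{dgCat}$. In other words, the functor $\kappa_v$ is represented up to homotopy by $\mathcal{C}/v$.
   Context: Fix a commutative ring $\mathbf{k}$. Dg modules are homologically graded (the differential lowers degree by one). A dg category is a category enriched over dg $\mathbf{k}$-modules. $\mathrm{dgCat}$ is the category of dg categories and dg functors with Tabuada's model structure, whose weak equivalences are the quasi-equivalences. All dg categories are assumed flat over $\mathbf{k}$. $\mathcal{C}\downarrow\mathrm{dgCat}$ is the category of dg categories equipped with a dg functor from $\mathcal{C}$ (maps are commutative triangles), with the induced model structure. For a dg functor $F:\mathcal{C}\to\mathcal{D}$ (an object of $\mathcal{C}\downarrow\mathrm{dgCat}$), set $$\kappa_v(\mathcal{D})=\{w\in\mathrm{Hom}_{\mathcal{D}}(F(X),F(Y))_{n+1}: d(w)=F(v)\}\,/\,B_{n+1}[\mathrm{Hom}_{\mathcal{D}}(F(X),F(Y))],$$ where $B_{n+1}$ denotes the boundaries in degree $n+1$, acting by translation. This defines a functor $\kappa_v:\mathcal{C}\downarrow\mathrm{dgCat}\to\mathrm{Sets}$.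 $\mathcal{C}/v:=\mathcal{C}\coprod_{\mathbf{k}\langle v\rangle}\mathbf{k}\langle v,w\rangle$, where $\mathbf{k}\langle v\rangle$ is the dg category with two objects generated by one closed morphism $v$ of degree $n$ from the first to the second, and $\mathbf{k}\langle v,w\rangle$ is generated by $v$ and a further parallel morphism $w$ of degree $n+1$ with $d(w)=v$. Explicitly, $\mathcal{C}/v$ is obtained from $\mathcal{C}$ by freely adjoining $w:X\to Y$ of degree $n+1$ with $d(w)=v$. *)

theory Defs
  imports
    "HOL-Algebra.Module"
    "HOL-Algebra.AbelCoset"
    "HOL-Algebra.Free_Abelian_Groups"
    "HOL-Library.Infinite_Typeclass"
begin

section \<open>Modules and flatness\<close>

definition module_hom ::
  "('r, 's) ring_scheme \<Rightarrow> ('r, 'a) module \<Rightarrow> ('r, 'b) module \<Rightarrow> ('a \<Rightarrow> 'b) set" where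
  "module_hom R M N = {f \<in> carrier M \<rightarrow> carrier N.
     (\<forall>a\<in>carrier M. \<forall>b\<in>carrier M. f (a \<oplus>\<^bsub>M\<^esub> b) = f a \<oplus>\<^bsub>N\<^esub> f b) \<and>
     (\<forall>r\<in>carrier R. \<forall>a\<in>carrier M. f (r \<odot>\<^bsub>M\<^esub> a) = r \<odot>\<^bsub>N\<^esub> f a)}"

definition tensor_relators ::
  "('r, 's) ring_scheme \<Rightarrow> ('r, 'a) module \<Rightarrow> ('r, 'b) module \<Rightarrow> (('a \<times> 'b) \<Rightarrow>\<^sub>0 int) set" where
  "tensor_relators R M N =
     {frag_of (a \<oplus>\<^bsub>M\<^esub> a', b) - frag_of (a, b) - frag_of (a', b) | a a' b.
        a \<in> carrier M \<and> a' \<in> carrier M \<and> b \<in> carrier N} \<union>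
     {frag_of (a, b \<oplus>\<^bsub>N\<^esub> b') - frag_of (a, b) - frag_of (a, b') | a b b'.
        a \<in> carrier M \<and> b \<in> carrier N \<and> b' \<in> carrier N} \<union>
     {frag_of (r \<odot>\<^bsub>M\<^esub> a, b) - frag_of (a, r \<odot>\<^bsub>N\<^esub> b) | r a b.
        r \<in> carrier R \<and> a \<in> carrier M \<and> b \<in> carrier N}"

definition tensor_kernel ::
  "('r, 's) ring_scheme \<Rightarrow> ('r, 'a) module \<Rightarrow> ('r, 'b) module \<Rightarrow> (('a \<times> 'b) \<Rightarrow>\<^sub>0 int) set" where
  "tensor_kernel R M N =
     generate (free_Abelian_group (carrier M \<times> carrier N)) (tensor_relators R M N)"

text \<open>The underlying abelian group of the tensor product; the action of the scalars plays no role
  in the definition of flatness.\<close>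

definition tensor_group ::
  "('r, 's) ring_scheme \<Rightarrow> ('r, 'a) module \<Rightarrow> ('r, 'b) module \<Rightarrow> (('a \<times> 'b) \<Rightarrow>\<^sub>0 int) set monoid" where
  "tensor_group R M N =
     free_Abelian_group (carrier M \<times> carrier N) Mod tensor_kernel R M N"

definition tensor_map_left ::
  "('r, 's) ring_scheme \<Rightarrow> ('r, 'a) module \<Rightarrow> ('r, 'b) module \<Rightarrow> ('a \<Rightarrow> 'b) \<Rightarrow> ('r, 'c) module
     \<Rightarrow> (('a \<times> 'c) \<Rightarrow>\<^sub>0 int) set \<Rightarrow> (('b \<times> 'c) \<Rightarrow>\<^sub>0 int) set" where
  "tensor_map_left R A B f M c =
     (\<Union>t\<in>c. tensor_kernel R B M #>\<^bsub>free_Abelian_group (carrier B \<times> carrier M)\<^esub>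
               frag_extend (\<lambda>(a, m). frag_of (f a, m)) t)"

text \<open>The test modules range over the type of the scalars. This loses nothing: it includes the
  inclusions of the ideals into the ring, which suffice to test flatness.\<close>

definition flat_module :: "('u, 's) ring_scheme \<Rightarrow> ('u, 'm) module \<Rightarrow> bool" where
  "flat_module R M \<longleftrightarrow> Module.module R M \<and>
     (\<forall>(A :: ('u, 'u) module) (B :: ('u, 'u) module) f.
        Module.module R A \<and> Module.module R B \<and> f \<in> module_hom R A B \<and> inj_on f (carrier A) \<longrightarrow>
        inj_on (tensor_map_left R A B f M) (carrier (tensor_group R A M)))"


section \<open>Dg categories and dg functors\<close>

text \<open>Universe convention: a dg category here is a small one whose scalars and whose morphisms
  are taken from one type \<open>'u\<close> and whose objects are taken from a type \<open>'o\<close>; \<open>'u\<close> will be an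
  infinite type. The graded pieces of distinct Hom complexes need not be disjoint, the source,
  target and degree of a morphism being passed as arguments.

  \<open>dgDiff A x y n\<close> is the differential from degree \<open>n\<close> to degree \<open>n - 1\<close> on \<open>Hom(x, y)\<close>, and
  \<open>dgComp A x y z p q g f\<close> is the composite \<open>g \<circ> f\<close> of \<open>f : x \<rightarrow> y\<close> of degree \<open>q\<close> with
  \<open>g : y \<rightarrow> z\<close> of degree \<open>p\<close>.\<close>

record ('o, 'u) dgcat =
  dgObj :: "'o set"
  dgHom :: "'o \<Rightarrow> 'o \<Rightarrow> int \<Rightarrow> ('u, 'u) module"
  dgDiff :: "'o \<Rightarrow> 'o \<Rightarrow> int \<Rightarrow> 'u \<Rightarrow> 'u"
  dgComp :: "'o \<Rightarrow> 'o \<Rightarrow> 'o \<Rightarrow> int \<Rightarrow> int \<Rightarrow> 'u \<Rightarrow> 'u \<Rightarrow> 'u"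
  dgId :: "'o \<Rightarrow> 'u"

definition koszul :: "('r, 'a) module \<Rightarrow> int \<Rightarrow> 'a \<Rightarrow> 'a" where
  "koszul M p a = (if even p then a else \<ominus>\<^bsub>M\<^esub> a)"

definition dg_category :: "'u ring \<Rightarrow> ('o, 'u) dgcat \<Rightarrow> bool" where
  "dg_category R A \<longleftrightarrow>
     (\<forall>x\<in>dgObj A. \<forall>y\<in>dgObj A. \<forall>n.
        Module.module R (dgHom A x y n) \<and>
        dgDiff A x y n \<in> module_hom R (dgHom A x y n) (dgHom A x y (n - 1)) \<and>
        (\<forall>a\<in>carrier (dgHom A x y n).
           dgDiff A x y (n - 1) (dgDiff A x y n a) = \<zero>\<^bsub>dgHom A x y (n - 2)\<^esub>)) \<and>
     (\<forall>x\<in>dgObj A. \<forall>y\<in>dgObj A. \<forall>z\<in>dgObj A. \<forall>p q.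
        (\<forall>g\<in>carrier (dgHom A y z p).
           dgComp A x y z p q g \<in> module_hom R (dgHom A x y q) (dgHom A x z (p + q))) \<and>
        (\<forall>f\<in>carrier (dgHom A x y q).
           (\<lambda>g. dgComp A x y z p q g f) \<in> module_hom R (dgHom A y z p) (dgHom A x z (p + q))) \<and>
        (\<forall>g\<in>carrier (dgHom A y z p). \<forall>f\<in>carrier (dgHom A x y q).
           dgDiff A x z (p + q) (dgComp A x y z p q g f) =
             dgComp A x y z (p - 1) q (dgDiff A y z p g) f \<oplus>\<^bsub>dgHom A x z (p + q - 1)\<^esub>
             koszul (dgHom A x z (p + q - 1)) p (dgComp A x y z p (q - 1) g (dgDiff A x y q f)))) \<and>
     (\<forall>w\<in>dgObj A. \<forall>x\<in>dgObj A. \<forall>y\<in>dgObj A. \<forall>z\<in>dgObj A. \<forall>p q r.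
        \<forall>h\<in>carrier (dgHom A y z p). \<forall>g\<in>carrier (dgHom A x y q). \<forall>f\<in>carrier (dgHom A w x r).
           dgComp A w y z p (q + r) h (dgComp A w x y q r g f) =
             dgComp A w x z (p + q) r (dgComp A x y z p q h g) f) \<and>
     (\<forall>x\<in>dgObj A. dgId A x \<in> carrier (dgHom A x x 0) \<and>
        dgDiff A x x 0 (dgId A x) = \<zero>\<^bsub>dgHom A x x (- 1)\<^esub>) \<and>
     (\<forall>x\<in>dgObj A. \<forall>y\<in>dgObj A. \<forall>n. \<forall>a\<in>carrier (dgHom A x y n).
        dgComp A x x y n 0 a (dgId A x) = a \<and> dgComp A x y y 0 n (dgId A y) a = a)"

definition flat_dgcat :: "'u ring \<Rightarrow> ('o, 'u) dgcat \<Rightarrow> bool" where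
  "flat_dgcat R A \<longleftrightarrow> (\<forall>x\<in>dgObj A. \<forall>y\<in>dgObj A. \<forall>n. flat_module R (dgHom A x y n))"

record ('o, 'p, 'u) dgfun =
  onObj :: "'o \<Rightarrow> 'p"
  onHom :: "'o \<Rightarrow> 'o \<Rightarrow> int \<Rightarrow> 'u \<Rightarrow> 'u"

text \<open>Dg functors are required to take the value \<open>undefined\<close> outside their domain, so that
  equality of dg functors is equality of records.\<close>

definition dg_functor ::
  "'u ring \<Rightarrow> ('o, 'u) dgcat \<Rightarrow> ('p, 'u) dgcat \<Rightarrow> ('o, 'p, 'u) dgfun \<Rightarrow> bool" where
  "dg_functor R A B F \<longleftrightarrow>
     dg_category R A \<and> dg_category R B \<and>
     onObj F \<in> dgObj A \<rightarrow>\<^sub>E dgObj B \<and>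
     (\<forall>x y. \<not> (x \<in> dgObj A \<and> y \<in> dgObj A) \<longrightarrow> (\<forall>n. onHom F x y n = (\<lambda>_. undefined))) \<and>
     (\<forall>x\<in>dgObj A. \<forall>y\<in>dgObj A. \<forall>n.
        onHom F x y n \<in> extensional (carrier (dgHom A x y n)) \<and>
        onHom F x y n \<in> module_hom R (dgHom A x y n) (dgHom B (onObj F x) (onObj F y) n) \<and>
        (\<forall>a\<in>carrier (dgHom A x y n).
           onHom F x y (n - 1) (dgDiff A x y n a) =
             dgDiff B (onObj F x) (onObj F y) n (onHom F x y n a))) \<and>
     (\<forall>x\<in>dgObj A. \<forall>y\<in>dgObj A. \<forall>z\<in>dgObj A. \<forall>p q.
        \<forall>g\<in>carrier (dgHom A y z p). \<forall>f\<in>carrier (dgHom A x y q).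
           onHom F x z (p + q) (dgComp A x y z p q g f) =
             dgComp B (onObj F x) (onObj F y) (onObj F z) p q (onHom F y z p g) (onHom F x y q f)) \<and>
     (\<forall>x\<in>dgObj A. onHom F x x 0 (dgId A x) = dgId B (onObj F x))"

definition dgfun_id :: "('o, 'u) dgcat \<Rightarrow> ('o, 'o, 'u) dgfun" where
  "dgfun_id A = \<lparr>
     onObj = restrict (\<lambda>x. x) (dgObj A),
     onHom = (\<lambda>x y n. if x \<in> dgObj A \<and> y \<in> dgObj A
                       then restrict (\<lambda>a. a) (carrier (dgHom A x y n)) else (\<lambda>_. undefined))\<rparr>"

definition dgfun_comp ::
  "('o, 'u) dgcat \<Rightarrow> ('p, 'q, 'u) dgfun \<Rightarrow> ('o, 'p, 'u) dgfun \<Rightarrow> ('o, 'q, 'u) dgfun" where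
  "dgfun_comp A G F = \<lparr>
     onObj = restrict (\<lambda>x. onObj G (onObj F x)) (dgObj A),
     onHom = (\<lambda>x y n. if x \<in> dgObj A \<and> y \<in> dgObj A
                       then restrict (\<lambda>a. onHom G (onObj F x) (onObj F y) n (onHom F x y n a))
                              (carrier (dgHom A x y n))
                       else (\<lambda>_. undefined))\<rparr>"


section \<open>Homology and quasi-equivalences\<close>

definition dg_cycles :: "('o, 'u) dgcat \<Rightarrow> 'o \<Rightarrow> 'o \<Rightarrow> int \<Rightarrow> 'u set" where
  "dg_cycles A x y n =
     {a \<in> carrier (dgHom A x y n). dgDiff A x y n a = \<zero>\<^bsub>dgHom A x y (n - 1)\<^esub>}"

definition dg_boundaries :: "('o, 'u) dgcat \<Rightarrow> 'o \<Rightarrow> 'o \<Rightarrow> int \<Rightarrow> 'u set" where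
  "dg_boundaries A x y n = dgDiff A x y (n + 1) ` carrier (dgHom A x y (n + 1))"

definition dg_coset :: "('o, 'u) dgcat \<Rightarrow> 'o \<Rightarrow> 'o \<Rightarrow> int \<Rightarrow> 'u \<Rightarrow> 'u set" where
  "dg_coset A x y n a = dg_boundaries A x y n +>\<^bsub>dgHom A x y n\<^esub> a"

definition dg_homology :: "('o, 'u) dgcat \<Rightarrow> 'o \<Rightarrow> 'o \<Rightarrow> int \<Rightarrow> 'u set set" where
  "dg_homology A x y n = dg_coset A x y n ` dg_cycles A x y n"

definition dg_coset_map ::
  "('p, 'u) dgcat \<Rightarrow> ('o, 'p, 'u) dgfun \<Rightarrow> 'o \<Rightarrow> 'o \<Rightarrow> int \<Rightarrow> 'u set \<Rightarrow> 'u set" where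
  "dg_coset_map B F x y n c = (\<Union>a\<in>c. dg_coset B (onObj F x) (onObj F y) n (onHom F x y n a))"

text \<open>Isomorphy of two objects in the category \<open>H\<^sub>0(A)\<close>.\<close>

definition H0_isomorphic :: "('o, 'u) dgcat \<Rightarrow> 'o \<Rightarrow> 'o \<Rightarrow> bool" where
  "H0_isomorphic A x y \<longleftrightarrow>
     (\<exists>f\<in>dg_cycles A x y 0. \<exists>g\<in>dg_cycles A y x 0.
        dg_coset A x x 0 (dgComp A x y x 0 0 g f) = dg_coset A x x 0 (dgId A x) \<and>
        dg_coset A y y 0 (dgComp A y x y 0 0 f g) = dg_coset A y y 0 (dgId A y))"

definition quasi_equivalence ::
  "'u ring \<Rightarrow> ('o, 'u) dgcat \<Rightarrow> ('p, 'u) dgcat \<Rightarrow> ('o, 'p, 'u) dgfun \<Rightarrow> bool" where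
  "quasi_equivalence R A B F \<longleftrightarrow>
     dg_functor R A B F \<and>
     (\<forall>x\<in>dgObj A. \<forall>y\<in>dgObj A. \<forall>n.
        bij_betw (dg_coset_map B F x y n) (dg_homology A x y n)
          (dg_homology B (onObj F x) (onObj F y) n)) \<and>
     (\<forall>y\<in>dgObj B. \<exists>x\<in>dgObj A. H0_isomorphic B (onObj F x) y)"


section \<open>Homotopy categories\<close>

text \<open>The homotopy category \<open>Ho\<close> of a category with weak equivalences is the localization at the
  weak equivalences: its morphisms are finite zigzags of maps in which the maps pointing backwards
  are weak equivalences, modulo the congruence generated by the relations of the category and by
  the requirement that a weak equivalence traversed backwards is inverse to itself traversed
  forwards. Zigzags are written in the order in which they are traversed. For a model category this
  is the usual homotopy category, and its Hom sets are the sets \<open>[X, Y]\<close> of homotopy classes of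
  maps; no (co)fibrancy of \<open>X\<close> or \<open>Y\<close> is needed.\<close>

record ('x, 'f) wecat =
  weOb :: "'x set"
  weHom :: "'x \<Rightarrow> 'x \<Rightarrow> 'f set"
  weComp :: "'x \<Rightarrow> 'x \<Rightarrow> 'x \<Rightarrow> 'f \<Rightarrow> 'f \<Rightarrow> 'f"
  weId :: "'x \<Rightarrow> 'f"
  weEq :: "'x \<Rightarrow> 'x \<Rightarrow> 'f set"

datatype ('x, 'f) zigzag_step = Fwd 'x 'f 'x | Bwd 'x 'f 'x

inductive zigzag :: "('x, 'f) wecat \<Rightarrow> 'x \<Rightarrow> 'x \<Rightarrow> ('x, 'f) zigzag_step list \<Rightarrow> bool"
  for K where
  zigzag_Nil: "x \<in> weOb K \<Longrightarrow> zigzag K x x []"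
| zigzag_Fwd: "\<lbrakk>x \<in> weOb K; y \<in> weOb K; f \<in> weHom K x y; zigzag K y z p\<rbrakk>
    \<Longrightarrow> zigzag K x z (Fwd x f y # p)"
| zigzag_Bwd: "\<lbrakk>x \<in> weOb K; y \<in> weOb K; f \<in> weEq K y x; zigzag K y z p\<rbrakk>
    \<Longrightarrow> zigzag K x z (Bwd x f y # p)"

inductive zigzag_eq ::
  "('x, 'f) wecat \<Rightarrow> 'x \<Rightarrow> 'x \<Rightarrow> ('x, 'f) zigzag_step list \<Rightarrow> ('x, 'f) zigzag_step list \<Rightarrow> bool"
  for K where
  ze_refl: "zigzag K x y p \<Longrightarrow> zigzag_eq K x y p p"
| ze_sym: "zigzag_eq K x y p q \<Longrightarrow> zigzag_eq K x y q p"
| ze_trans: "\<lbrakk>zigzag_eq K x y p q; zigzag_eq K x y q r\<rbrakk> \<Longrightarrow> zigzag_eq K x y p r"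
| ze_append: "\<lbrakk>zigzag_eq K x y p p'; zigzag_eq K y z q q'\<rbrakk>
    \<Longrightarrow> zigzag_eq K x z (p @ q) (p' @ q')"
| ze_id: "x \<in> weOb K \<Longrightarrow> zigzag_eq K x x [Fwd x (weId K x) x] []"
| ze_comp: "\<lbrakk>x \<in> weOb K; y \<in> weOb K; z \<in> weOb K; f \<in> weHom K x y; g \<in> weHom K y z\<rbrakk>
    \<Longrightarrow> zigzag_eq K x z [Fwd x f y, Fwd y g z] [Fwd x (weComp K x y z g f) z]"
| ze_inv1: "\<lbrakk>x \<in> weOb K; y \<in> weOb K; w \<in> weEq K x y\<rbrakk>
    \<Longrightarrow> zigzag_eq K x x [Fwd x w y, Bwd y w x] []"
| ze_inv2: "\<lbrakk>x \<in> weOb K; y \<in> weOb K; w \<in> weEq K x y\<rbrakk>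
    \<Longrightarrow> zigzag_eq K y y [Bwd y w x, Fwd x w y] []"

definition Ho_Hom ::
  "('x, 'f) wecat \<Rightarrow> 'x \<Rightarrow> 'x \<Rightarrow> ('x, 'f) zigzag_step list set set" where
  "Ho_Hom K x y = {p. zigzag K x y p} // {(p, q). zigzag_eq K x y p q}"

text \<open>Postcomposition with a map \<open>g : y \<rightarrow> z\<close>, as a function \<open>[x, y] \<rightarrow> [x, z]\<close>.\<close>

definition Ho_postcomp ::
  "('x, 'f) wecat \<Rightarrow> 'x \<Rightarrow> 'x \<Rightarrow> 'x \<Rightarrow> 'f
     \<Rightarrow> ('x, 'f) zigzag_step list set \<Rightarrow> ('x, 'f) zigzag_step list set" where
  "Ho_postcomp K x y z g c = (\<Union>p\<in>c. {q. zigzag_eq K x z (p @ [Fwd y g z]) q})"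


section \<open>Dg categories under a fixed one\<close>

text \<open>The category of dg categories \<open>D\<close> equipped with a dg functor \<open>F : C \<rightarrow> D\<close>. The model structure
  induced by Tabuada's enters its homotopy category only through the weak equivalences, which are
  the commutative triangles whose underlying dg functor is a quasi-equivalence.\<close>

type_synonym ('o, 'u) dg_under = "('o, 'u) dgcat \<times> ('o, 'o, 'u) dgfun"

definition under_hom ::
  "'u ring \<Rightarrow> ('o, 'u) dgcat \<Rightarrow> ('o, 'u) dg_under \<Rightarrow> ('o, 'u) dg_under \<Rightarrow> ('o, 'o, 'u) dgfun set" where
  "under_hom R C P Q =
     {G. dg_functor R (fst P) (fst Q) G \<and> dgfun_comp C G (snd P) = snd Q}"

definition under_dgCat ::
  "'u ring \<Rightarrow> ('o, 'u) dgcat \<Rightarrow> (('o, 'u) dg_under, ('o, 'o, 'u) dgfun) wecat" where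
  "under_dgCat R C = \<lparr>
     weOb = {P. dg_functor R C (fst P) (snd P)},
     weHom = under_hom R C,
     weComp = (\<lambda>P Q S G F. dgfun_comp (fst P) G F),
     weId = (\<lambda>P. dgfun_id (fst P)),
     weEq = (\<lambda>P Q. {G \<in> under_hom R C P Q. quasi_equivalence R (fst P) (fst Q) G})\<rparr>"


section \<open>The functor \<open>\<kappa>\<^sub>v\<close>\<close>

definition kappa ::
  "'o \<Rightarrow> 'o \<Rightarrow> int \<Rightarrow> 'u \<Rightarrow> ('o, 'u) dg_under \<Rightarrow> 'u set set" where
  "kappa X Y n v P = (case P of (D, F) \<Rightarrow>
     dg_coset D (onObj F X) (onObj F Y) (n + 1) `
       {w \<in> carrier (dgHom D (onObj F X) (onObj F Y) (n + 1)).
          dgDiff D (onObj F X) (onObj F Y) (n + 1) w = onHom F X Y n v})"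

definition kappa_map ::
  "'o \<Rightarrow> 'o \<Rightarrow> int \<Rightarrow> ('o, 'u) dg_under \<Rightarrow> ('o, 'u) dg_under \<Rightarrow> ('o, 'o, 'u) dgfun
     \<Rightarrow> 'u set \<Rightarrow> 'u set" where
  "kappa_map X Y n P Q G =
     dg_coset_map (fst Q) G (onObj (snd P) X) (onObj (snd P) Y) (n + 1)"


section \<open>The dg category \<open>C/v\<close>\<close>

text \<open>In the dg categories \<open>\<bold>k\<langle>v\<rangle>\<close> and \<open>\<bold>k\<langle>v,w\<rangle>\<close> the objects are \<open>False\<close> (the source of \<open>v\<close>) and
  \<open>True\<close> (its target). Every graded piece of a Hom complex is zero or free on one generator
  (\<open>v\<close>, \<open>w\<close> or an identity); it is represented by the coefficients of that generator. Composition is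
  then multiplication of coefficients, since of two composable generators at least one is an
  identity.\<close>

definition scalar_module :: "'u ring \<Rightarrow> bool \<Rightarrow> ('u, 'u) module" where
  "scalar_module R b =
     \<lparr>carrier = (if b then carrier R else {\<zero>\<^bsub>R\<^esub>}), monoid.mult = monoid.mult R, one = monoid.one R,
      ring.zero = ring.zero R, add = ring.add R, smult = monoid.mult R\<rparr>"

definition k_v :: "'u ring \<Rightarrow> int \<Rightarrow> (bool, 'u) dgcat" where
  "k_v R n = \<lparr>
     dgObj = UNIV,
     dgHom = (\<lambda>x y m. scalar_module R (x = y \<and> m = 0 \<or> \<not> x \<and> y \<and> m = n)),
     dgDiff = (\<lambda>x y m a. \<zero>\<^bsub>R\<^esub>),
     dgComp = (\<lambda>x y z p q g f. g \<otimes>\<^bsub>R\<^esub> f),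
     dgId = (\<lambda>x. \<one>\<^bsub>R\<^esub>)\<rparr>"

definition k_vw :: "'u ring \<Rightarrow> int \<Rightarrow> (bool, 'u) dgcat" where
  "k_vw R n = \<lparr>
     dgObj = UNIV,
     dgHom = (\<lambda>x y m. scalar_module R (x = y \<and> m = 0 \<or> \<not> x \<and> y \<and> (m = n \<or> m = n + 1))),
     dgDiff = (\<lambda>x y m a. if \<not> x \<and> y \<and> m = n + 1 then a else \<zero>\<^bsub>R\<^esub>),
     dgComp = (\<lambda>x y z p q g f. g \<otimes>\<^bsub>R\<^esub> f),
     dgId = (\<lambda>x. \<one>\<^bsub>R\<^esub>)\<rparr>"

definition k_v_incl :: "'u ring \<Rightarrow> int \<Rightarrow> (bool, bool, 'u) dgfun" where
  "k_v_incl R n = \<lparr>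
     onObj = (\<lambda>x. x),
     onHom = (\<lambda>x y m. restrict (\<lambda>a. a) (carrier (dgHom (k_v R n) x y m)))\<rparr>"

text \<open>The dg functor \<open>\<bold>k\<langle>v\<rangle> \<rightarrow> C\<close> classifying a closed morphism \<open>v : X \<rightarrow> Y\<close> of degree \<open>n\<close>.\<close>

definition k_v_classify ::
  "'u ring \<Rightarrow> ('o, 'u) dgcat \<Rightarrow> 'o \<Rightarrow> 'o \<Rightarrow> int \<Rightarrow> 'u \<Rightarrow> (bool, 'o, 'u) dgfun" where
  "k_v_classify R C X Y n v = (let ob = (\<lambda>b. if b then Y else X) in \<lparr>
     onObj = ob,
     onHom = (\<lambda>x y m. restrict
       (\<lambda>r. if x = y \<and> m = 0 then r \<odot>\<^bsub>dgHom C (ob x) (ob y) m\<^esub> dgId C (ob x)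
            else if \<not> x \<and> y \<and> m = n then r \<odot>\<^bsub>dgHom C (ob x) (ob y) m\<^esub> v
            else \<zero>\<^bsub>dgHom C (ob x) (ob y) m\<^esub>)
       (carrier (dgHom (k_v R n) x y m)))\<rparr>)"

text \<open>\<open>P\<close> with \<open>i : B \<rightarrow> P\<close> and \<open>j : B' \<rightarrow> P\<close> is a pushout of \<open>f : A \<rightarrow> B\<close> and \<open>g : A \<rightarrow> B'\<close>.\<close>

definition dg_pushout ::
  "'u ring \<Rightarrow> ('a, 'u) dgcat \<Rightarrow> ('b, 'u) dgcat \<Rightarrow> ('c, 'u) dgcat
     \<Rightarrow> ('a, 'b, 'u) dgfun \<Rightarrow> ('a, 'c, 'u) dgfun
     \<Rightarrow> ('o, 'u) dgcat \<Rightarrow> ('b, 'o, 'u) dgfun \<Rightarrow> ('c, 'o, 'u) dgfun \<Rightarrow> bool" where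
  "dg_pushout R A B B' f g P i j \<longleftrightarrow>
     dg_functor R A B f \<and> dg_functor R A B' g \<and> dg_functor R B P i \<and> dg_functor R B' P j \<and>
     dgfun_comp A i f = dgfun_comp A j g \<and>
     (\<forall>(E :: ('o, 'u) dgcat) h l.
        dg_functor R B E h \<and> dg_functor R B' E l \<and> dgfun_comp A h f = dgfun_comp A l g \<longrightarrow>
        (\<exists>!u. dg_functor R P E u \<and> dgfun_comp B u i = h \<and> dgfun_comp B' u j = l))"

text \<open>\<open>C/v\<close> is determined up to isomorphism; the predicate says that \<open>Cv\<close>, with structure functor
  \<open>I : C \<rightarrow> Cv\<close>, is a pushout of \<open>C \<leftarrow> \<bold>k\<langle>v\<rangle> \<rightarrow> \<bold>k\<langle>v,w\<rangle>\<close>.\<close>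

definition is_C_over_v ::
  "'u ring \<Rightarrow> ('o, 'u) dgcat \<Rightarrow> 'o \<Rightarrow> 'o \<Rightarrow> int \<Rightarrow> 'u \<Rightarrow> ('o, 'u) dg_under \<Rightarrow> bool" where
  "is_C_over_v R C X Y n v P \<longleftrightarrow>
     (\<exists>J. dg_pushout R (k_v R n) C (k_vw R n) (k_v_classify R C X Y n v) (k_v_incl R n)
            (fst P) (snd P) J)"

end

theory Submission
  imports Defs
begin

text \<open>The functor \<open>\<kappa>\<^sub>v\<close> sends quasi-equivalences to bijections, so it extends to the homotopy category and
  every zigzag from \<open>C/v\<close> to \<open>D\<close> carries the universal class \<open>[w]\<close> to a class in \<open>\<kappa>\<^sub>v(D)\<close>. This
  map is natural and has to be shown bijective; the isomorphism of the theorem is its inverse.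

  On honest maps the universal property of the pushout gives more than is asked: a map \<open>C/v \<rightarrow> D\<close> under
  \<open>C\<close> is the same as a morphism \<open>w\<close> of \<open>D\<close> with \<open>d w = F(v)\<close>. So every class in \<open>\<kappa>\<^sub>v(D)\<close> is reached. If two
  such morphisms differ by a boundary \<open>d h\<close>, the three morphisms together define a map from \<open>C/v\<close> to
  the path dg category of \<open>D\<close>, and the two maps to \<open>D\<close> are its two ends; the constant-path functor is a
  quasi-equivalence and a section of both evaluations (\<open>quasi_equivalence_path_const\<close>,
  \<open>path_eval_const\<close>), so the two maps agree in the homotopy category
  (\<open>zigzag_eq_of_common_section\<close>).

  It remains to see that zigzags give nothing new. A step backwards along a quasi-equivalence
  \<open>G : E \<rightarrow> D\<close> can be removed: since \<open>\<kappa>\<^sub>v(G)\<close> is bijective, the class of a map \<open>C/v \<rightarrow> D\<close> lifts to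
  \<open>\<kappa>\<^sub>v(E)\<close>, hence to a map \<open>C/v \<rightarrow> E\<close> whose composite with \<open>G\<close> agrees with the given one in the homotopy
  category. So every zigzag from \<open>C/v\<close> equals a single map (\<open>zigzag_eq_Fwd\<close>). This part of the argument is
  formal and is carried out for an arbitrary set-valued functor that inverts weak equivalences
  (locale \<open>homotopy_universal_element\<close>).

  The path dg category keeps the objects of \<open>D\<close> and has triples of morphisms as morphisms; it exists
  within the given type of morphisms because that type is infinite.\<close>

section \<open>Functors that invert weak equivalences\<close>

lemma zigzag_append:
  "zigzag K x y p \<Longrightarrow> zigzag K y z q \<Longrightarrow> zigzag K x z (p @ q)"
  by (induction rule: zigzag.induct) (auto intro: zigzag.intros)

lemma zigzag_single:
  "\<lbrakk>x \<in> weOb K; y \<in> weOb K; f \<in> weHom K x y\<rbrakk> \<Longrightarrow> zigzag K x y [Fwd x f y]"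
  by (intro zigzag.intros)

text \<open>A functor to sets that makes weak equivalences bijective acts on zigzags: a step traversed backwards
  acts by the inverse bijection.\<close>

fun zigzag_act ::
  "('x \<Rightarrow> 's set) \<Rightarrow> ('x \<Rightarrow> 'x \<Rightarrow> 'f \<Rightarrow> 's \<Rightarrow> 's) \<Rightarrow> ('x, 'f) zigzag_step list \<Rightarrow> 's \<Rightarrow> 's" where
  "zigzag_act T TM [] s = s"
| "zigzag_act T TM (Fwd x f y # p) s = zigzag_act T TM p (TM x y f s)"
| "zigzag_act T TM (Bwd x f y # p) s = zigzag_act T TM p (inv_into (T y) (TM y x f) s)"

lemma zigzag_act_append:
  "zigzag_act T TM (p @ q) s = zigzag_act T TM q (zigzag_act T TM p s)"
  by (induction T TM p s rule: zigzag_act.induct) auto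

text \<open>A functor \<open>T\<close> from a category with weak equivalences to sets, with action \<open>TM\<close> on maps, that turns
  weak equivalences into bijections. Such a functor descends to the homotopy category, which is
  lemma \<open>zigzag_eq_act\<close>; injectivity of the representation below rests on it.\<close>

locale homotopical_set_functor =
  fixes K :: "('x, 'f) wecat"
    and T :: "'x \<Rightarrow> 's set"
    and TM :: "'x \<Rightarrow> 'x \<Rightarrow> 'f \<Rightarrow> 's \<Rightarrow> 's"
  assumes id_hom: "x \<in> weOb K \<Longrightarrow> weId K x \<in> weHom K x x"
    and comp_hom: "\<lbrakk>x \<in> weOb K; y \<in> weOb K; z \<in> weOb K; f \<in> weHom K x y; g \<in> weHom K y z\<rbrakk>
      \<Longrightarrow> weComp K x y z g f \<in> weHom K x z"
    and weEq_hom: "\<lbrakk>x \<in> weOb K; y \<in> weOb K\<rbrakk> \<Longrightarrow> weEq K x y \<subseteq> weHom K x y"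
    and TM_closed: "\<lbrakk>x \<in> weOb K; y \<in> weOb K; f \<in> weHom K x y; s \<in> T x\<rbrakk> \<Longrightarrow> TM x y f s \<in> T y"
    and TM_id: "\<lbrakk>x \<in> weOb K; s \<in> T x\<rbrakk> \<Longrightarrow> TM x x (weId K x) s = s"
    and TM_comp: "\<lbrakk>x \<in> weOb K; y \<in> weOb K; z \<in> weOb K; f \<in> weHom K x y; g \<in> weHom K y z; s \<in> T x\<rbrakk>
      \<Longrightarrow> TM x z (weComp K x y z g f) s = TM y z g (TM x y f s)"
    and TM_weEq: "\<lbrakk>x \<in> weOb K; y \<in> weOb K; w \<in> weEq K x y\<rbrakk> \<Longrightarrow> bij_betw (TM x y w) (T x) (T y)"
begin

lemma zigzag_eq_imp_zigzag:
  "zigzag_eq K x y p q \<Longrightarrow> zigzag K x y p \<and> zigzag K x y q"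
proof (induction rule: zigzag_eq.induct)
  case (ze_append x y p p' z q q')
  then show ?case by (auto intro: zigzag_append)
qed (use id_hom comp_hom weEq_hom[THEN subsetD] in \<open>auto intro!: zigzag.intros\<close>)

lemma zigzag_act_closed:
  "zigzag K x y p \<Longrightarrow> s \<in> T x \<Longrightarrow> zigzag_act T TM p s \<in> T y"
proof (induction arbitrary: s rule: zigzag.induct)
  case (zigzag_Bwd x y f z p)
  then have "inv_into (T y) (TM y x f) s \<in> T y"
    using TM_weEq[of y x f] by (metis bij_betw_imp_surj_on inv_into_into)
  then show ?case using zigzag_Bwd by simp
qed (auto simp: TM_closed)

lemma zigzag_eq_act:
  "zigzag_eq K x y p q \<Longrightarrow> s \<in> T x \<Longrightarrow> zigzag_act T TM p s = zigzag_act T TM q s"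
proof (induction arbitrary: s rule: zigzag_eq.induct)
  case (ze_append x y p p' z q q')
  then show ?case
    using zigzag_act_closed zigzag_eq_imp_zigzag by (metis zigzag_act_append)
next
  case (ze_inv1 x y w)
  then show ?case using TM_weEq[of x y w] by (simp add: bij_betw_inv_into_left)
next
  case (ze_inv2 x y w)
  then show ?case using TM_weEq[of x y w] by (simp add: bij_betw_inv_into_right)
qed (auto simp: TM_id TM_comp)

lemma zigzag_eq_class_eq:
  assumes "zigzag_eq K x y p q"
  shows "{r. zigzag_eq K x y p r} = {r. zigzag_eq K x y q r}"
  by (metis assms ze_sym ze_trans)

lemma zigzag_eq_append_left:
  "\<lbrakk>zigzag_eq K x y p p'; zigzag K y z q\<rbrakk> \<Longrightarrow> zigzag_eq K x z (p @ q) (p' @ q)"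
  by (blast intro: ze_append ze_refl)

lemma zigzag_eq_append_right:
  "\<lbrakk>zigzag K x y p; zigzag_eq K y z q q'\<rbrakk> \<Longrightarrow> zigzag_eq K x z (p @ q) (p @ q')"
  by (blast intro: ze_append ze_refl)

text \<open>Both maps become inverse to \<open>s\<close> in the homotopy category.\<close>

lemma zigzag_eq_of_common_section:
  assumes "x \<in> weOb K" "y \<in> weOb K" "s \<in> weEq K y x" "f \<in> weHom K x y" "g \<in> weHom K x y"
    and "weComp K y x y f s = weId K y" "weComp K y x y g s = weId K y"
  shows "zigzag_eq K x y [Fwd x f y] [Fwd x g y]"
proof -
  have s: "s \<in> weHom K y x" using assms weEq_hom by blast
  have B: "zigzag K x y [Bwd x s y]" using assms by (intro zigzag.intros)
  have inverse: "zigzag_eq K x y [Fwd x h y] [Bwd x s y]"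
    if h: "h \<in> weHom K x y" "weComp K y x y h s = weId K y" for h
  proof -
    have H: "zigzag K x y [Fwd x h y]" using assms h by (intro zigzag.intros)
    have "zigzag_eq K x y [Fwd x h y] ([Bwd x s y, Fwd y s x] @ [Fwd x h y])"
      using zigzag_eq_append_left[OF ze_sym[OF ze_inv2[of y K x s]] H] assms by simp
    moreover have "zigzag_eq K x y ([Bwd x s y] @ [Fwd y s x, Fwd x h y])
                     ([Bwd x s y] @ [Fwd y (weId K y) y])"
      using zigzag_eq_append_right[OF B ze_comp[of y K x y s h]] assms s h by simp
    moreover have "zigzag_eq K x y ([Bwd x s y] @ [Fwd y (weId K y) y]) ([Bwd x s y] @ [])"
      using assms by (intro zigzag_eq_append_right[OF B] ze_id)
    ultimately show ?thesis using ze_trans by (metis append_Cons append_Nil append_Nil2)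
  qed
  show ?thesis using inverse assms by (blast intro: ze_trans ze_sym)
qed

end

section \<open>Representability up to homotopy\<close>

text \<open>A criterion for an object \<open>A\<close> with an element \<open>t\<close> of \<open>T A\<close> to represent \<open>T\<close> on the homotopy category
  that refers only to honest maps out of \<open>A\<close>: they reach every element of \<open>T\<close>, and those that agree
  on \<open>t\<close> agree in the homotopy category.\<close>

locale homotopy_universal_element = homotopical_set_functor K T TM
  for K :: "('x, 'f) wecat" and T :: "'x \<Rightarrow> 's set"
    and TM :: "'x \<Rightarrow> 'x \<Rightarrow> 'f \<Rightarrow> 's \<Rightarrow> 's" +
  fixes A :: 'x and t :: 's
  assumes A: "A \<in> weOb K" and t: "t \<in> T A"
    and reach: "\<lbrakk>x \<in> weOb K; s \<in> T x\<rbrakk> \<Longrightarrow> \<exists>f\<in>weHom K A x. TM A x f t = s"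
    and separate: "\<lbrakk>x \<in> weOb K; f \<in> weHom K A x; g \<in> weHom K A x; TM A x f t = TM A x g t\<rbrakk>
      \<Longrightarrow> zigzag_eq K A x [Fwd A f x] [Fwd A g x]"
begin

text \<open>Zigzags that start at \<open>A\<close> are straightened from the left. A forward step is composed with the map
  reached so far. A backward step along \<open>w\<close> is absorbed because the map \<open>f\<close> reached so far lifts along
  \<open>w\<close>: bijectivity of \<open>T\<close> on \<open>w\<close> gives the element that the lift has to reach, and the composite of
  the lift with \<open>w\<close> agrees with \<open>f\<close> on \<open>t\<close>, hence in the homotopy category.\<close>

lemma Fwd_append_zigzag_eq_Fwd:
  assumes "zigzag K x y p" "f \<in> weHom K A x"
  shows "\<exists>g\<in>weHom K A y. zigzag_eq K A y (Fwd A f x # p) [Fwd A g y]"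
  using assms
proof (induction arbitrary: f rule: zigzag.induct)
  case (zigzag_Nil x)
  then show ?case using A by (auto intro: ze_refl zigzag.intros)
next
  case (zigzag_Fwd x y h z p)
  define f' where "f' = weComp K A x y h f"
  have f': "f' \<in> weHom K A y" unfolding f'_def using zigzag_Fwd A by (intro comp_hom)
  then obtain g where g: "g \<in> weHom K A z" "zigzag_eq K A z (Fwd A f' y # p) [Fwd A g z]"
    using zigzag_Fwd.IH by blast
  have "zigzag_eq K A z ([Fwd A f x, Fwd x h y] @ p) ([Fwd A f' y] @ p)"
    unfolding f'_def using zigzag_Fwd A by (intro zigzag_eq_append_left[OF ze_comp])
  then have "zigzag_eq K A z (Fwd A f x # Fwd x h y # p) (Fwd A f' y # p)" by simp
  then show ?case using g by (metis ze_trans)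
next
  case (zigzag_Bwd x y w z p)
  have w: "w \<in> weHom K y x" using zigzag_Bwd weEq_hom by blast
  \<comment> \<open>The lift of \<open>f\<close> along the weak equivalence \<open>w\<close>, up to homotopy.\<close>
  obtain s where s: "s \<in> T y" "TM y x w s = TM A x f t"
    using TM_weEq[of y x w] TM_closed[OF A _ _ t] zigzag_Bwd
    by (metis bij_betw_imp_surj_on imageE)
  obtain f' where f': "f' \<in> weHom K A y" "TM A y f' t = s"
    using reach s zigzag_Bwd by blast
  then obtain g where g: "g \<in> weHom K A z" "zigzag_eq K A z (Fwd A f' y # p) [Fwd A g z]"
    using zigzag_Bwd.IH by blast
  have wf': "weComp K A y x w f' \<in> weHom K A x" using zigzag_Bwd A f' w by (intro comp_hom)
  have "TM A x (weComp K A y x w f') t = TM A x f t"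
    using TM_comp[of A y x f' w t] A t zigzag_Bwd f' w s by simp
  then have "zigzag_eq K A x [Fwd A f x] [Fwd A (weComp K A y x w f') x]"
    using separate zigzag_Bwd wf' by simp
  moreover have "zigzag_eq K A x [Fwd A (weComp K A y x w f') x] [Fwd A f' y, Fwd y w x]"
    using zigzag_Bwd A f' w by (intro ze_sym[OF ze_comp])
  ultimately have fw: "zigzag_eq K A x [Fwd A f x] [Fwd A f' y, Fwd y w x]" by (rule ze_trans)
  have B: "zigzag K x y [Bwd x w y]" using zigzag_Bwd by (intro zigzag.intros)
  have F: "zigzag K A y [Fwd A f' y]" using zigzag_Bwd A f' by (intro zigzag.intros)
  have "zigzag_eq K A y ([Fwd A f x] @ [Bwd x w y]) ([Fwd A f' y, Fwd y w x] @ [Bwd x w y])"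
    using fw B by (rule zigzag_eq_append_left)
  moreover have "zigzag_eq K A y ([Fwd A f' y] @ [Fwd y w x, Bwd x w y]) ([Fwd A f' y] @ [])"
    using zigzag_Bwd by (intro zigzag_eq_append_right[OF F] ze_inv1)
  ultimately have "zigzag_eq K A y [Fwd A f x, Bwd x w y] [Fwd A f' y]"
    using ze_trans by (metis append_Cons append_Nil append_Nil2)
  from zigzag_eq_append_left[OF this zigzag_Bwd.hyps(4)]
  have "zigzag_eq K A z (Fwd A f x # Bwd x w y # p) (Fwd A f' y # p)" by simp
  then show ?case using g by (metis ze_trans)
qed

lemma zigzag_eq_Fwd:
  assumes "zigzag K A x p"
  shows "\<exists>f\<in>weHom K A x. zigzag_eq K A x p [Fwd A f x]"
proof -
  obtain f where f: "f \<in> weHom K A x" "zigzag_eq K A x (Fwd A (weId K A) A # p) [Fwd A f x]"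
    using Fwd_append_zigzag_eq_Fwd[OF assms id_hom[OF A]] by blast
  have "zigzag_eq K A x ([] @ p) ([Fwd A (weId K A) A] @ p)"
    using A assms by (intro zigzag_eq_append_left[OF ze_sym[OF ze_id]])
  then have "zigzag_eq K A x p (Fwd A (weId K A) A # p)" by simp
  then show ?thesis using f by (metis ze_trans)
qed

text \<open>The map that carries \<open>t\<close> to \<open>s\<close> is a choice, but its class in the homotopy category is not; see
  \<open>represent_eq\<close>.\<close>

definition represent :: "'x \<Rightarrow> 's \<Rightarrow> ('x, 'f) zigzag_step list set" where
  "represent x s = {q. zigzag_eq K A x [Fwd A (SOME f. f \<in> weHom K A x \<and> TM A x f t = s) x] q}"

lemma represent_eq:
  assumes "x \<in> weOb K" "f \<in> weHom K A x"
  shows "represent x (TM A x f t) = {q. zigzag_eq K A x [Fwd A f x] q}"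
proof -
  let ?g = "SOME g. g \<in> weHom K A x \<and> TM A x g t = TM A x f t"
  have "?g \<in> weHom K A x \<and> TM A x ?g t = TM A x f t"
    by (rule someI[of _ f]) (use assms in auto)
  then have "zigzag_eq K A x [Fwd A ?g x] [Fwd A f x]"
    using assms by (intro separate) auto
  then show ?thesis unfolding represent_def by (rule zigzag_eq_class_eq)
qed

theorem represent_bij:
  assumes x: "x \<in> weOb K"
  shows "bij_betw (represent x) (T x) (Ho_Hom K A x)"
proof (rule bij_betw_imageI)
  show "inj_on (represent x) (T x)"
  proof (rule inj_onI)
    fix s s' assume s: "s \<in> T x" "s' \<in> T x" and eq: "represent x s = represent x s'"
    obtain f f' where f: "f \<in> weHom K A x" "TM A x f t = s" and f': "f' \<in> weHom K A x" "TM A x f' t = s'"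
      using reach x s by meson
    have "[Fwd A f x] \<in> represent x s"
      using represent_eq[OF x f(1)] f(2) ze_refl[OF zigzag_single[OF A x f(1)]] by simp
    then have "zigzag_eq K A x [Fwd A f' x] [Fwd A f x]"
      using represent_eq[OF x f'(1)] f'(2) eq by simp
    then show "s = s'" using zigzag_eq_act[of A x _ _ t] f f' t by fastforce
  qed
  show "represent x ` T x = Ho_Hom K A x"
  proof (intro equalityI subsetI)
    fix c assume "c \<in> represent x ` T x"
    then obtain f where f: "f \<in> weHom K A x" "c = {q. zigzag_eq K A x [Fwd A f x] q}"
      using reach[OF x] represent_eq[OF x] by (metis imageE)
    then show "c \<in> Ho_Hom K A x"
      using zigzag_single[OF A x f(1)] by (auto simp: Ho_Hom_def quotient_def)
  next
    fix c assume "c \<in> Ho_Hom K A x"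
    then obtain p where p: "zigzag K A x p" "c = {q. zigzag_eq K A x p q}"
      by (auto simp: Ho_Hom_def quotient_def)
    then obtain f where f: "f \<in> weHom K A x" "zigzag_eq K A x p [Fwd A f x]"
      using zigzag_eq_Fwd by blast
    then have "c = {q. zigzag_eq K A x [Fwd A f x] q}"
      using p zigzag_eq_class_eq by metis
    then show "c \<in> represent x ` T x"
      using represent_eq[OF x f(1)] TM_closed[OF A x f(1) t] by (metis imageI)
  qed
qed

theorem represent_natural:
  assumes x: "x \<in> weOb K" and y: "y \<in> weOb K" and g: "g \<in> weHom K x y" and s: "s \<in> T x"
  shows "represent y (TM x y g s) = Ho_postcomp K A x y g (represent x s)"
proof -
  obtain f where f: "f \<in> weHom K A x" "TM A x f t = s" using reach x s by blast
  let ?gf = "weComp K A x y g f"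
  have gf: "?gf \<in> weHom K A y" using A x y f g by (intro comp_hom)
  have "TM x y g s = TM A y ?gf t" using TM_comp[of A x y f g t] A x y f g t by simp
  then have l: "represent y (TM x y g s) = {q. zigzag_eq K A y [Fwd A ?gf y] q}"
    using represent_eq[OF y gf] by simp
  have r: "represent x s = {q. zigzag_eq K A x [Fwd A f x] q}"
    using represent_eq[OF x f(1)] f(2) by simp
  have post: "zigzag_eq K A y (p @ [Fwd x g y]) [Fwd A ?gf y]" if "zigzag_eq K A x [Fwd A f x] p" for p
  proof -
    have "zigzag_eq K A y (p @ [Fwd x g y]) ([Fwd A f x] @ [Fwd x g y])"
      using that zigzag_single[OF x y g] by (intro zigzag_eq_append_left[OF ze_sym])
    moreover have "zigzag_eq K A y [Fwd A f x, Fwd x g y] [Fwd A ?gf y]"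
      using A x y f g by (intro ze_comp)
    ultimately show ?thesis using ze_trans by (metis append_Cons append_Nil)
  qed
  have "[Fwd A f x] \<in> represent x s"
    using r ze_refl[OF zigzag_single[OF A x f(1)]] by simp
  then show ?thesis
    unfolding Ho_postcomp_def l using zigzag_eq_class_eq[OF post] r by auto
qed

end

section \<open>Elementary calculus in dg categories\<close>

lemma module_hom_closed: "f \<in> module_hom R M N \<Longrightarrow> a \<in> carrier M \<Longrightarrow> f a \<in> carrier N"
  and module_hom_add: "f \<in> module_hom R M N \<Longrightarrow> a \<in> carrier M \<Longrightarrow> b \<in> carrier M
    \<Longrightarrow> f (a \<oplus>\<^bsub>M\<^esub> b) = f a \<oplus>\<^bsub>N\<^esub> f b"
  and module_hom_smult: "f \<in> module_hom R M N \<Longrightarrow> r \<in> carrier R \<Longrightarrow> a \<in> carrier M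
    \<Longrightarrow> f (r \<odot>\<^bsub>M\<^esub> a) = r \<odot>\<^bsub>N\<^esub> f a"
  by (auto simp: module_hom_def)

lemma module_hom_zero:
  assumes "f \<in> module_hom R M N" "abelian_group M" "abelian_group N"
  shows "f \<zero>\<^bsub>M\<^esub> = \<zero>\<^bsub>N\<^esub>"
proof -
  interpret M: abelian_group M by fact
  interpret N: abelian_group N by fact
  have c: "f \<zero>\<^bsub>M\<^esub> \<in> carrier N" using assms by (simp add: module_hom_closed)
  have "f \<zero>\<^bsub>M\<^esub> \<oplus>\<^bsub>N\<^esub> f \<zero>\<^bsub>M\<^esub> = f \<zero>\<^bsub>M\<^esub>"
    using module_hom_add[OF assms(1) M.zero_closed M.zero_closed] by simp
  then show ?thesis using c N.add.r_cancel_one by blast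
qed

lemma module_hom_minus:
  assumes "f \<in> module_hom R M N" "abelian_group M" "abelian_group N" "a \<in> carrier M"
  shows "f (\<ominus>\<^bsub>M\<^esub> a) = \<ominus>\<^bsub>N\<^esub> f a"
proof -
  interpret M: abelian_group M by fact
  interpret N: abelian_group N by fact
  have "f (\<ominus>\<^bsub>M\<^esub> a) \<oplus>\<^bsub>N\<^esub> f a = \<zero>\<^bsub>N\<^esub>"
    using module_hom_add[OF assms(1), of "\<ominus>\<^bsub>M\<^esub> a" a] assms module_hom_zero[OF assms(1-3)]
    by (simp add: M.l_neg)
  then show ?thesis using assms by (simp add: module_hom_closed N.minus_equality)
qed

locale dg_cat =
  fixes R :: "'u ring" and A :: "('o, 'u) dgcat"
  assumes dg_category: "dg_category R A"
begin

lemma hom_module: "x \<in> dgObj A \<Longrightarrow> y \<in> dgObj A \<Longrightarrow> Module.module R (dgHom A x y n)"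
  using dg_category by (simp add: dg_category_def)

lemma hom_group: "x \<in> dgObj A \<Longrightarrow> y \<in> dgObj A \<Longrightarrow> abelian_group (dgHom A x y n)"
  using hom_module Module.module.axioms(2) by blast

lemma diff_hom: "x \<in> dgObj A \<Longrightarrow> y \<in> dgObj A
    \<Longrightarrow> dgDiff A x y n \<in> module_hom R (dgHom A x y n) (dgHom A x y (n - 1))"
  using dg_category by (simp add: dg_category_def)

lemma comp_hom_right:
  "\<lbrakk>x \<in> dgObj A; y \<in> dgObj A; z \<in> dgObj A; g \<in> carrier (dgHom A y z p)\<rbrakk>
    \<Longrightarrow> dgComp A x y z p q g \<in> module_hom R (dgHom A x y q) (dgHom A x z (p + q))"
  using dg_category by (simp add: dg_category_def)

lemma comp_hom_left:
  "\<lbrakk>x \<in> dgObj A; y \<in> dgObj A; z \<in> dgObj A; f \<in> carrier (dgHom A x y q)\<rbrakk>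
    \<Longrightarrow> (\<lambda>g. dgComp A x y z p q g f) \<in> module_hom R (dgHom A y z p) (dgHom A x z (p + q))"
  using dg_category by (simp add: dg_category_def)

text \<open>The degree of a result is a separate variable, tied by an equation, so that the rules apply
  to every presentation of that degree.\<close>

lemma diff_closed:
  "\<lbrakk>x \<in> dgObj A; y \<in> dgObj A; a \<in> carrier (dgHom A x y n); m = n - 1\<rbrakk>
    \<Longrightarrow> dgDiff A x y n a \<in> carrier (dgHom A x y m)"
  by (simp add: module_hom_closed[OF diff_hom])

lemma diff_add:
  "\<lbrakk>x \<in> dgObj A; y \<in> dgObj A; a \<in> carrier (dgHom A x y n); b \<in> carrier (dgHom A x y n)\<rbrakk>
    \<Longrightarrow> dgDiff A x y n (a \<oplus>\<^bsub>dgHom A x y n\<^esub> b) =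
        dgDiff A x y n a \<oplus>\<^bsub>dgHom A x y (n - 1)\<^esub> dgDiff A x y n b"
  by (rule module_hom_add[OF diff_hom])

lemma diff_smult:
  "\<lbrakk>x \<in> dgObj A; y \<in> dgObj A; r \<in> carrier R; a \<in> carrier (dgHom A x y n)\<rbrakk>
    \<Longrightarrow> dgDiff A x y n (r \<odot>\<^bsub>dgHom A x y n\<^esub> a) = r \<odot>\<^bsub>dgHom A x y (n - 1)\<^esub> dgDiff A x y n a"
  by (rule module_hom_smult[OF diff_hom])

lemma diff_zero:
  "\<lbrakk>x \<in> dgObj A; y \<in> dgObj A\<rbrakk>
    \<Longrightarrow> dgDiff A x y n \<zero>\<^bsub>dgHom A x y n\<^esub> = \<zero>\<^bsub>dgHom A x y (n - 1)\<^esub>"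
  by (rule module_hom_zero[OF diff_hom hom_group hom_group])

lemma diff_minus:
  "\<lbrakk>x \<in> dgObj A; y \<in> dgObj A; a \<in> carrier (dgHom A x y n)\<rbrakk>
    \<Longrightarrow> dgDiff A x y n (\<ominus>\<^bsub>dgHom A x y n\<^esub> a) = \<ominus>\<^bsub>dgHom A x y (n - 1)\<^esub> dgDiff A x y n a"
  by (rule module_hom_minus[OF diff_hom hom_group hom_group])

lemma diff_diff:
  "\<lbrakk>x \<in> dgObj A; y \<in> dgObj A; a \<in> carrier (dgHom A x y n); m = n - 1\<rbrakk>
    \<Longrightarrow> dgDiff A x y m (dgDiff A x y n a) = \<zero>\<^bsub>dgHom A x y (m - 1)\<^esub>"
  using dg_category by (simp add: dg_category_def)

lemma comp_closed:
  "\<lbrakk>x \<in> dgObj A; y \<in> dgObj A; z \<in> dgObj A; g \<in> carrier (dgHom A y z p); f \<in> carrier (dgHom A x y q);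
    m = p + q\<rbrakk> \<Longrightarrow> dgComp A x y z p q g f \<in> carrier (dgHom A x z m)"
  by (simp add: module_hom_closed[OF comp_hom_right])

lemma comp_add_right:
  "\<lbrakk>x \<in> dgObj A; y \<in> dgObj A; z \<in> dgObj A; g \<in> carrier (dgHom A y z p);
    f \<in> carrier (dgHom A x y q); f' \<in> carrier (dgHom A x y q)\<rbrakk>
    \<Longrightarrow> dgComp A x y z p q g (f \<oplus>\<^bsub>dgHom A x y q\<^esub> f') =
        dgComp A x y z p q g f \<oplus>\<^bsub>dgHom A x z (p + q)\<^esub> dgComp A x y z p q g f'"
  by (rule module_hom_add[OF comp_hom_right])

lemma comp_add_left:
  "\<lbrakk>x \<in> dgObj A; y \<in> dgObj A; z \<in> dgObj A; g \<in> carrier (dgHom A y z p);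
    g' \<in> carrier (dgHom A y z p); f \<in> carrier (dgHom A x y q)\<rbrakk>
    \<Longrightarrow> dgComp A x y z p q (g \<oplus>\<^bsub>dgHom A y z p\<^esub> g') f =
        dgComp A x y z p q g f \<oplus>\<^bsub>dgHom A x z (p + q)\<^esub> dgComp A x y z p q g' f"
  by (rule module_hom_add[OF comp_hom_left])

lemma comp_smult_right:
  "\<lbrakk>x \<in> dgObj A; y \<in> dgObj A; z \<in> dgObj A; g \<in> carrier (dgHom A y z p);
    f \<in> carrier (dgHom A x y q); r \<in> carrier R\<rbrakk>
    \<Longrightarrow> dgComp A x y z p q g (r \<odot>\<^bsub>dgHom A x y q\<^esub> f) =
        r \<odot>\<^bsub>dgHom A x z (p + q)\<^esub> dgComp A x y z p q g f"
  by (rule module_hom_smult[OF comp_hom_right])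

lemma comp_smult_left:
  "\<lbrakk>x \<in> dgObj A; y \<in> dgObj A; z \<in> dgObj A; g \<in> carrier (dgHom A y z p);
    f \<in> carrier (dgHom A x y q); r \<in> carrier R\<rbrakk>
    \<Longrightarrow> dgComp A x y z p q (r \<odot>\<^bsub>dgHom A y z p\<^esub> g) f =
        r \<odot>\<^bsub>dgHom A x z (p + q)\<^esub> dgComp A x y z p q g f"
  by (rule module_hom_smult[OF comp_hom_left])

lemma comp_zero_right:
  "\<lbrakk>x \<in> dgObj A; y \<in> dgObj A; z \<in> dgObj A; g \<in> carrier (dgHom A y z p)\<rbrakk>
    \<Longrightarrow> dgComp A x y z p q g \<zero>\<^bsub>dgHom A x y q\<^esub> = \<zero>\<^bsub>dgHom A x z (p + q)\<^esub>"
  by (rule module_hom_zero[OF comp_hom_right hom_group hom_group])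

lemma comp_zero_left:
  "\<lbrakk>x \<in> dgObj A; y \<in> dgObj A; z \<in> dgObj A; f \<in> carrier (dgHom A x y q)\<rbrakk>
    \<Longrightarrow> dgComp A x y z p q \<zero>\<^bsub>dgHom A y z p\<^esub> f = \<zero>\<^bsub>dgHom A x z (p + q)\<^esub>"
  by (rule module_hom_zero[OF comp_hom_left hom_group hom_group])

lemma comp_minus_right:
  "\<lbrakk>x \<in> dgObj A; y \<in> dgObj A; z \<in> dgObj A; g \<in> carrier (dgHom A y z p); f \<in> carrier (dgHom A x y q)\<rbrakk>
    \<Longrightarrow> dgComp A x y z p q g (\<ominus>\<^bsub>dgHom A x y q\<^esub> f) = \<ominus>\<^bsub>dgHom A x z (p + q)\<^esub> dgComp A x y z p q g f"
  by (rule module_hom_minus[OF comp_hom_right hom_group hom_group])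

lemma comp_minus_left:
  "\<lbrakk>x \<in> dgObj A; y \<in> dgObj A; z \<in> dgObj A; g \<in> carrier (dgHom A y z p); f \<in> carrier (dgHom A x y q)\<rbrakk>
    \<Longrightarrow> dgComp A x y z p q (\<ominus>\<^bsub>dgHom A y z p\<^esub> g) f = \<ominus>\<^bsub>dgHom A x z (p + q)\<^esub> dgComp A x y z p q g f"
  by (rule module_hom_minus[OF comp_hom_left hom_group hom_group])

lemma leibniz:
  "\<lbrakk>x \<in> dgObj A; y \<in> dgObj A; z \<in> dgObj A; g \<in> carrier (dgHom A y z p); f \<in> carrier (dgHom A x y q);
    m = p + q\<rbrakk>
    \<Longrightarrow> dgDiff A x z m (dgComp A x y z p q g f) =
        dgComp A x y z (p - 1) q (dgDiff A y z p g) f \<oplus>\<^bsub>dgHom A x z (m - 1)\<^esub>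
        koszul (dgHom A x z (m - 1)) p (dgComp A x y z p (q - 1) g (dgDiff A x y q f))"
  using dg_category by (simp add: dg_category_def)

lemma comp_assoc:
  "\<lbrakk>w \<in> dgObj A; x \<in> dgObj A; y \<in> dgObj A; z \<in> dgObj A;
    h \<in> carrier (dgHom A y z p); g \<in> carrier (dgHom A x y q); f \<in> carrier (dgHom A w x r);
    m = q + r; k = p + q\<rbrakk>
    \<Longrightarrow> dgComp A w y z p m h (dgComp A w x y q r g f) =
        dgComp A w x z k r (dgComp A x y z p q h g) f"
  using dg_category by (simp add: dg_category_def)

lemma id_closed: "x \<in> dgObj A \<Longrightarrow> dgId A x \<in> carrier (dgHom A x x 0)"
  and diff_id: "x \<in> dgObj A \<Longrightarrow> dgDiff A x x 0 (dgId A x) = \<zero>\<^bsub>dgHom A x x (- 1)\<^esub>"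
  using dg_category by (simp_all add: dg_category_def)

lemma comp_id_right:
    "\<lbrakk>x \<in> dgObj A; y \<in> dgObj A; a \<in> carrier (dgHom A x y n)\<rbrakk>
      \<Longrightarrow> dgComp A x x y n 0 a (dgId A x) = a"
  and comp_id_left:
    "\<lbrakk>x \<in> dgObj A; y \<in> dgObj A; a \<in> carrier (dgHom A x y n)\<rbrakk>
      \<Longrightarrow> dgComp A x y y 0 n (dgId A y) a = a"
  using dg_category by (simp_all add: dg_category_def)

lemma coset_eq_iff:
  assumes x: "x \<in> dgObj A" and y: "y \<in> dgObj A"
    and a: "a \<in> carrier (dgHom A x y n)" and b: "b \<in> carrier (dgHom A x y n)"
  shows "dg_coset A x y n a = dg_coset A x y n b \<longleftrightarrow>
    (\<exists>h\<in>carrier (dgHom A x y (n + 1)). a = dgDiff A x y (n + 1) h \<oplus>\<^bsub>dgHom A x y n\<^esub> b)"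
proof -
  interpret H: abelian_group "dgHom A x y n" using x y by (rule hom_group)
  interpret H': abelian_group "dgHom A x y (n + 1)" using x y by (rule hom_group)
  have coset: "dg_coset A x y n c =
      {dgDiff A x y (n + 1) h \<oplus>\<^bsub>dgHom A x y n\<^esub> c | h. h \<in> carrier (dgHom A x y (n + 1))}" for c
    by (auto simp: dg_coset_def dg_boundaries_def a_r_coset_def')
  have closed: "h \<in> carrier (dgHom A x y (n + 1))
      \<Longrightarrow> dgDiff A x y (n + 1) h \<in> carrier (dgHom A x y n)" for h
    using x y by (simp add: diff_closed)
  have add: "dgDiff A x y (n + 1) (h \<oplus>\<^bsub>dgHom A x y (n + 1)\<^esub> k) =
      dgDiff A x y (n + 1) h \<oplus>\<^bsub>dgHom A x y n\<^esub> dgDiff A x y (n + 1) k"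
    if "h \<in> carrier (dgHom A x y (n + 1))" "k \<in> carrier (dgHom A x y (n + 1))" for h k
    using diff_add[OF x y that] by simp
  have zero: "dgDiff A x y (n + 1) \<zero>\<^bsub>dgHom A x y (n + 1)\<^esub> = \<zero>\<^bsub>dgHom A x y n\<^esub>"
    using diff_zero[OF x y, of "n + 1"] by simp
  have minus: "dgDiff A x y (n + 1) (\<ominus>\<^bsub>dgHom A x y (n + 1)\<^esub> h) =
      \<ominus>\<^bsub>dgHom A x y n\<^esub> dgDiff A x y (n + 1) h"
    if "h \<in> carrier (dgHom A x y (n + 1))" for h
    using diff_minus[OF x y that] by simp
  show ?thesis
  proof
    assume "dg_coset A x y n a = dg_coset A x y n b"
    moreover have "a \<in> dg_coset A x y n a"
      unfolding coset using zero a by (intro CollectI exI[of _ "\<zero>\<^bsub>dgHom A x y (n + 1)\<^esub>"]) simp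
    ultimately show "\<exists>h\<in>carrier (dgHom A x y (n + 1)).
        a = dgDiff A x y (n + 1) h \<oplus>\<^bsub>dgHom A x y n\<^esub> b"
      unfolding coset by auto
  next
    assume "\<exists>h\<in>carrier (dgHom A x y (n + 1)). a = dgDiff A x y (n + 1) h \<oplus>\<^bsub>dgHom A x y n\<^esub> b"
    then obtain h where h: "h \<in> carrier (dgHom A x y (n + 1))"
      and a_eq: "a = dgDiff A x y (n + 1) h \<oplus>\<^bsub>dgHom A x y n\<^esub> b" by blast
    have sub: "dg_coset A x y n c \<subseteq> dg_coset A x y n e"
      if "k \<in> carrier (dgHom A x y (n + 1))" "c = dgDiff A x y (n + 1) k \<oplus>\<^bsub>dgHom A x y n\<^esub> e"
        "e \<in> carrier (dgHom A x y n)" for c e k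
    proof
      fix t assume "t \<in> dg_coset A x y n c"
      then obtain l where l: "l \<in> carrier (dgHom A x y (n + 1))"
        "t = dgDiff A x y (n + 1) l \<oplus>\<^bsub>dgHom A x y n\<^esub> c" unfolding coset by auto
      have "t = dgDiff A x y (n + 1) (l \<oplus>\<^bsub>dgHom A x y (n + 1)\<^esub> k) \<oplus>\<^bsub>dgHom A x y n\<^esub> e"
        using that l by (simp add: add closed H.a_assoc)
      then show "t \<in> dg_coset A x y n e" unfolding coset using that l by blast
    qed
    have "b = dgDiff A x y (n + 1) (\<ominus>\<^bsub>dgHom A x y (n + 1)\<^esub> h) \<oplus>\<^bsub>dgHom A x y n\<^esub> a"
      unfolding a_eq using h b by (simp add: minus closed H.r_neg1)
    then show "dg_coset A x y n a = dg_coset A x y n b"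
      using sub[OF h a_eq b] sub[of "\<ominus>\<^bsub>dgHom A x y (n + 1)\<^esub> h" b a] h a by auto
  qed
qed

lemma coset_self:
  assumes x: "x \<in> dgObj A" and y: "y \<in> dgObj A" and a: "a \<in> carrier (dgHom A x y n)"
  shows "a \<in> dg_coset A x y n a"
proof -
  interpret H: abelian_group "dgHom A x y n" using x y by (rule hom_group)
  interpret H': abelian_group "dgHom A x y (n + 1)" using x y by (rule hom_group)
  have "\<zero>\<^bsub>dgHom A x y n\<^esub> \<in> dg_boundaries A x y n"
    using diff_zero[OF x y, of "n + 1"] unfolding dg_boundaries_def
    by (metis H'.zero_closed add_diff_cancel_right' imageI)
  then show ?thesis using a unfolding dg_coset_def a_r_coset_def' by force
qed

lemma coset_memD:
  assumes "b \<in> dg_coset A x y n a"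
  obtains h where "h \<in> carrier (dgHom A x y (n + 1))"
    "b = dgDiff A x y (n + 1) h \<oplus>\<^bsub>dgHom A x y n\<^esub> a"
  using assms by (auto simp: dg_coset_def dg_boundaries_def a_r_coset_def')

end

section \<open>Dg functors\<close>

locale dg_fun = A: dg_cat R A + B: dg_cat R B
  for R :: "'u ring" and A :: "('o, 'u) dgcat" and B :: "('p, 'u) dgcat" +
  fixes F :: "('o, 'p, 'u) dgfun"
  assumes dg_functor: "dg_functor R A B F"
begin

lemma obj_closed: "x \<in> dgObj A \<Longrightarrow> onObj F x \<in> dgObj B"
  using dg_functor by (auto simp: dg_functor_def)

lemma obj_ext: "x \<notin> dgObj A \<Longrightarrow> onObj F x = undefined"
  using dg_functor by (auto simp: dg_functor_def)

lemma onHom_outside: "\<not> (x \<in> dgObj A \<and> y \<in> dgObj A) \<Longrightarrow> onHom F x y n = (\<lambda>_. undefined)"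
  using dg_functor unfolding dg_functor_def by blast

lemma onHom_hom: "\<lbrakk>x \<in> dgObj A; y \<in> dgObj A\<rbrakk>
    \<Longrightarrow> onHom F x y n \<in> module_hom R (dgHom A x y n) (dgHom B (onObj F x) (onObj F y) n)"
  using dg_functor by (simp add: dg_functor_def)

lemma onHom_extensional: "\<lbrakk>x \<in> dgObj A; y \<in> dgObj A\<rbrakk>
    \<Longrightarrow> onHom F x y n \<in> extensional (carrier (dgHom A x y n))"
  using dg_functor by (simp add: dg_functor_def)

lemma onHom_closed: "\<lbrakk>x \<in> dgObj A; y \<in> dgObj A; a \<in> carrier (dgHom A x y n)\<rbrakk>
    \<Longrightarrow> onHom F x y n a \<in> carrier (dgHom B (onObj F x) (onObj F y) n)"
  by (rule module_hom_closed[OF onHom_hom])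

lemma onHom_add: "\<lbrakk>x \<in> dgObj A; y \<in> dgObj A; a \<in> carrier (dgHom A x y n); b \<in> carrier (dgHom A x y n)\<rbrakk>
    \<Longrightarrow> onHom F x y n (a \<oplus>\<^bsub>dgHom A x y n\<^esub> b) =
        onHom F x y n a \<oplus>\<^bsub>dgHom B (onObj F x) (onObj F y) n\<^esub> onHom F x y n b"
  by (rule module_hom_add[OF onHom_hom])

lemma onHom_smult: "\<lbrakk>x \<in> dgObj A; y \<in> dgObj A; r \<in> carrier R; a \<in> carrier (dgHom A x y n)\<rbrakk>
    \<Longrightarrow> onHom F x y n (r \<odot>\<^bsub>dgHom A x y n\<^esub> a) =
        r \<odot>\<^bsub>dgHom B (onObj F x) (onObj F y) n\<^esub> onHom F x y n a"
  by (rule module_hom_smult[OF onHom_hom])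

lemma onHom_zero: "\<lbrakk>x \<in> dgObj A; y \<in> dgObj A\<rbrakk>
    \<Longrightarrow> onHom F x y n \<zero>\<^bsub>dgHom A x y n\<^esub> = \<zero>\<^bsub>dgHom B (onObj F x) (onObj F y) n\<^esub>"
  by (rule module_hom_zero[OF onHom_hom A.hom_group B.hom_group[OF obj_closed obj_closed]])

lemma onHom_diff: "\<lbrakk>x \<in> dgObj A; y \<in> dgObj A; a \<in> carrier (dgHom A x y n); m = n - 1\<rbrakk>
    \<Longrightarrow> onHom F x y m (dgDiff A x y n a) = dgDiff B (onObj F x) (onObj F y) n (onHom F x y n a)"
  using dg_functor by (simp add: dg_functor_def)

lemma onHom_comp:
  "\<lbrakk>x \<in> dgObj A; y \<in> dgObj A; z \<in> dgObj A; g \<in> carrier (dgHom A y z p); f \<in> carrier (dgHom A x y q)\<rbrakk>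
    \<Longrightarrow> onHom F x z (p + q) (dgComp A x y z p q g f) =
        dgComp B (onObj F x) (onObj F y) (onObj F z) p q (onHom F y z p g) (onHom F x y q f)"
  using dg_functor by (simp add: dg_functor_def)

lemma onHom_id: "x \<in> dgObj A \<Longrightarrow> onHom F x x 0 (dgId A x) = dgId B (onObj F x)"
  using dg_functor by (simp add: dg_functor_def)

lemma coset_map_coset:
  assumes x: "x \<in> dgObj A" and y: "y \<in> dgObj A" and a: "a \<in> carrier (dgHom A x y n)"
  shows "dg_coset_map B F x y n (dg_coset A x y n a) =
    dg_coset B (onObj F x) (onObj F y) n (onHom F x y n a)"
proof -
  have "dg_coset B (onObj F x) (onObj F y) n (onHom F x y n b) =
      dg_coset B (onObj F x) (onObj F y) n (onHom F x y n a)" if b_mem: "b \<in> dg_coset A x y n a" for b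
  proof -
    obtain h where h: "h \<in> carrier (dgHom A x y (n + 1))"
      and b: "b = dgDiff A x y (n + 1) h \<oplus>\<^bsub>dgHom A x y n\<^esub> a" using A.coset_memD[OF b_mem] by blast
    have dh: "dgDiff A x y (n + 1) h \<in> carrier (dgHom A x y n)"
      using x y h by (simp add: A.diff_closed)
    have bc: "b \<in> carrier (dgHom A x y n)"
      unfolding b using A.hom_group[OF x y] dh a by (simp add: abelian_groupE)
    have "onHom F x y n b = dgDiff B (onObj F x) (onObj F y) (n + 1) (onHom F x y (n + 1) h)
        \<oplus>\<^bsub>dgHom B (onObj F x) (onObj F y) n\<^esub> onHom F x y n a"
      unfolding b using x y a h dh onHom_add onHom_diff[OF x y h, of n] by simp
    then show ?thesis
      using B.coset_eq_iff[OF obj_closed[OF x] obj_closed[OF y] onHom_closed[OF x y bc]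
          onHom_closed[OF x y a]] onHom_closed[OF x y h] by auto
  qed
  then show ?thesis
    unfolding dg_coset_map_def
    by (rule SUP_eq_const[rotated]) (use A.coset_self[OF x y a] in auto)
qed

end

lemma dg_funI: "dg_functor R A B F \<Longrightarrow> dg_fun R A B F"
  by (simp add: dg_fun_def dg_cat_def dg_fun_axioms_def dg_functor_def)

lemma dgfun_eqI:
  assumes F: "dg_functor R A B F" and G: "dg_functor R A B' G"
    and "\<And>x. x \<in> dgObj A \<Longrightarrow> onObj F x = onObj G x"
    and "\<And>x y n a. \<lbrakk>x \<in> dgObj A; y \<in> dgObj A; a \<in> carrier (dgHom A x y n)\<rbrakk>
      \<Longrightarrow> onHom F x y n a = onHom G x y n a"
  shows "F = G"
proof -
  interpret F: dg_fun R A B F using F by (rule dg_funI)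
  interpret G: dg_fun R A B' G using G by (rule dg_funI)
  have "onObj F = onObj G" using assms(3) F.obj_ext G.obj_ext by (metis ext)
  moreover have "onHom F x y n = onHom G x y n" for x y n
  proof (cases "x \<in> dgObj A \<and> y \<in> dgObj A")
    case True
    then show ?thesis using F.onHom_extensional G.onHom_extensional assms(4)
      by (blast intro: extensionalityI)
  qed (simp add: F.onHom_outside G.onHom_outside)
  ultimately show ?thesis by (intro dgfun.equality ext) auto
qed

lemma dg_categoryI:
  assumes "\<And>x y n. \<lbrakk>x \<in> dgObj A; y \<in> dgObj A\<rbrakk> \<Longrightarrow> Module.module R (dgHom A x y n)"
    and "\<And>x y n a. \<lbrakk>x \<in> dgObj A; y \<in> dgObj A; a \<in> carrier (dgHom A x y n)\<rbrakk>
      \<Longrightarrow> dgDiff A x y n a \<in> carrier (dgHom A x y (n - 1))"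
    and "\<And>x y n a b. \<lbrakk>x \<in> dgObj A; y \<in> dgObj A; a \<in> carrier (dgHom A x y n); b \<in> carrier (dgHom A x y n)\<rbrakk>
      \<Longrightarrow> dgDiff A x y n (a \<oplus>\<^bsub>dgHom A x y n\<^esub> b) =
          dgDiff A x y n a \<oplus>\<^bsub>dgHom A x y (n - 1)\<^esub> dgDiff A x y n b"
    and "\<And>x y n r a. \<lbrakk>x \<in> dgObj A; y \<in> dgObj A; r \<in> carrier R; a \<in> carrier (dgHom A x y n)\<rbrakk>
      \<Longrightarrow> dgDiff A x y n (r \<odot>\<^bsub>dgHom A x y n\<^esub> a) = r \<odot>\<^bsub>dgHom A x y (n - 1)\<^esub> dgDiff A x y n a"
    and "\<And>x y n a. \<lbrakk>x \<in> dgObj A; y \<in> dgObj A; a \<in> carrier (dgHom A x y n)\<rbrakk>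
      \<Longrightarrow> dgDiff A x y (n - 1) (dgDiff A x y n a) = \<zero>\<^bsub>dgHom A x y (n - 2)\<^esub>"
    and "\<And>x y z p q g f. \<lbrakk>x \<in> dgObj A; y \<in> dgObj A; z \<in> dgObj A;
        g \<in> carrier (dgHom A y z p); f \<in> carrier (dgHom A x y q)\<rbrakk>
      \<Longrightarrow> dgComp A x y z p q g f \<in> carrier (dgHom A x z (p + q))"
    and "\<And>x y z p q g f f'. \<lbrakk>x \<in> dgObj A; y \<in> dgObj A; z \<in> dgObj A;
        g \<in> carrier (dgHom A y z p); f \<in> carrier (dgHom A x y q); f' \<in> carrier (dgHom A x y q)\<rbrakk>
      \<Longrightarrow> dgComp A x y z p q g (f \<oplus>\<^bsub>dgHom A x y q\<^esub> f') =
          dgComp A x y z p q g f \<oplus>\<^bsub>dgHom A x z (p + q)\<^esub> dgComp A x y z p q g f'"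
    and "\<And>x y z p q g g' f. \<lbrakk>x \<in> dgObj A; y \<in> dgObj A; z \<in> dgObj A;
        g \<in> carrier (dgHom A y z p); g' \<in> carrier (dgHom A y z p); f \<in> carrier (dgHom A x y q)\<rbrakk>
      \<Longrightarrow> dgComp A x y z p q (g \<oplus>\<^bsub>dgHom A y z p\<^esub> g') f =
          dgComp A x y z p q g f \<oplus>\<^bsub>dgHom A x z (p + q)\<^esub> dgComp A x y z p q g' f"
    and "\<And>x y z p q r g f. \<lbrakk>x \<in> dgObj A; y \<in> dgObj A; z \<in> dgObj A; r \<in> carrier R;
        g \<in> carrier (dgHom A y z p); f \<in> carrier (dgHom A x y q)\<rbrakk>
      \<Longrightarrow> dgComp A x y z p q g (r \<odot>\<^bsub>dgHom A x y q\<^esub> f) =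
          r \<odot>\<^bsub>dgHom A x z (p + q)\<^esub> dgComp A x y z p q g f"
    and "\<And>x y z p q r g f. \<lbrakk>x \<in> dgObj A; y \<in> dgObj A; z \<in> dgObj A; r \<in> carrier R;
        g \<in> carrier (dgHom A y z p); f \<in> carrier (dgHom A x y q)\<rbrakk>
      \<Longrightarrow> dgComp A x y z p q (r \<odot>\<^bsub>dgHom A y z p\<^esub> g) f =
          r \<odot>\<^bsub>dgHom A x z (p + q)\<^esub> dgComp A x y z p q g f"
    and "\<And>x y z p q g f. \<lbrakk>x \<in> dgObj A; y \<in> dgObj A; z \<in> dgObj A;
        g \<in> carrier (dgHom A y z p); f \<in> carrier (dgHom A x y q)\<rbrakk>
      \<Longrightarrow> dgDiff A x z (p + q) (dgComp A x y z p q g f) =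
          dgComp A x y z (p - 1) q (dgDiff A y z p g) f \<oplus>\<^bsub>dgHom A x z (p + q - 1)\<^esub>
          koszul (dgHom A x z (p + q - 1)) p (dgComp A x y z p (q - 1) g (dgDiff A x y q f))"
    and "\<And>w x y z p q r h g f. \<lbrakk>w \<in> dgObj A; x \<in> dgObj A; y \<in> dgObj A; z \<in> dgObj A;
        h \<in> carrier (dgHom A y z p); g \<in> carrier (dgHom A x y q); f \<in> carrier (dgHom A w x r)\<rbrakk>
      \<Longrightarrow> dgComp A w y z p (q + r) h (dgComp A w x y q r g f) =
          dgComp A w x z (p + q) r (dgComp A x y z p q h g) f"
    and "\<And>x. x \<in> dgObj A \<Longrightarrow> dgId A x \<in> carrier (dgHom A x x 0)"
    and "\<And>x. x \<in> dgObj A \<Longrightarrow> dgDiff A x x 0 (dgId A x) = \<zero>\<^bsub>dgHom A x x (- 1)\<^esub>"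
    and "\<And>x y n a. \<lbrakk>x \<in> dgObj A; y \<in> dgObj A; a \<in> carrier (dgHom A x y n)\<rbrakk>
      \<Longrightarrow> dgComp A x x y n 0 a (dgId A x) = a"
    and "\<And>x y n a. \<lbrakk>x \<in> dgObj A; y \<in> dgObj A; a \<in> carrier (dgHom A x y n)\<rbrakk>
      \<Longrightarrow> dgComp A x y y 0 n (dgId A y) a = a"
  shows "dg_category R A"
  unfolding dg_category_def module_hom_def
  by (intro conjI ballI allI CollectI funcsetI; (rule assms; assumption))

lemma dg_functorI:
  assumes "dg_category R A" "dg_category R B" "onObj F \<in> dgObj A \<rightarrow>\<^sub>E dgObj B"
    and "\<And>x y n. \<not> (x \<in> dgObj A \<and> y \<in> dgObj A) \<Longrightarrow> onHom F x y n = (\<lambda>_. undefined)"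
    and "\<And>x y n. \<lbrakk>x \<in> dgObj A; y \<in> dgObj A\<rbrakk>
      \<Longrightarrow> onHom F x y n \<in> extensional (carrier (dgHom A x y n))"
    and "\<And>x y n a. \<lbrakk>x \<in> dgObj A; y \<in> dgObj A; a \<in> carrier (dgHom A x y n)\<rbrakk>
      \<Longrightarrow> onHom F x y n a \<in> carrier (dgHom B (onObj F x) (onObj F y) n)"
    and "\<And>x y n a b. \<lbrakk>x \<in> dgObj A; y \<in> dgObj A; a \<in> carrier (dgHom A x y n);
        b \<in> carrier (dgHom A x y n)\<rbrakk>
      \<Longrightarrow> onHom F x y n (a \<oplus>\<^bsub>dgHom A x y n\<^esub> b) =
          onHom F x y n a \<oplus>\<^bsub>dgHom B (onObj F x) (onObj F y) n\<^esub> onHom F x y n b"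
    and "\<And>x y n r a. \<lbrakk>x \<in> dgObj A; y \<in> dgObj A; r \<in> carrier R; a \<in> carrier (dgHom A x y n)\<rbrakk>
      \<Longrightarrow> onHom F x y n (r \<odot>\<^bsub>dgHom A x y n\<^esub> a) =
          r \<odot>\<^bsub>dgHom B (onObj F x) (onObj F y) n\<^esub> onHom F x y n a"
    and "\<And>x y n a. \<lbrakk>x \<in> dgObj A; y \<in> dgObj A; a \<in> carrier (dgHom A x y n)\<rbrakk>
      \<Longrightarrow> onHom F x y (n - 1) (dgDiff A x y n a) =
          dgDiff B (onObj F x) (onObj F y) n (onHom F x y n a)"
    and "\<And>x y z p q g f. \<lbrakk>x \<in> dgObj A; y \<in> dgObj A; z \<in> dgObj A;
        g \<in> carrier (dgHom A y z p); f \<in> carrier (dgHom A x y q)\<rbrakk>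
      \<Longrightarrow> onHom F x z (p + q) (dgComp A x y z p q g f) =
          dgComp B (onObj F x) (onObj F y) (onObj F z) p q (onHom F y z p g) (onHom F x y q f)"
    and "\<And>x. x \<in> dgObj A \<Longrightarrow> onHom F x x 0 (dgId A x) = dgId B (onObj F x)"
  shows "dg_functor R A B F"
  unfolding dg_functor_def module_hom_def
  by (intro conjI ballI allI impI CollectI funcsetI) (use assms in auto)

lemma dgfun_id_apply:
  "x \<in> dgObj A \<Longrightarrow> onObj (dgfun_id A) x = x"
  "\<lbrakk>x \<in> dgObj A; y \<in> dgObj A; a \<in> carrier (dgHom A x y n)\<rbrakk> \<Longrightarrow> onHom (dgfun_id A) x y n a = a"
  by (simp_all add: dgfun_id_def)

lemma dgfun_comp_apply:
  "x \<in> dgObj A \<Longrightarrow> onObj (dgfun_comp A G F) x = onObj G (onObj F x)"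
  "\<lbrakk>x \<in> dgObj A; y \<in> dgObj A; a \<in> carrier (dgHom A x y n)\<rbrakk>
    \<Longrightarrow> onHom (dgfun_comp A G F) x y n a = onHom G (onObj F x) (onObj F y) n (onHom F x y n a)"
  by (simp_all add: dgfun_comp_def)

lemma dg_functor_id:
  assumes "dg_category R A"
  shows "dg_functor R A A (dgfun_id A)"
proof -
  interpret A: dg_cat R A using assms by unfold_locales
  show ?thesis
    using assms
    by (intro dg_functorI)
       (auto simp: dgfun_id_def A.diff_closed A.comp_closed A.id_closed A.hom_group abelian_groupE(1)
         Module.module.smult_closed[OF A.hom_module])
qed

lemma dg_functor_comp:
  assumes F: "dg_functor R A B F" and G: "dg_functor R B E G"
  shows "dg_functor R A E (dgfun_comp A G F)"
proof -
  interpret F: dg_fun R A B F using F by (rule dg_funI)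
  interpret G: dg_fun R B E G using G by (rule dg_funI)
  show ?thesis
  proof (rule dg_functorI)
    show "dg_category R A" "dg_category R E" by (fact F.A.dg_category, fact G.B.dg_category)
  qed (auto simp: dgfun_comp_def F.obj_closed G.obj_closed F.A.diff_closed F.A.comp_closed F.A.id_closed
      F.A.hom_group abelian_groupE(1) Module.module.smult_closed[OF F.A.hom_module]
      F.onHom_closed G.onHom_closed F.onHom_add G.onHom_add F.onHom_smult G.onHom_smult
      F.onHom_diff G.onHom_diff F.onHom_comp G.onHom_comp F.onHom_id G.onHom_id)
qed

lemma dgfun_comp_id_left:
  assumes F: "dg_functor R A B F"
  shows "dgfun_comp A (dgfun_id B) F = F"
proof -
  interpret F: dg_fun R A B F using F by (rule dg_funI)
  show ?thesis
    by (rule dgfun_eqI[OF dg_functor_comp[OF F dg_functor_id] F])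
       (simp_all add: F.B.dg_category dgfun_id_apply dgfun_comp_apply F.obj_closed F.onHom_closed)
qed

lemma dgfun_comp_assoc:
  assumes F: "dg_functor R A B F" and G: "dg_functor R B E G" and H: "dg_functor R E E' H"
  shows "dgfun_comp A H (dgfun_comp A G F) = dgfun_comp A (dgfun_comp B H G) F"
proof -
  interpret F: dg_fun R A B F using F by (rule dg_funI)
  interpret G: dg_fun R B E G using G by (rule dg_funI)
  show ?thesis
    by (rule dgfun_eqI[OF dg_functor_comp[OF dg_functor_comp[OF F G] H]
          dg_functor_comp[OF F dg_functor_comp[OF G H]]])
       (simp_all add: dgfun_comp_apply F.obj_closed F.onHom_closed)
qed

section \<open>The functor \<open>\<kappa>\<^sub>v\<close> inverts quasi-equivalences\<close>

lemma (in dg_cat) cyclesD: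
  assumes "a \<in> dg_cycles A x y n"
  shows "a \<in> carrier (dgHom A x y n)" "dgDiff A x y n a = \<zero>\<^bsub>dgHom A x y (n - 1)\<^esub>"
  using assms by (simp_all add: dg_cycles_def)

locale dg_quasi_equivalence = dg_fun +
  assumes quasi_equivalence: "quasi_equivalence R A B F"
begin

lemma homology_bij: "\<lbrakk>x \<in> dgObj A; y \<in> dgObj A\<rbrakk> \<Longrightarrow>
  bij_betw (dg_coset_map B F x y n) (dg_homology A x y n)
    (dg_homology B (onObj F x) (onObj F y) n)"
  using quasi_equivalence by (simp add: quasi_equivalence_def)

lemma homology_inj:
  assumes "x \<in> dgObj A" "y \<in> dgObj A" "a \<in> dg_cycles A x y n" "b \<in> dg_cycles A x y n"
    and "dg_coset B (onObj F x) (onObj F y) n (onHom F x y n a) =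
      dg_coset B (onObj F x) (onObj F y) n (onHom F x y n b)"
  shows "dg_coset A x y n a = dg_coset A x y n b"
proof -
  have "dg_coset_map B F x y n (dg_coset A x y n a) = dg_coset_map B F x y n (dg_coset A x y n b)"
    using assms A.cyclesD by (simp add: coset_map_coset)
  then show ?thesis
    using bij_betw_imp_inj_on[OF homology_bij[OF assms(1,2)]] assms(3,4)
    unfolding dg_homology_def by (auto dest: inj_onD)
qed

lemma homology_surj:
  assumes "x \<in> dgObj A" "y \<in> dgObj A" "b \<in> dg_cycles B (onObj F x) (onObj F y) n"
  shows "\<exists>a\<in>dg_cycles A x y n. dg_coset B (onObj F x) (onObj F y) n (onHom F x y n a) =
    dg_coset B (onObj F x) (onObj F y) n b"
proof -
  have "dg_coset B (onObj F x) (onObj F y) n b \<in> dg_coset_map B F x y n ` dg_homology A x y n"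
    using homology_bij[OF assms(1,2), of n] assms(3) by (auto simp: bij_betw_def dg_homology_def)
  then obtain a where a: "a \<in> dg_cycles A x y n"
    and eq: "dg_coset B (onObj F x) (onObj F y) n b = dg_coset_map B F x y n (dg_coset A x y n a)"
    unfolding dg_homology_def by blast
  then show ?thesis
    using coset_map_coset[OF assms(1,2) A.cyclesD(1)[OF a]] by auto
qed

text \<open>The solutions \<open>w\<close> of \<open>d w = a\<close>, up to boundaries, form a torsor under the homology in degree
  \<open>n + 1\<close> or the empty set, and \<open>a\<close> decides which through its class in degree \<open>n\<close>. A functor that
  is bijective on both homology groups is therefore bijective on these sets. Surjectivity comes first,
  injectivity is \<open>primitive_inj\<close>.\<close>

lemma lift_primitive:
  assumes x: "x \<in> dgObj A" and y: "y \<in> dgObj A" and a: "a \<in> dg_cycles A x y n"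
    and w: "w \<in> carrier (dgHom B (onObj F x) (onObj F y) (n + 1))"
    and dw: "dgDiff B (onObj F x) (onObj F y) (n + 1) w = onHom F x y n a"
  shows "\<exists>u\<in>carrier (dgHom A x y (n + 1)). dgDiff A x y (n + 1) u = a \<and>
    dg_coset B (onObj F x) (onObj F y) (n + 1) (onHom F x y (n + 1) u) =
    dg_coset B (onObj F x) (onObj F y) (n + 1) w"
proof -
  let ?x = "onObj F x" and ?y = "onObj F y"
  have xy: "?x \<in> dgObj B" "?y \<in> dgObj B" using x y obj_closed by auto
  interpret H: abelian_group "dgHom A x y n" using x y by (rule A.hom_group)
  interpret H1: abelian_group "dgHom A x y (n + 1)" using x y by (rule A.hom_group)
  interpret K: abelian_group "dgHom B ?x ?y n" using xy by (rule B.hom_group)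
  interpret K1: abelian_group "dgHom B ?x ?y (n + 1)" using xy by (rule B.hom_group)
  have ac: "a \<in> carrier (dgHom A x y n)" using a A.cyclesD by blast
  have z: "\<zero>\<^bsub>dgHom A x y n\<^esub> \<in> dg_cycles A x y n"
    using A.diff_zero[OF x y] by (simp add: dg_cycles_def)
  have "dg_coset B ?x ?y n (onHom F x y n a) = dg_coset B ?x ?y n \<zero>\<^bsub>dgHom B ?x ?y n\<^esub>"
    unfolding B.coset_eq_iff[OF xy onHom_closed[OF x y ac] K.zero_closed]
    using w dw onHom_closed[OF x y ac] by (intro bexI[of _ w]) auto
  then have "dg_coset A x y n a = dg_coset A x y n \<zero>\<^bsub>dgHom A x y n\<^esub>"
    using homology_inj[OF x y a z] onHom_zero[OF x y] by simp
  then obtain u where u: "u \<in> carrier (dgHom A x y (n + 1))"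
    and "a = dgDiff A x y (n + 1) u \<oplus>\<^bsub>dgHom A x y n\<^esub> \<zero>\<^bsub>dgHom A x y n\<^esub>"
    using A.coset_eq_iff[OF x y ac H.zero_closed] by blast
  then have du: "dgDiff A x y (n + 1) u = a" using A.diff_closed[OF x y u, of n] by simp
  have Fu: "onHom F x y (n + 1) u \<in> carrier (dgHom B ?x ?y (n + 1))"
    using onHom_closed[OF x y u] .
  have dFu: "dgDiff B ?x ?y (n + 1) (onHom F x y (n + 1) u) = onHom F x y n a"
    using onHom_diff[OF x y u, of n] du by simp
  \<comment> \<open>Correct \<open>u\<close> by a cycle that hits the difference of \<open>w\<close> and the image of \<open>u\<close>.\<close>
  let ?e = "w \<oplus>\<^bsub>dgHom B ?x ?y (n + 1)\<^esub> (\<ominus>\<^bsub>dgHom B ?x ?y (n + 1)\<^esub> onHom F x y (n + 1) u)"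
  have e: "?e \<in> dg_cycles B ?x ?y (n + 1)"
    using w Fu dw dFu B.diff_add[OF xy w K1.a_inv_closed[OF Fu]] B.diff_minus[OF xy Fu]
      onHom_closed[OF x y ac] by (simp add: dg_cycles_def K.r_neg)
  obtain c where c: "c \<in> dg_cycles A x y (n + 1)"
    "dg_coset B ?x ?y (n + 1) (onHom F x y (n + 1) c) = dg_coset B ?x ?y (n + 1) ?e"
    using homology_surj[OF x y e] by blast
  have cc: "c \<in> carrier (dgHom A x y (n + 1))" "dgDiff A x y (n + 1) c = \<zero>\<^bsub>dgHom A x y n\<^esub>"
    using A.cyclesD[OF c(1)] by auto
  have Fc: "onHom F x y (n + 1) c \<in> carrier (dgHom B ?x ?y (n + 1))"
    using onHom_closed[OF x y cc(1)] .
  obtain k where k: "k \<in> carrier (dgHom B ?x ?y (n + 1 + 1))"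
    "onHom F x y (n + 1) c = dgDiff B ?x ?y (n + 1 + 1) k \<oplus>\<^bsub>dgHom B ?x ?y (n + 1)\<^esub> ?e"
    using B.coset_eq_iff[OF xy Fc, of ?e] c(2) w Fu by auto
  have dk: "dgDiff B ?x ?y (n + 1 + 1) k \<in> carrier (dgHom B ?x ?y (n + 1))"
    using B.diff_closed[OF xy k(1), of "n + 1"] by simp
  have "onHom F x y (n + 1) (c \<oplus>\<^bsub>dgHom A x y (n + 1)\<^esub> u) =
      dgDiff B ?x ?y (n + 1 + 1) k \<oplus>\<^bsub>dgHom B ?x ?y (n + 1)\<^esub> w"
    using onHom_add[OF x y cc(1) u] k(2) dk w Fu by (simp add: K1.a_assoc K1.l_neg)
  then have "dg_coset B ?x ?y (n + 1) (onHom F x y (n + 1) (c \<oplus>\<^bsub>dgHom A x y (n + 1)\<^esub> u)) =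
      dg_coset B ?x ?y (n + 1) w"
    using B.coset_eq_iff[OF xy onHom_closed[OF x y] w] cc u k(1) by blast
  moreover have "dgDiff A x y (n + 1) (c \<oplus>\<^bsub>dgHom A x y (n + 1)\<^esub> u) = a"
    using A.diff_add[OF x y cc(1) u] cc du ac by simp
  ultimately show ?thesis using cc(1) u by blast
qed

text \<open>The difference of two primitives of the same element is a cycle, so this is injectivity on homology
  applied to that difference.\<close>

lemma primitive_inj:
  assumes x: "x \<in> dgObj A" and y: "y \<in> dgObj A"
    and u: "u \<in> carrier (dgHom A x y n)" and w: "w \<in> carrier (dgHom A x y n)"
    and d: "dgDiff A x y n u = dgDiff A x y n w"
    and eq: "dg_coset B (onObj F x) (onObj F y) n (onHom F x y n u) =
      dg_coset B (onObj F x) (onObj F y) n (onHom F x y n w)"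
  shows "dg_coset A x y n u = dg_coset A x y n w"
proof -
  let ?x = "onObj F x" and ?y = "onObj F y"
  have xy: "?x \<in> dgObj B" "?y \<in> dgObj B" using x y obj_closed by auto
  interpret H: abelian_group "dgHom A x y n" using x y by (rule A.hom_group)
  interpret H1: abelian_group "dgHom A x y (n - 1)" using x y by (rule A.hom_group)
  interpret K: abelian_group "dgHom B ?x ?y n" using xy by (rule B.hom_group)
  have Fu: "onHom F x y n u \<in> carrier (dgHom B ?x ?y n)" and Fw: "onHom F x y n w \<in> carrier (dgHom B ?x ?y n)"
    using onHom_closed[OF x y] u w by auto
  let ?e = "u \<oplus>\<^bsub>dgHom A x y n\<^esub> (\<ominus>\<^bsub>dgHom A x y n\<^esub> w)"
  have ec: "?e \<in> carrier (dgHom A x y n)" using u w by simp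
  have e: "?e \<in> dg_cycles A x y n"
    using u w d A.diff_add[OF x y u H.a_inv_closed[OF w]] A.diff_minus[OF x y w]
      A.diff_closed[OF x y w] by (simp add: dg_cycles_def H1.r_neg)
  have z: "\<zero>\<^bsub>dgHom A x y n\<^esub> \<in> dg_cycles A x y n"
    using A.diff_zero[OF x y] by (simp add: dg_cycles_def)
  obtain k where k: "k \<in> carrier (dgHom B ?x ?y (n + 1))"
    "onHom F x y n u = dgDiff B ?x ?y (n + 1) k \<oplus>\<^bsub>dgHom B ?x ?y n\<^esub> onHom F x y n w"
    using B.coset_eq_iff[OF xy Fu Fw] eq by blast
  have dk: "dgDiff B ?x ?y (n + 1) k \<in> carrier (dgHom B ?x ?y n)"
    using B.diff_closed[OF xy k(1)] by simp
  have "onHom F x y n ?e \<oplus>\<^bsub>dgHom B ?x ?y n\<^esub> onHom F x y n w =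
      dgDiff B ?x ?y (n + 1) k \<oplus>\<^bsub>dgHom B ?x ?y n\<^esub> onHom F x y n w"
    using onHom_add[OF x y ec w] k(2) u w by (simp add: H.a_assoc H.l_neg)
  then have "onHom F x y n ?e = dgDiff B ?x ?y (n + 1) k \<oplus>\<^bsub>dgHom B ?x ?y n\<^esub> onHom F x y n \<zero>\<^bsub>dgHom A x y n\<^esub>"
    using onHom_closed[OF x y ec] dk Fw onHom_zero[OF x y] by simp
  then have "dg_coset B ?x ?y n (onHom F x y n ?e) = dg_coset B ?x ?y n (onHom F x y n \<zero>\<^bsub>dgHom A x y n\<^esub>)"
    using B.coset_eq_iff[OF xy onHom_closed[OF x y ec] onHom_closed[OF x y H.zero_closed]] k(1) by blast
  then have "dg_coset A x y n ?e = dg_coset A x y n \<zero>\<^bsub>dgHom A x y n\<^esub>"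
    by (rule homology_inj[OF x y e z])
  then obtain h where h: "h \<in> carrier (dgHom A x y (n + 1))"
    "?e = dgDiff A x y (n + 1) h \<oplus>\<^bsub>dgHom A x y n\<^esub> \<zero>\<^bsub>dgHom A x y n\<^esub>"
    using A.coset_eq_iff[OF x y ec H.zero_closed] by blast
  have dh: "dgDiff A x y (n + 1) h \<in> carrier (dgHom A x y n)"
    using A.diff_closed[OF x y h(1)] by simp
  have "u = ?e \<oplus>\<^bsub>dgHom A x y n\<^esub> w" using u w by (simp add: H.a_assoc H.l_neg)
  then have "u = dgDiff A x y (n + 1) h \<oplus>\<^bsub>dgHom A x y n\<^esub> w" using h(2) dh by simp
  then show ?thesis using A.coset_eq_iff[OF x y u w] h(1) by blast
qed

end

locale closed_morphism = C: dg_cat R C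
  for R :: "'u ring" and C :: "('o, 'u) dgcat" +
  fixes X Y :: 'o and n :: int and v :: 'u
  assumes X: "X \<in> dgObj C" and Y: "Y \<in> dgObj C" and v: "v \<in> dg_cycles C X Y n"
begin

abbreviation K where "K \<equiv> under_dgCat R C"

lemma v_closed: "v \<in> carrier (dgHom C X Y n)" and dv: "dgDiff C X Y n v = \<zero>\<^bsub>dgHom C X Y (n - 1)\<^esub>"
  using v C.cyclesD by blast+

lemma under_ob_iff: "P \<in> weOb K \<longleftrightarrow> dg_functor R C (fst P) (snd P)"
  by (simp add: under_dgCat_def)

lemma under_hom_iff: "G \<in> weHom K P Q \<longleftrightarrow>
    dg_functor R (fst P) (fst Q) G \<and> dgfun_comp C G (snd P) = snd Q"
  by (simp add: under_dgCat_def under_hom_def)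

lemma under_weEq_iff: "G \<in> weEq K P Q \<longleftrightarrow>
    G \<in> weHom K P Q \<and> quasi_equivalence R (fst P) (fst Q) G"
  by (simp add: under_dgCat_def)

lemma under_id_comp: "weId K P = dgfun_id (fst P)" "weComp K P Q S G F = dgfun_comp (fst P) G F"
  by (simp_all add: under_dgCat_def)

lemma under_hom_apply:
  assumes "G \<in> weHom K P Q"
  shows "onObj (snd Q) X = onObj G (onObj (snd P) X)" "onObj (snd Q) Y = onObj G (onObj (snd P) Y)"
    and "onHom (snd Q) X Y n v = onHom G (onObj (snd P) X) (onObj (snd P) Y) n (onHom (snd P) X Y n v)"
proof -
  have "snd Q = dgfun_comp C G (snd P)" using assms by (simp add: under_hom_iff)
  then show "onObj (snd Q) X = onObj G (onObj (snd P) X)" "onObj (snd Q) Y = onObj G (onObj (snd P) Y)"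
    "onHom (snd Q) X Y n v = onHom G (onObj (snd P) X) (onObj (snd P) Y) n (onHom (snd P) X Y n v)"
    using X Y v_closed by (simp_all add: dgfun_comp_apply)
qed

text \<open>The set of which \<open>\<kappa>\<^sub>v\<close> is the quotient, and the quotient map.\<close>

definition primitives :: "('o, 'u) dg_under \<Rightarrow> 'u set" where
  "primitives P = {w \<in> carrier (dgHom (fst P) (onObj (snd P) X) (onObj (snd P) Y) (n + 1)).
     dgDiff (fst P) (onObj (snd P) X) (onObj (snd P) Y) (n + 1) w = onHom (snd P) X Y n v}"

definition kappa_class :: "('o, 'u) dg_under \<Rightarrow> 'u \<Rightarrow> 'u set" where
  "kappa_class P = dg_coset (fst P) (onObj (snd P) X) (onObj (snd P) Y) (n + 1)"

lemma kappa_eq: "kappa X Y n v P = kappa_class P ` primitives P"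
  by (cases P) (simp add: kappa_def primitives_def kappa_class_def)

abbreviation hom_value :: "('o, 'u) dg_under \<Rightarrow> ('o, 'o, 'u) dgfun \<Rightarrow> 'u \<Rightarrow> 'u" where
  "hom_value P G \<equiv> onHom G (onObj (snd P) X) (onObj (snd P) Y) (n + 1)"

lemma under_obj:
  assumes "P \<in> weOb K"
  shows "onObj (snd P) X \<in> dgObj (fst P)" "onObj (snd P) Y \<in> dgObj (fst P)"
    "onHom (snd P) X Y n v \<in> dg_cycles (fst P) (onObj (snd P) X) (onObj (snd P) Y) n"
    "dg_cat R (fst P)"
proof -
  interpret P: dg_fun R C "fst P" "snd P" using assms by (intro dg_funI) (simp add: under_ob_iff)
  show XY: "onObj (snd P) X \<in> dgObj (fst P)" "onObj (snd P) Y \<in> dgObj (fst P)"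
    using X Y P.obj_closed by auto
  show "onHom (snd P) X Y n v \<in> dg_cycles (fst P) (onObj (snd P) X) (onObj (snd P) Y) n"
    using P.onHom_diff[OF X Y v_closed, of "n - 1"] P.onHom_zero[OF X Y] dv
      P.onHom_closed[OF X Y v_closed] by (simp add: dg_cycles_def)
  show "dg_cat R (fst P)" by unfold_locales
qed

lemma kappa_map_class:
  assumes P: "P \<in> weOb K" and G: "G \<in> weHom K P Q" and w: "w \<in> primitives P"
  shows "hom_value P G w \<in> primitives Q"
    and "kappa_map X Y n P Q G (kappa_class P w) = kappa_class Q (hom_value P G w)"
proof -
  interpret G: dg_fun R "fst P" "fst Q" G using G by (intro dg_funI) (simp add: under_hom_iff)
  note XY = under_obj(1,2)[OF P]
  note GXY = under_hom_apply[OF G]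
  have wc: "w \<in> carrier (dgHom (fst P) (onObj (snd P) X) (onObj (snd P) Y) (n + 1))"
    and dw: "dgDiff (fst P) (onObj (snd P) X) (onObj (snd P) Y) (n + 1) w = onHom (snd P) X Y n v"
    using w by (auto simp: primitives_def)
  show "hom_value P G w \<in> primitives Q"
    using G.onHom_closed[OF XY wc] G.onHom_diff[OF XY wc, of n] dw
    by (simp add: primitives_def GXY)
  show "kappa_map X Y n P Q G (kappa_class P w) = kappa_class Q (hom_value P G w)"
    using G.coset_map_coset[OF XY wc] by (simp add: kappa_map_def kappa_class_def GXY)
qed

text \<open>Here \<open>F(v)\<close> plays the role of the element whose primitives are compared along a quasi-equivalence.\<close>

sublocale homotopical_set_functor K "kappa X Y n v" "kappa_map X Y n"
proof unfold_locales
  fix P assume P: "P \<in> weOb K"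
  then show id: "weId K P \<in> weHom K P P"
    using under_obj(4)[OF P] dgfun_comp_id_left dg_functor_id
    by (auto simp: under_hom_iff under_ob_iff under_id_comp dg_cat_def)
  fix c assume "c \<in> kappa X Y n v P"
  then obtain w where w: "w \<in> primitives P" "c = kappa_class P w" by (auto simp: kappa_eq)
  have "hom_value P (weId K P) w = w"
    using w under_obj[OF P] by (simp add: under_id_comp dgfun_id_apply primitives_def)
  then show "kappa_map X Y n P P (weId K P) c = c"
    using kappa_map_class(2)[OF P id w(1)] w by simp
next
  fix P Q S F G
  assume P: "P \<in> weOb K" and Q: "Q \<in> weOb K" and "S \<in> weOb K"
    and F: "F \<in> weHom K P Q" and G: "G \<in> weHom K Q S"
  show GF: "weComp K P Q S G F \<in> weHom K P S"
    using F G P dg_functor_comp[of R "fst P" "fst Q" F "fst S" G]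
      dgfun_comp_assoc[of R C "fst P" "snd P" "fst Q" F "fst S" G]
    by (simp add: under_hom_iff under_ob_iff under_id_comp)
  fix c assume "c \<in> kappa X Y n v P"
  then obtain w where w: "w \<in> primitives P" "c = kappa_class P w" by (auto simp: kappa_eq)
  have "hom_value P (weComp K P Q S G F) w = hom_value Q G (hom_value P F w)"
    using w under_obj[OF P] under_hom_apply[OF F]
    by (simp add: under_id_comp dgfun_comp_apply primitives_def)
  then show "kappa_map X Y n P S (weComp K P Q S G F) c =
      kappa_map X Y n Q S G (kappa_map X Y n P Q F c)"
    using kappa_map_class[OF P GF w(1)] kappa_map_class[OF P F w(1)] kappa_map_class[OF Q G] w by simp
next
  fix P Q assume "P \<in> weOb K" "Q \<in> weOb K"
  show "weEq K P Q \<subseteq> weHom K P Q" by (auto simp: under_weEq_iff)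
next
  fix P Q F c assume P: "P \<in> weOb K" and "Q \<in> weOb K" and F: "F \<in> weHom K P Q"
    and "c \<in> kappa X Y n v P"
  then show "kappa_map X Y n P Q F c \<in> kappa X Y n v Q"
    using kappa_map_class[OF P F] by (auto simp: kappa_eq)
next
  fix P Q G assume P: "P \<in> weOb K" and Q: "Q \<in> weOb K" and "G \<in> weEq K P Q"
  then have G: "G \<in> weHom K P Q" and qe: "quasi_equivalence R (fst P) (fst Q) G"
    by (auto simp: under_weEq_iff)
  interpret G: dg_fun R "fst P" "fst Q" G using G by (intro dg_funI) (simp add: under_hom_iff)
  interpret G: dg_quasi_equivalence R "fst P" "fst Q" G using qe by unfold_locales
  note PXY = under_obj(1,2)[OF P]
  note GXY = under_hom_apply[OF G]
  show "bij_betw (kappa_map X Y n P Q G) (kappa X Y n v P) (kappa X Y n v Q)"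
  proof (rule bij_betw_imageI)
    show "inj_on (kappa_map X Y n P Q G) (kappa X Y n v P)"
    proof (rule inj_onI)
      fix c c' assume "c \<in> kappa X Y n v P" "c' \<in> kappa X Y n v P"
        and eq: "kappa_map X Y n P Q G c = kappa_map X Y n P Q G c'"
      then obtain w w' where w: "w \<in> primitives P" "c = kappa_class P w"
        and w': "w' \<in> primitives P" "c' = kappa_class P w'"
        by (auto simp: kappa_eq)
      then have "kappa_class Q (hom_value P G w) = kappa_class Q (hom_value P G w')"
        using eq kappa_map_class(2)[OF P G] by simp
      then show "c = c'"
        using w w' G.primitive_inj[OF PXY, of w "n + 1" w']
        by (simp add: kappa_class_def primitives_def GXY)
    qed
    show "kappa_map X Y n P Q G ` kappa X Y n v P = kappa X Y n v Q"
    proof (intro equalityI subsetI)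
      fix c assume "c \<in> kappa_map X Y n P Q G ` kappa X Y n v P"
      then show "c \<in> kappa X Y n v Q" using kappa_map_class[OF P G] by (auto simp: kappa_eq)
    next
      fix c assume "c \<in> kappa X Y n v Q"
      then obtain w where w: "w \<in> primitives Q" "c = kappa_class Q w" by (auto simp: kappa_eq)
      then obtain u where "u \<in> primitives P" "kappa_class Q (hom_value P G u) = kappa_class Q w"
        using G.lift_primitive[OF PXY under_obj(3)[OF P], of w]
        by (auto simp: primitives_def kappa_class_def GXY)
      then show "c \<in> kappa_map X Y n P Q G ` kappa X Y n v P"
        using kappa_map_class(2)[OF P G] w by (force simp: kappa_eq)
    qed
  qed
qed

end

section \<open>The path dg category\<close>

text \<open>The morphisms of the path dg category of \<open>A\<close> are triples of morphisms of \<open>A\<close>. All morphisms are taken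
  from one type, so triples are encoded in that type, which is possible because it is infinite.\<close>

definition encode_triple :: "'u::infinite \<times> 'u \<times> 'u \<Rightarrow> 'u" where
  "encode_triple = (SOME e. bij e)"

lemma bij_encode_triple: "bij (encode_triple :: 'u::infinite \<times> 'u \<times> 'u \<Rightarrow> 'u)"
proof -
  have "|UNIV \<times> UNIV :: ('u \<times> 'u) set| =o |UNIV :: 'u set|"
    by (rule card_of_Times_same_infinite) (rule infinite_UNIV)
  then obtain e :: "'u \<times> 'u \<Rightarrow> 'u" where e: "bij e"
    using card_of_ordIso[of "UNIV :: ('u \<times> 'u) set" "UNIV :: 'u set"] by auto
  have "bij (\<lambda>(a, s). e (a, e s))"
  proof (rule bijI)
    show "inj (\<lambda>(a, s). e (a, e s))"
      by (rule injI) (auto dest!: injD[OF bij_is_inj[OF e]])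
    show "surj (\<lambda>(a, s). e (a, e s))"
    proof (unfold surj_def, rule allI)
      fix t
      obtain a b where "t = e (a, b)" using bij_is_surj[OF e] by (metis surjE surj_pair)
      moreover obtain s where "b = e s" using bij_is_surj[OF e] by (metis surjE)
      ultimately show "\<exists>x. t = (\<lambda>(a, s). e (a, e s)) x"
        by (intro exI[of _ "(a, s)"]) simp
    qed
  qed
  then show ?thesis unfolding encode_triple_def by (rule someI[of bij])
qed

definition triple :: "'u::infinite \<Rightarrow> 'u \<Rightarrow> 'u \<Rightarrow> 'u" where
  "triple a b c = encode_triple (a, b, c)"

text \<open>A triple is read as a path: a morphism where it starts, a morphism where it finishes, and a
  homotopy that links them.\<close>

definition start :: "'u::infinite \<Rightarrow> 'u" where "start t = fst (inv_into UNIV encode_triple t)"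
definition finish :: "'u::infinite \<Rightarrow> 'u" where "finish t = fst (snd (inv_into UNIV encode_triple t))"
definition link :: "'u::infinite \<Rightarrow> 'u" where "link t = snd (snd (inv_into UNIV encode_triple t))"

lemma triple_simps [simp]:
  "start (triple a b c) = a" "finish (triple a b c) = b" "link (triple a b c) = c"
  by (simp_all add: triple_def start_def finish_def link_def inv_into_f_f[OF bij_is_inj[OF bij_encode_triple] UNIV_I])

lemma triple_eq_iff [simp]: "triple a b c = triple a' b' c' \<longleftrightarrow> a = a' \<and> b = b' \<and> c = c'"
  by (metis triple_simps)

definition triple_module ::
  "('r, 'u::infinite) module \<Rightarrow> ('r, 'u) module \<Rightarrow> ('r, 'u) module \<Rightarrow> ('r, 'u) module" where
  "triple_module L M N = L\<lparr>
     carrier := {triple a b c | a b c. a \<in> carrier L \<and> b \<in> carrier M \<and> c \<in> carrier N},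
     ring.zero := triple \<zero>\<^bsub>L\<^esub> \<zero>\<^bsub>M\<^esub> \<zero>\<^bsub>N\<^esub>,
     add := (\<lambda>s t. triple (start s \<oplus>\<^bsub>L\<^esub> start t) (finish s \<oplus>\<^bsub>M\<^esub> finish t) (link s \<oplus>\<^bsub>N\<^esub> link t)),
     smult := (\<lambda>r t. triple (r \<odot>\<^bsub>L\<^esub> start t) (r \<odot>\<^bsub>M\<^esub> finish t) (r \<odot>\<^bsub>N\<^esub> link t))\<rparr>"

lemma triple_module_simps [simp]:
  "triple a b c \<in> carrier (triple_module L M N) \<longleftrightarrow>
     a \<in> carrier L \<and> b \<in> carrier M \<and> c \<in> carrier N"
  "triple a b c \<oplus>\<^bsub>triple_module L M N\<^esub> triple a' b' c' =
     triple (a \<oplus>\<^bsub>L\<^esub> a') (b \<oplus>\<^bsub>M\<^esub> b') (c \<oplus>\<^bsub>N\<^esub> c')"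
  "\<zero>\<^bsub>triple_module L M N\<^esub> = triple \<zero>\<^bsub>L\<^esub> \<zero>\<^bsub>M\<^esub> \<zero>\<^bsub>N\<^esub>"
  "r \<odot>\<^bsub>triple_module L M N\<^esub> triple a b c = triple (r \<odot>\<^bsub>L\<^esub> a) (r \<odot>\<^bsub>M\<^esub> b) (r \<odot>\<^bsub>N\<^esub> c)"
  by (auto simp: triple_module_def)

lemma triple_module_cases:
  assumes "t \<in> carrier (triple_module L M N)"
  obtains a b c where "t = triple a b c" "a \<in> carrier L" "b \<in> carrier M" "c \<in> carrier N"
  using assms by (auto simp: triple_module_def)

lemma module_triple_module:
  assumes "Module.module R L" "Module.module R M" "Module.module R N"
  shows "Module.module R (triple_module L M N)"
proof -
  interpret L: Module.module R L by fact
  interpret M: Module.module R M by fact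
  interpret N: Module.module R N by fact
  show ?thesis
  proof (rule moduleI)
    show "cring R" by unfold_locales
    show "abelian_group (triple_module L M N)"
    proof (rule abelian_groupI)
      fix s assume "s \<in> carrier (triple_module L M N)"
      then obtain a b c where s: "s = triple a b c" "a \<in> carrier L" "b \<in> carrier M" "c \<in> carrier N"
        by (rule triple_module_cases)
      then show "\<exists>t\<in>carrier (triple_module L M N). t \<oplus>\<^bsub>triple_module L M N\<^esub> s = \<zero>\<^bsub>triple_module L M N\<^esub>"
        by (intro bexI[of _ "triple (\<ominus>\<^bsub>L\<^esub> a) (\<ominus>\<^bsub>M\<^esub> b) (\<ominus>\<^bsub>N\<^esub> c)"])
           (simp_all add: L.l_neg M.l_neg N.l_neg)
    qed (auto elim!: triple_module_cases simp: L.a_ac M.a_ac N.a_ac)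
  qed (auto elim!: triple_module_cases simp: L.smult_l_distr M.smult_l_distr N.smult_l_distr
      L.smult_r_distr M.smult_r_distr N.smult_r_distr L.smult_assoc1 M.smult_assoc1 N.smult_assoc1)
qed

lemma triple_module_minus:
  assumes "Module.module R L" "Module.module R M" "Module.module R N"
    and "a \<in> carrier L" "b \<in> carrier M" "c \<in> carrier N"
  shows "\<ominus>\<^bsub>triple_module L M N\<^esub> triple a b c = triple (\<ominus>\<^bsub>L\<^esub> a) (\<ominus>\<^bsub>M\<^esub> b) (\<ominus>\<^bsub>N\<^esub> c)"
proof -
  interpret L: Module.module R L by fact
  interpret M: Module.module R M by fact
  interpret N: Module.module R N by fact
  interpret T: Module.module R "triple_module L M N"
    using assms by (intro module_triple_module)
  show ?thesis
    using assms by (intro T.minus_equality) (simp_all add: L.l_neg M.l_neg N.l_neg)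
qed

context abelian_group
begin

lemma a_inv_zero: "\<ominus> \<zero> = \<zero>"
  using r_neg[OF zero_closed] l_zero[OF a_inv_closed[OF zero_closed]] by simp

lemma minus_minus_add:
  "\<lbrakk>a \<in> carrier G; b \<in> carrier G; c \<in> carrier G; a' \<in> carrier G; b' \<in> carrier G; c' \<in> carrier G\<rbrakk>
    \<Longrightarrow> a \<oplus> a' \<ominus> (b \<oplus> b') \<ominus> (c \<oplus> c') = (a \<ominus> b \<ominus> c) \<oplus> (a' \<ominus> b' \<ominus> c')"
  by (simp add: minus_eq minus_add a_ac)

text \<open>The Leibniz rule in the third component of the path dg category, with a name for each of its terms.
  The term \<open>s\<close> stands for the composite of the finish of the left factor with the start of the right
  factor; it occurs twice on the right, with opposite signs.\<close>

lemma insert_difference: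
  assumes "a \<in> carrier G" "b \<in> carrier G" "c \<in> carrier G" "e \<in> carrier G"
    "u \<in> carrier G" "w \<in> carrier G" "s \<in> carrier G"
  shows "a \<ominus> b \<ominus> ((c \<ominus> e) \<oplus> (u \<oplus> w)) = ((a \<ominus> s \<ominus> c) \<ominus> u) \<oplus> (e \<oplus> (s \<ominus> b \<ominus> w))"
proof -
  have "((a \<ominus> s \<ominus> c) \<ominus> u) \<oplus> (e \<oplus> (s \<ominus> b \<ominus> w)) = ((a \<ominus> c \<ominus> u) \<oplus> \<ominus> s) \<oplus> (s \<oplus> (e \<ominus> b \<ominus> w))"
    using assms by (simp add: minus_eq a_ac)
  also have "\<dots> = (a \<ominus> c \<ominus> u) \<oplus> (e \<ominus> b \<ominus> w)"
    using assms by (simp add: a_assoc r_neg1)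
  also have "\<dots> = a \<ominus> b \<ominus> ((c \<ominus> e) \<oplus> (u \<oplus> w))"
    using assms by (simp add: minus_eq minus_add a_ac)
  finally show ?thesis ..
qed

end

text \<open>The sign rule \<open>koszul\<close> is typed for plain module records, so its calculus has a locale for these.\<close>

locale sign_module = Module.module R M for R :: "('r, 's) ring_scheme" and M :: "('r, 'a) module"
begin

lemma koszul_closed: "a \<in> carrier M \<Longrightarrow> koszul M p a \<in> carrier M"
  by (simp add: koszul_def)

lemma koszul_add: "a \<in> carrier M \<Longrightarrow> b \<in> carrier M
    \<Longrightarrow> koszul M p (a \<oplus>\<^bsub>M\<^esub> b) = koszul M p a \<oplus>\<^bsub>M\<^esub> koszul M p b"
  by (simp add: koszul_def M.minus_add)

lemma koszul_koszul: "a \<in> carrier M \<Longrightarrow> koszul M p (koszul M q a) = koszul M (p + q) a"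
  by (simp add: koszul_def)

lemma koszul_self: "a \<in> carrier M \<Longrightarrow> koszul M p (koszul M p a) = a"
  by (simp add: koszul_def)

lemma koszul_zero: "koszul M p \<zero>\<^bsub>M\<^esub> = \<zero>\<^bsub>M\<^esub>"
  by (simp add: koszul_def)

lemma koszul_succ: "a \<in> carrier M \<Longrightarrow> koszul M (p + 1) a = \<ominus>\<^bsub>M\<^esub> koszul M p a"
  and koszul_pred: "a \<in> carrier M \<Longrightarrow> koszul M (p - 1) a = \<ominus>\<^bsub>M\<^esub> koszul M p a"
  by (simp_all add: koszul_def)

lemma koszul_smult:
  "\<lbrakk>r \<in> carrier R; a \<in> carrier M\<rbrakk> \<Longrightarrow> koszul M p (r \<odot>\<^bsub>M\<^esub> a) = r \<odot>\<^bsub>M\<^esub> koszul M p a"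
  by (simp add: koszul_def smult_r_minus)

end

lemma (in Module.module) smult_minus_minus:
  "\<lbrakk>r \<in> carrier R; a \<in> carrier M; b \<in> carrier M; c \<in> carrier M\<rbrakk>
    \<Longrightarrow> r \<odot>\<^bsub>M\<^esub> (a \<ominus>\<^bsub>M\<^esub> b \<ominus>\<^bsub>M\<^esub> c) = r \<odot>\<^bsub>M\<^esub> a \<ominus>\<^bsub>M\<^esub> r \<odot>\<^bsub>M\<^esub> b \<ominus>\<^bsub>M\<^esub> r \<odot>\<^bsub>M\<^esub> c"
  by (simp add: M.minus_eq smult_r_distr smult_r_minus)

text \<open>The tensor product of the Hom complexes with the cochain algebra of the interval. A triple
  \<open>(f\<^sub>0, f\<^sub>1, h)\<close> of degree \<open>n\<close> consists of two morphisms of degree \<open>n\<close> and one of degree \<open>n + 1\<close>, with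
  \<open>d (f\<^sub>0, f\<^sub>1, h) = (d f\<^sub>0, d f\<^sub>1, f\<^sub>0 - f\<^sub>1 - d h)\<close>, and
  \<open>(g\<^sub>0, g\<^sub>1, k) \<circ> (f\<^sub>0, f\<^sub>1, h) = (g\<^sub>0 f\<^sub>0, g\<^sub>1 f\<^sub>1, k f\<^sub>0 + (-1)\<^sup>p g\<^sub>1 h)\<close> for a left factor of degree \<open>p\<close>. A cycle is
  thus a pair of cycles with a homotopy between them. The objects are those of \<open>A\<close>, since the dg
  functors to be compared agree on objects.\<close>

definition path_dgcat :: "('o, 'u::infinite) dgcat \<Rightarrow> ('o, 'u) dgcat" where
  "path_dgcat A = \<lparr>
     dgObj = dgObj A,
     dgHom = (\<lambda>x y n. triple_module (dgHom A x y n) (dgHom A x y n) (dgHom A x y (n + 1))),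
     dgDiff = (\<lambda>x y n t. triple (dgDiff A x y n (start t)) (dgDiff A x y n (finish t))
       (start t \<ominus>\<^bsub>dgHom A x y n\<^esub> finish t \<ominus>\<^bsub>dgHom A x y n\<^esub> dgDiff A x y (n + 1) (link t))),
     dgComp = (\<lambda>x y z p q s t. triple
       (dgComp A x y z p q (start s) (start t)) (dgComp A x y z p q (finish s) (finish t))
       (dgComp A x y z (p + 1) q (link s) (start t) \<oplus>\<^bsub>dgHom A x z (p + q + 1)\<^esub>
        koszul (dgHom A x z (p + q + 1)) p (dgComp A x y z p (q + 1) (finish s) (link t)))),
     dgId = (\<lambda>x. triple (dgId A x) (dgId A x) \<zero>\<^bsub>dgHom A x x 1\<^esub>)\<rparr>"

context dg_cat
begin

lemma hom_sign_module:
  "x \<in> dgObj A \<Longrightarrow> y \<in> dgObj A \<Longrightarrow> sign_module R (dgHom A x y n)"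
  by (simp add: sign_module_def hom_module)

lemma comp_koszul_right:
  "\<lbrakk>x \<in> dgObj A; y \<in> dgObj A; z \<in> dgObj A; g \<in> carrier (dgHom A y z p); f \<in> carrier (dgHom A x y q)\<rbrakk>
    \<Longrightarrow> dgComp A x y z p q g (koszul (dgHom A x y q) m f) =
        koszul (dgHom A x z (p + q)) m (dgComp A x y z p q g f)"
  by (simp add: koszul_def comp_minus_right)

lemma comp_koszul_left:
  "\<lbrakk>x \<in> dgObj A; y \<in> dgObj A; z \<in> dgObj A; g \<in> carrier (dgHom A y z p); f \<in> carrier (dgHom A x y q)\<rbrakk>
    \<Longrightarrow> dgComp A x y z p q (koszul (dgHom A y z p) m g) f =
        koszul (dgHom A x z (p + q)) m (dgComp A x y z p q g f)"
  by (simp add: koszul_def comp_minus_left)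

lemma diff_koszul:
  "\<lbrakk>x \<in> dgObj A; y \<in> dgObj A; a \<in> carrier (dgHom A x y n)\<rbrakk>
    \<Longrightarrow> dgDiff A x y n (koszul (dgHom A x y n) m a) =
        koszul (dgHom A x y (n - 1)) m (dgDiff A x y n a)"
  by (simp add: koszul_def diff_minus)

text \<open>The third component of the Leibniz rule for two triples of degrees \<open>p\<close> and \<open>q\<close>.\<close>

lemma path_leibniz:
  assumes x: "x \<in> dgObj A" and y: "y \<in> dgObj A" and z: "z \<in> dgObj A"
    and g: "g0 \<in> carrier (dgHom A y z p)" "g1 \<in> carrier (dgHom A y z p)" "k \<in> carrier (dgHom A y z (p + 1))"
    and f: "f0 \<in> carrier (dgHom A x y q)" "f1 \<in> carrier (dgHom A x y q)" "h \<in> carrier (dgHom A x y (q + 1))"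
  defines "M \<equiv> dgHom A x z (p + q)"
  shows "dgComp A x y z p q g0 f0 \<ominus>\<^bsub>M\<^esub> dgComp A x y z p q g1 f1 \<ominus>\<^bsub>M\<^esub>
      dgDiff A x z (p + q + 1) (dgComp A x y z (p + 1) q k f0 \<oplus>\<^bsub>dgHom A x z (p + q + 1)\<^esub>
        koszul (dgHom A x z (p + q + 1)) p (dgComp A x y z p (q + 1) g1 h)) =
    (dgComp A x y z p q (g0 \<ominus>\<^bsub>dgHom A y z p\<^esub> g1 \<ominus>\<^bsub>dgHom A y z p\<^esub> dgDiff A y z (p + 1) k) f0 \<oplus>\<^bsub>M\<^esub>
      koszul M (p - 1) (dgComp A x y z (p - 1) (q + 1) (dgDiff A y z p g1) h)) \<oplus>\<^bsub>M\<^esub>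
    koszul M p (dgComp A x y z (p + 1) (q - 1) k (dgDiff A x y q f0) \<oplus>\<^bsub>M\<^esub>
      koszul M p (dgComp A x y z p q g1
        (f0 \<ominus>\<^bsub>dgHom A x y q\<^esub> f1 \<ominus>\<^bsub>dgHom A x y q\<^esub> dgDiff A x y (q + 1) h)))"
proof -
  interpret M: sign_module R M unfolding M_def using x z by (rule hom_sign_module)
  interpret M1: sign_module R "dgHom A x z (p + q + 1)" using x z by (rule hom_sign_module)
  interpret G: abelian_group "dgHom A y z p" using y z by (rule hom_group)
  interpret F: abelian_group "dgHom A x y q" using x y by (rule hom_group)
  have dk: "dgDiff A y z (p + 1) k \<in> carrier (dgHom A y z p)"
    and dg1: "dgDiff A y z p g1 \<in> carrier (dgHom A y z (p - 1))"
    and df0: "dgDiff A x y q f0 \<in> carrier (dgHom A x y (q - 1))"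
    and dh: "dgDiff A x y (q + 1) h \<in> carrier (dgHom A x y q)"
    using x y z g f by (simp_all add: diff_closed)
  have c: "dgComp A x y z p q g0 f0 \<in> carrier M" "dgComp A x y z p q g1 f1 \<in> carrier M"
    "dgComp A x y z p q g1 f0 \<in> carrier M"
    "dgComp A x y z p q (dgDiff A y z (p + 1) k) f0 \<in> carrier M"
    "dgComp A x y z (p + 1) (q - 1) k (dgDiff A x y q f0) \<in> carrier M"
    "dgComp A x y z (p - 1) (q + 1) (dgDiff A y z p g1) h \<in> carrier M"
    "dgComp A x y z p q g1 (dgDiff A x y (q + 1) h) \<in> carrier M"
    unfolding M_def using x y z g f dk dg1 df0 dh by (simp_all add: comp_closed)
  have c1: "dgComp A x y z (p + 1) q k f0 \<in> carrier (dgHom A x z (p + q + 1))"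
    "dgComp A x y z p (q + 1) g1 h \<in> carrier (dgHom A x z (p + q + 1))"
    using x y z g f by (simp_all add: comp_closed)
  have kf: "dgDiff A x z (p + q + 1) (dgComp A x y z (p + 1) q k f0) =
      dgComp A x y z p q (dgDiff A y z (p + 1) k) f0 \<ominus>\<^bsub>M\<^esub>
      koszul M p (dgComp A x y z (p + 1) (q - 1) k (dgDiff A x y q f0))"
    using leibniz[OF x y z g(3) f(1), of "p + q + 1"] M.koszul_succ[OF c(5), of p]
    by (simp add: M_def[symmetric] M.minus_eq)
  have gh: "dgDiff A x z (p + q + 1) (koszul (dgHom A x z (p + q + 1)) p (dgComp A x y z p (q + 1) g1 h)) =
      koszul M p (dgComp A x y z (p - 1) (q + 1) (dgDiff A y z p g1) h) \<oplus>\<^bsub>M\<^esub>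
      dgComp A x y z p q g1 (dgDiff A x y (q + 1) h)"
    using leibniz[OF x y z g(2) f(3), of "p + q + 1"] c diff_koszul[OF x z c1(2), of p]
    by (simp add: M_def[symmetric] M.koszul_add M.koszul_self M.koszul_closed)
  have lhs: "dgDiff A x z (p + q + 1) (dgComp A x y z (p + 1) q k f0 \<oplus>\<^bsub>dgHom A x z (p + q + 1)\<^esub>
        koszul (dgHom A x z (p + q + 1)) p (dgComp A x y z p (q + 1) g1 h)) =
      (dgComp A x y z p q (dgDiff A y z (p + 1) k) f0 \<ominus>\<^bsub>M\<^esub>
      koszul M p (dgComp A x y z (p + 1) (q - 1) k (dgDiff A x y q f0))) \<oplus>\<^bsub>M\<^esub>
      (koszul M p (dgComp A x y z (p - 1) (q + 1) (dgDiff A y z p g1) h) \<oplus>\<^bsub>M\<^esub>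
      dgComp A x y z p q g1 (dgDiff A x y (q + 1) h))"
    using diff_add[OF x z c1(1) M1.koszul_closed[OF c1(2)], of p] kf gh
    by (simp add: M_def[symmetric])
  have gf0: "dgComp A x y z p q (g0 \<ominus>\<^bsub>dgHom A y z p\<^esub> g1 \<ominus>\<^bsub>dgHom A y z p\<^esub> dgDiff A y z (p + 1) k) f0 =
      dgComp A x y z p q g0 f0 \<ominus>\<^bsub>M\<^esub> dgComp A x y z p q g1 f0 \<ominus>\<^bsub>M\<^esub>
      dgComp A x y z p q (dgDiff A y z (p + 1) k) f0"
    using x y z g f dk by (simp add: G.minus_eq M.minus_eq comp_add_left comp_minus_left M_def[symmetric])
  have g1f: "dgComp A x y z p q g1 (f0 \<ominus>\<^bsub>dgHom A x y q\<^esub> f1 \<ominus>\<^bsub>dgHom A x y q\<^esub> dgDiff A x y (q + 1) h) =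
      dgComp A x y z p q g1 f0 \<ominus>\<^bsub>M\<^esub> dgComp A x y z p q g1 f1 \<ominus>\<^bsub>M\<^esub>
      dgComp A x y z p q g1 (dgDiff A x y (q + 1) h)"
    using x y z g f dh by (simp add: F.minus_eq M.minus_eq comp_add_right comp_minus_right M_def[symmetric])
  show ?thesis
    unfolding lhs gf0 g1f
    using c M.insert_difference[OF c(1,2,4) M.koszul_closed[OF c(5), of p]
        M.koszul_closed[OF c(6), of p] c(7) c(3)]
    by (simp add: M.koszul_add M.koszul_self M.koszul_closed M.koszul_pred M.minus_eq)
qed

end

lemma path_dgcat_simps [simp]:
  "dgObj (path_dgcat A) = dgObj A"
  "dgHom (path_dgcat A) x y n = triple_module (dgHom A x y n) (dgHom A x y n) (dgHom A x y (n + 1))"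
  "dgDiff (path_dgcat A) x y n (triple a b c) = triple (dgDiff A x y n a) (dgDiff A x y n b)
     (a \<ominus>\<^bsub>dgHom A x y n\<^esub> b \<ominus>\<^bsub>dgHom A x y n\<^esub> dgDiff A x y (n + 1) c)"
  "dgComp (path_dgcat A) x y z p q (triple g0 g1 k) (triple f0 f1 h) = triple
     (dgComp A x y z p q g0 f0) (dgComp A x y z p q g1 f1)
     (dgComp A x y z (p + 1) q k f0 \<oplus>\<^bsub>dgHom A x z (p + q + 1)\<^esub>
      koszul (dgHom A x z (p + q + 1)) p (dgComp A x y z p (q + 1) g1 h))"
  "dgId (path_dgcat A) x = triple (dgId A x) (dgId A x) \<zero>\<^bsub>dgHom A x x 1\<^esub>"
  by (simp_all add: path_dgcat_def)

lemma koszul_triple: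
  assumes "Module.module R L" "Module.module R M" "Module.module R N"
    and "a \<in> carrier L" "b \<in> carrier M" "c \<in> carrier N"
  shows "koszul (triple_module L M N) p (triple a b c) = triple (koszul L p a) (koszul M p b) (koszul N p c)"
  using triple_module_minus[OF assms] by (simp add: koszul_def)

context dg_cat
begin

text \<open>The third component of associativity. The two signs \<open>(-1)\<^sup>p\<close> and \<open>(-1)\<^sup>q\<close> that the right-hand
  homotopy collects on the left combine to the one sign that it receives on the right.\<close>

lemma path_comp_assoc:
  assumes w: "w \<in> dgObj A" and x: "x \<in> dgObj A" and y: "y \<in> dgObj A" and z: "z \<in> dgObj A"
    and e: "e1 \<in> carrier (dgHom A y z p)" "m \<in> carrier (dgHom A y z (p + 1))"
    and g: "g0 \<in> carrier (dgHom A x y q)" "g1 \<in> carrier (dgHom A x y q)" "k \<in> carrier (dgHom A x y (q + 1))"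
    and f: "f0 \<in> carrier (dgHom A w x r)" "h \<in> carrier (dgHom A w x (r + 1))"
  defines "M \<equiv> dgHom A w z (p + q + r + 1)"
  shows "dgComp A w y z (p + 1) (q + r) m (dgComp A w x y q r g0 f0) \<oplus>\<^bsub>M\<^esub>
      koszul M p (dgComp A w y z p (q + r + 1) e1
        (dgComp A w x y (q + 1) r k f0 \<oplus>\<^bsub>dgHom A w y (q + r + 1)\<^esub>
         koszul (dgHom A w y (q + r + 1)) q (dgComp A w x y q (r + 1) g1 h))) =
    dgComp A w x z (p + q + 1) r (dgComp A x y z (p + 1) q m g0 \<oplus>\<^bsub>dgHom A x z (p + q + 1)\<^esub>
        koszul (dgHom A x z (p + q + 1)) p (dgComp A x y z p (q + 1) e1 k)) f0 \<oplus>\<^bsub>M\<^esub>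
      koszul M (p + q) (dgComp A w x z (p + q) (r + 1) (dgComp A x y z p q e1 g1) h)"
proof -
  interpret M: sign_module R M unfolding M_def using w z by (rule hom_sign_module)
  interpret W: sign_module R "dgHom A w y (q + r + 1)" using w y by (rule hom_sign_module)
  interpret X: sign_module R "dgHom A x z (p + q + 1)" using x z by (rule hom_sign_module)
  have kf: "dgComp A w x y (q + 1) r k f0 \<in> carrier (dgHom A w y (q + r + 1))"
    and gh: "dgComp A w x y q (r + 1) g1 h \<in> carrier (dgHom A w y (q + r + 1))"
    and mg: "dgComp A x y z (p + 1) q m g0 \<in> carrier (dgHom A x z (p + q + 1))"
    and ek: "dgComp A x y z p (q + 1) e1 k \<in> carrier (dgHom A x z (p + q + 1))"
    using w x y z e g f by (simp_all add: comp_closed)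
  have M_eq: "dgHom A w z (p + (q + r + 1)) = M" "dgHom A w z (p + q + 1 + r) = M"
    by (simp_all add: M_def algebra_simps)
  have c: "dgComp A w y z p (q + r + 1) e1 (dgComp A w x y (q + 1) r k f0) \<in> carrier M"
    "dgComp A w y z p (q + r + 1) e1 (dgComp A w x y q (r + 1) g1 h) \<in> carrier M"
    "dgComp A w y z (p + 1) (q + r) m (dgComp A w x y q r g0 f0) \<in> carrier M"
    using w x y z e g f kf gh by (auto simp: M_def comp_closed)
  have l: "dgComp A w y z p (q + r + 1) e1
        (dgComp A w x y (q + 1) r k f0 \<oplus>\<^bsub>dgHom A w y (q + r + 1)\<^esub>
         koszul (dgHom A w y (q + r + 1)) q (dgComp A w x y q (r + 1) g1 h)) =
      dgComp A w y z p (q + r + 1) e1 (dgComp A w x y (q + 1) r k f0) \<oplus>\<^bsub>M\<^esub>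
      koszul M q (dgComp A w y z p (q + r + 1) e1 (dgComp A w x y q (r + 1) g1 h))"
    using comp_add_right[OF w y z e(1) kf W.koszul_closed[OF gh]]
      comp_koszul_right[OF w y z e(1) gh] by (simp only: M_eq)
  have r: "dgComp A w x z (p + q + 1) r (dgComp A x y z (p + 1) q m g0 \<oplus>\<^bsub>dgHom A x z (p + q + 1)\<^esub>
        koszul (dgHom A x z (p + q + 1)) p (dgComp A x y z p (q + 1) e1 k)) f0 =
      dgComp A w x z (p + q + 1) r (dgComp A x y z (p + 1) q m g0) f0 \<oplus>\<^bsub>M\<^esub>
      koszul M p (dgComp A w x z (p + q + 1) r (dgComp A x y z p (q + 1) e1 k) f0)"
    using comp_add_left[OF w x z mg X.koszul_closed[OF ek] f(1)]
      comp_koszul_left[OF w x z ek f(1)] by (simp only: M_eq)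
  have assoc: "dgComp A w y z p (q + r + 1) e1 (dgComp A w x y (q + 1) r k f0) =
      dgComp A w x z (p + q + 1) r (dgComp A x y z p (q + 1) e1 k) f0"
    "dgComp A w y z p (q + r + 1) e1 (dgComp A w x y q (r + 1) g1 h) =
      dgComp A w x z (p + q) (r + 1) (dgComp A x y z p q e1 g1) h"
    "dgComp A w y z (p + 1) (q + r) m (dgComp A w x y q r g0 f0) =
      dgComp A w x z (p + q + 1) r (dgComp A x y z (p + 1) q m g0) f0"
    using w x y z e g f by (auto intro!: comp_assoc)
  show ?thesis
    unfolding l r
    using c by (simp add: assoc M.koszul_add M.koszul_closed M.koszul_koszul M.a_assoc)
qed

end

locale dg_cat_infinite = dg_cat R A for R :: "'u::infinite ring" and A :: "('o, 'u) dgcat"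
begin

lemma dg_category_path: "dg_category R (path_dgcat A)"
proof (rule dg_categoryI; unfold path_dgcat_simps(1,2))
  fix x y n assume x: "x \<in> dgObj A" and y: "y \<in> dgObj A"
  show "Module.module R (triple_module (dgHom A x y n) (dgHom A x y n) (dgHom A x y (n + 1)))"
    using x y by (intro module_triple_module hom_module)
  interpret M: sign_module R "dgHom A x y n" using x y by (rule hom_sign_module)
  interpret M1: sign_module R "dgHom A x y (n - 1)" using x y by (rule hom_sign_module)
  interpret N: sign_module R "dgHom A x y (n + 1)" using x y by (rule hom_sign_module)
  fix s assume "s \<in> carrier (triple_module (dgHom A x y n) (dgHom A x y n) (dgHom A x y (n + 1)))"
  then obtain a b c where s: "s = triple a b c" and abc: "a \<in> carrier (dgHom A x y n)"
    "b \<in> carrier (dgHom A x y n)" "c \<in> carrier (dgHom A x y (n + 1))"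
    by (rule triple_module_cases)
  have dc: "dgDiff A x y (n + 1) c \<in> carrier (dgHom A x y n)" using x y abc by (simp add: diff_closed)
  show "dgDiff (path_dgcat A) x y n s
      \<in> carrier (triple_module (dgHom A x y (n - 1)) (dgHom A x y (n - 1)) (dgHom A x y (n - 1 + 1)))"
    using x y abc by (simp add: s diff_closed)
  show "dgDiff (path_dgcat A) x y (n - 1) (dgDiff (path_dgcat A) x y n s) =
      \<zero>\<^bsub>triple_module (dgHom A x y (n - 2)) (dgHom A x y (n - 2)) (dgHom A x y (n - 2 + 1))\<^esub>"
    using x y abc dc diff_diff[OF x y abc(3), of n] diff_closed[OF x y abc(1), of "n - 1"]
      diff_closed[OF x y abc(2), of "n - 1"]
    by (simp add: s diff_diff M.minus_eq diff_add diff_minus M1.minus_eq M1.r_neg M1.a_inv_zero)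
  show "dgComp (path_dgcat A) x x y n 0 s (dgId (path_dgcat A) x) = s"
    using x y abc by (simp add: s comp_id_right comp_zero_right N.koszul_zero id_closed
          comp_zero_right[of x x y b n 1])
  have "dgComp A x y y 1 n \<zero>\<^bsub>dgHom A y y 1\<^esub> a = \<zero>\<^bsub>dgHom A x y (n + 1)\<^esub>"
    using comp_zero_left[OF x y y abc(1), of 1] by (simp add: add.commute)
  then show "dgComp (path_dgcat A) x y y 0 n (dgId (path_dgcat A) y) s = s"
    using x y abc by (simp add: s comp_id_left koszul_def)
  {
    fix r assume r: "r \<in> carrier R"
    show "dgDiff (path_dgcat A) x y n
        (r \<odot>\<^bsub>triple_module (dgHom A x y n) (dgHom A x y n) (dgHom A x y (n + 1))\<^esub> s) =
        r \<odot>\<^bsub>triple_module (dgHom A x y (n - 1)) (dgHom A x y (n - 1)) (dgHom A x y (n - 1 + 1))\<^esub>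
        dgDiff (path_dgcat A) x y n s"
      using x y abc r dc diff_smult[OF x y r abc(3)] by (simp add: s diff_smult M.smult_minus_minus)
  }
  fix t assume "t \<in> carrier (triple_module (dgHom A x y n) (dgHom A x y n) (dgHom A x y (n + 1)))"
  then obtain a' b' c' where t: "t = triple a' b' c'" and abc': "a' \<in> carrier (dgHom A x y n)"
    "b' \<in> carrier (dgHom A x y n)" "c' \<in> carrier (dgHom A x y (n + 1))"
    by (rule triple_module_cases)
  have dc': "dgDiff A x y (n + 1) c' \<in> carrier (dgHom A x y n)" using x y abc' by (simp add: diff_closed)
  show "dgDiff (path_dgcat A) x y n
      (s \<oplus>\<^bsub>triple_module (dgHom A x y n) (dgHom A x y n) (dgHom A x y (n + 1))\<^esub> t) =
      dgDiff (path_dgcat A) x y n s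
      \<oplus>\<^bsub>triple_module (dgHom A x y (n - 1)) (dgHom A x y (n - 1)) (dgHom A x y (n - 1 + 1))\<^esub>
      dgDiff (path_dgcat A) x y n t"
    using x y abc abc' dc dc' diff_add[OF x y abc(3) abc'(3)]
    by (simp add: s t diff_add M.minus_minus_add)
next
  fix x y z p q g f
  assume x: "x \<in> dgObj A" and y: "y \<in> dgObj A" and z: "z \<in> dgObj A"
    and gT: "g \<in> carrier (triple_module (dgHom A y z p) (dgHom A y z p) (dgHom A y z (p + 1)))"
    and fT: "f \<in> carrier (triple_module (dgHom A x y q) (dgHom A x y q) (dgHom A x y (q + 1)))"
  obtain g0 g1 k where g': "g = triple g0 g1 k"
    and g: "g0 \<in> carrier (dgHom A y z p)" "g1 \<in> carrier (dgHom A y z p)" "k \<in> carrier (dgHom A y z (p + 1))"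
    using gT by (rule triple_module_cases)
  obtain f0 f1 h where f': "f = triple f0 f1 h"
    and f: "f0 \<in> carrier (dgHom A x y q)" "f1 \<in> carrier (dgHom A x y q)" "h \<in> carrier (dgHom A x y (q + 1))"
    using fT by (rule triple_module_cases)
  note gf = g' f'
  interpret M: sign_module R "dgHom A x z (p + q + 1)" using x z by (rule hom_sign_module)
  interpret G: sign_module R "dgHom A y z (p + 1)" using y z by (rule hom_sign_module)
  interpret F: sign_module R "dgHom A x y (q + 1)" using x y by (rule hom_sign_module)
  have deg: "p + 1 + q = p + q + 1" "p + (q + 1) = p + q + 1" by simp_all
  have kf: "dgComp A x y z (p + 1) q k f0 \<in> carrier (dgHom A x z (p + q + 1))"
    and gh: "dgComp A x y z p (q + 1) g1 h \<in> carrier (dgHom A x z (p + q + 1))"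
    using x y z g f by (simp_all add: comp_closed)
  show "dgComp (path_dgcat A) x y z p q g f \<in> carrier (triple_module
      (dgHom A x z (p + q)) (dgHom A x z (p + q)) (dgHom A x z (p + q + 1)))"
    using x y z g f kf gh by (simp add: gf comp_closed M.koszul_closed)
  show "dgDiff (path_dgcat A) x z (p + q) (dgComp (path_dgcat A) x y z p q g f) =
      dgComp (path_dgcat A) x y z (p - 1) q (dgDiff (path_dgcat A) y z p g) f
      \<oplus>\<^bsub>triple_module (dgHom A x z (p + q - 1)) (dgHom A x z (p + q - 1)) (dgHom A x z (p + q - 1 + 1))\<^esub>
      koszul (triple_module (dgHom A x z (p + q - 1)) (dgHom A x z (p + q - 1))
          (dgHom A x z (p + q - 1 + 1))) p
        (dgComp (path_dgcat A) x y z p (q - 1) g (dgDiff (path_dgcat A) x y q f))"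
  proof -
    interpret H: sign_module R "dgHom A x y q" using x y by (rule hom_sign_module)
    interpret N: sign_module R "dgHom A x z (p + q)" using x z by (rule hom_sign_module)
    have deg: "p - 1 + q + 1 = p + q" "p + (q - 1) + 1 = p + q" "p + q - 1 + 1 = p + q"
      "p - 1 + 1 = p" "q - 1 + 1 = q" by simp_all
    have dh: "dgDiff A x y (q + 1) h \<in> carrier (dgHom A x y q)"
      and df: "dgDiff A x y q f0 \<in> carrier (dgHom A x y (q - 1))"
        "dgDiff A x y q f1 \<in> carrier (dgHom A x y (q - 1))"
      using x y f by (simp_all add: diff_closed)
    have k3: "dgComp A x y z (p + 1) (q - 1) k (dgDiff A x y q f0) \<oplus>\<^bsub>dgHom A x z (p + q)\<^esub>
        koszul (dgHom A x z (p + q)) p (dgComp A x y z p q g1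
          (f0 \<ominus>\<^bsub>dgHom A x y q\<^esub> f1 \<ominus>\<^bsub>dgHom A x y q\<^esub> dgDiff A x y (q + 1) h))
        \<in> carrier (dgHom A x z (p + q))"
      using x y z g f df dh
      by (intro N.add.m_closed N.koszul_closed comp_closed[of x y z]) auto
    have k12: "dgComp A x y z p (q - 1) g0 (dgDiff A x y q f0) \<in> carrier (dgHom A x z (p + q - 1))"
      "dgComp A x y z p (q - 1) g1 (dgDiff A x y q f1) \<in> carrier (dgHom A x z (p + q - 1))"
      using x y z g f df by (simp_all add: comp_closed)
    have "koszul (triple_module (dgHom A x z (p + q - 1)) (dgHom A x z (p + q - 1)) (dgHom A x z (p + q))) p
        (dgComp (path_dgcat A) x y z p (q - 1) g (dgDiff (path_dgcat A) x y q f)) =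
      triple (koszul (dgHom A x z (p + q - 1)) p (dgComp A x y z p (q - 1) g0 (dgDiff A x y q f0)))
        (koszul (dgHom A x z (p + q - 1)) p (dgComp A x y z p (q - 1) g1 (dgDiff A x y q f1)))
        (koszul (dgHom A x z (p + q)) p (dgComp A x y z (p + 1) (q - 1) k (dgDiff A x y q f0) \<oplus>\<^bsub>dgHom A x z (p + q)\<^esub>
        koszul (dgHom A x z (p + q)) p (dgComp A x y z p q g1
          (f0 \<ominus>\<^bsub>dgHom A x y q\<^esub> f1 \<ominus>\<^bsub>dgHom A x y q\<^esub> dgDiff A x y (q + 1) h))))"
      unfolding gf path_dgcat_simps deg
      by (rule koszul_triple[OF hom_module[OF x z] hom_module[OF x z] hom_module[OF x z] k12 k3])
    then show ?thesis
      unfolding deg using path_leibniz[OF x y z g f] leibniz[OF x y z g(1) f(1)] leibniz[OF x y z g(2) f(2)]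
      by (simp add: gf deg)
  qed
  {
    fix r assume r: "r \<in> carrier R"
    show "dgComp (path_dgcat A) x y z p q g
        (r \<odot>\<^bsub>triple_module (dgHom A x y q) (dgHom A x y q) (dgHom A x y (q + 1))\<^esub> f) =
        r \<odot>\<^bsub>triple_module (dgHom A x z (p + q)) (dgHom A x z (p + q)) (dgHom A x z (p + q + 1))\<^esub>
        dgComp (path_dgcat A) x y z p q g f"
      using x y z g f r kf gh comp_smult_right[OF x y z g(3) f(1) r] comp_smult_right[OF x y z g(2) f(3) r]
      by (simp add: gf comp_smult_right M.koszul_smult M.koszul_closed M.smult_r_distr deg)
    show "dgComp (path_dgcat A) x y z p q
        (r \<odot>\<^bsub>triple_module (dgHom A y z p) (dgHom A y z p) (dgHom A y z (p + 1))\<^esub> g) f =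
        r \<odot>\<^bsub>triple_module (dgHom A x z (p + q)) (dgHom A x z (p + q)) (dgHom A x z (p + q + 1))\<^esub>
        dgComp (path_dgcat A) x y z p q g f"
      using x y z g f r kf gh comp_smult_left[OF x y z g(3) f(1) r] comp_smult_left[OF x y z g(2) f(3) r]
      by (simp add: gf comp_smult_left M.koszul_smult M.koszul_closed M.smult_r_distr deg)
  }
  {
    fix f' assume "f' \<in> carrier (triple_module (dgHom A x y q) (dgHom A x y q) (dgHom A x y (q + 1)))"
    then obtain f0' f1' h' where gf': "f' = triple f0' f1' h'"
      and f': "f0' \<in> carrier (dgHom A x y q)" "f1' \<in> carrier (dgHom A x y q)" "h' \<in> carrier (dgHom A x y (q + 1))"
      by (rule triple_module_cases)
    have kf': "dgComp A x y z (p + 1) q k f0' \<in> carrier (dgHom A x z (p + q + 1))"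
      and gh': "dgComp A x y z p (q + 1) g1 h' \<in> carrier (dgHom A x z (p + q + 1))"
      using x y z g f' by (simp_all add: comp_closed)
    show "dgComp (path_dgcat A) x y z p q g
        (f \<oplus>\<^bsub>triple_module (dgHom A x y q) (dgHom A x y q) (dgHom A x y (q + 1))\<^esub> f') =
        dgComp (path_dgcat A) x y z p q g f
        \<oplus>\<^bsub>triple_module (dgHom A x z (p + q)) (dgHom A x z (p + q)) (dgHom A x z (p + q + 1))\<^esub>
        dgComp (path_dgcat A) x y z p q g f'"
      using x y z g f f' kf gh kf' gh'
        comp_add_right[OF x y z g(3) f(1) f'(1)] comp_add_right[OF x y z g(2) f(3) f'(3)]
      by (simp add: gf gf' comp_add_right M.koszul_add M.koszul_closed M.a_ac deg)
  }
  {
    fix g' assume "g' \<in> carrier (triple_module (dgHom A y z p) (dgHom A y z p) (dgHom A y z (p + 1)))"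
    then obtain g0' g1' k' where gf': "g' = triple g0' g1' k'"
      and g': "g0' \<in> carrier (dgHom A y z p)" "g1' \<in> carrier (dgHom A y z p)" "k' \<in> carrier (dgHom A y z (p + 1))"
      by (rule triple_module_cases)
    have kf': "dgComp A x y z (p + 1) q k' f0 \<in> carrier (dgHom A x z (p + q + 1))"
      and gh': "dgComp A x y z p (q + 1) g1' h \<in> carrier (dgHom A x z (p + q + 1))"
      using x y z g' f by (simp_all add: comp_closed)
    show "dgComp (path_dgcat A) x y z p q
        (g \<oplus>\<^bsub>triple_module (dgHom A y z p) (dgHom A y z p) (dgHom A y z (p + 1))\<^esub> g') f =
        dgComp (path_dgcat A) x y z p q g f
        \<oplus>\<^bsub>triple_module (dgHom A x z (p + q)) (dgHom A x z (p + q)) (dgHom A x z (p + q + 1))\<^esub>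
        dgComp (path_dgcat A) x y z p q g' f"
      using x y z g g' f kf gh kf' gh'
        comp_add_left[OF x y z g(3) g'(3) f(1)] comp_add_left[OF x y z g(2) g'(2) f(3)]
      by (simp add: gf gf' comp_add_left M.koszul_add M.koszul_closed M.a_ac deg)
  }
next
  fix w x y z p q r e g f
  assume w: "w \<in> dgObj A" and x: "x \<in> dgObj A" and y: "y \<in> dgObj A" and z: "z \<in> dgObj A"
    and eT: "e \<in> carrier (triple_module (dgHom A y z p) (dgHom A y z p) (dgHom A y z (p + 1)))"
    and gT: "g \<in> carrier (triple_module (dgHom A x y q) (dgHom A x y q) (dgHom A x y (q + 1)))"
    and fT: "f \<in> carrier (triple_module (dgHom A w x r) (dgHom A w x r) (dgHom A w x (r + 1)))"
  obtain e0 e1 m where e': "e = triple e0 e1 m"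
    and e: "e0 \<in> carrier (dgHom A y z p)" "e1 \<in> carrier (dgHom A y z p)" "m \<in> carrier (dgHom A y z (p + 1))"
    using eT by (rule triple_module_cases)
  obtain g0 g1 k where g': "g = triple g0 g1 k"
    and g: "g0 \<in> carrier (dgHom A x y q)" "g1 \<in> carrier (dgHom A x y q)" "k \<in> carrier (dgHom A x y (q + 1))"
    using gT by (rule triple_module_cases)
  obtain f0 f1 h where f': "f = triple f0 f1 h"
    and f: "f0 \<in> carrier (dgHom A w x r)" "f1 \<in> carrier (dgHom A w x r)" "h \<in> carrier (dgHom A w x (r + 1))"
    using fT by (rule triple_module_cases)
  have deg: "p + (q + r) + 1 = p + q + r + 1" by simp
  show "dgComp (path_dgcat A) w y z p (q + r) e (dgComp (path_dgcat A) w x y q r g f) =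
      dgComp (path_dgcat A) w x z (p + q) r (dgComp (path_dgcat A) x y z p q e g) f"
    using path_comp_assoc[OF w x y z e(2,3) g f(1,3)] comp_assoc[OF w x y z e(1) g(1) f(1)]
      comp_assoc[OF w x y z e(2) g(2) f(2)]
    by (simp add: e' g' f' deg)
next
  fix x assume x: "x \<in> dgObj A"
  interpret M: sign_module R "dgHom A x x 0" using x x by (rule hom_sign_module)
  interpret M1: sign_module R "dgHom A x x 1" using x x by (rule hom_sign_module)
  show "dgId (path_dgcat A) x \<in> carrier (triple_module (dgHom A x x 0) (dgHom A x x 0) (dgHom A x x (0 + 1)))"
    using x by (simp add: id_closed)
  show "dgDiff (path_dgcat A) x x 0 (dgId (path_dgcat A) x) =
      \<zero>\<^bsub>triple_module (dgHom A x x (- 1)) (dgHom A x x (- 1)) (dgHom A x x (- 1 + 1))\<^esub>"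
    using x diff_zero[OF x x, of 1] id_closed[OF x] by (simp add: diff_id M.minus_eq M.r_neg)
qed

end

definition path_const :: "('o, 'u::infinite) dgcat \<Rightarrow> ('o, 'o, 'u) dgfun" where
  "path_const A = \<lparr>
     onObj = restrict (\<lambda>x. x) (dgObj A),
     onHom = (\<lambda>x y n. if x \<in> dgObj A \<and> y \<in> dgObj A
       then restrict (\<lambda>a. triple a a \<zero>\<^bsub>dgHom A x y (n + 1)\<^esub>) (carrier (dgHom A x y n))
       else (\<lambda>_. undefined))\<rparr>"

text \<open>Used for \<open>e\<close> one of \<open>start\<close> and \<open>finish\<close>, the two evaluations at an end of the path.\<close>

definition path_eval :: "('o, 'u::infinite) dgcat \<Rightarrow> ('u \<Rightarrow> 'u) \<Rightarrow> ('o, 'o, 'u) dgfun" where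
  "path_eval A e = \<lparr>
     onObj = restrict (\<lambda>x. x) (dgObj A),
     onHom = (\<lambda>x y n. if x \<in> dgObj A \<and> y \<in> dgObj A
       then restrict e (carrier (dgHom (path_dgcat A) x y n)) else (\<lambda>_. undefined))\<rparr>"

lemma path_const_apply:
  "x \<in> dgObj A \<Longrightarrow> onObj (path_const A) x = x"
  "\<lbrakk>x \<in> dgObj A; y \<in> dgObj A; a \<in> carrier (dgHom A x y n)\<rbrakk>
    \<Longrightarrow> onHom (path_const A) x y n a = triple a a \<zero>\<^bsub>dgHom A x y (n + 1)\<^esub>"
  by (simp_all add: path_const_def)

lemma path_eval_apply:
  "x \<in> dgObj A \<Longrightarrow> onObj (path_eval A e) x = x"
  "\<lbrakk>x \<in> dgObj A; y \<in> dgObj A; t \<in> carrier (dgHom (path_dgcat A) x y n)\<rbrakk>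
    \<Longrightarrow> onHom (path_eval A e) x y n t = e t"
  by (simp_all add: path_eval_def)

lemma path_ends:
  assumes "e \<in> {start, finish}"
  shows "t \<in> carrier (dgHom (path_dgcat A) x y n) \<Longrightarrow> e t \<in> carrier (dgHom A x y n)"
    and "e (s \<oplus>\<^bsub>dgHom (path_dgcat A) x y n\<^esub> t) = e s \<oplus>\<^bsub>dgHom A x y n\<^esub> e t"
    and "e (r \<odot>\<^bsub>dgHom (path_dgcat A) x y n\<^esub> t) = r \<odot>\<^bsub>dgHom A x y n\<^esub> e t"
    and "e (dgDiff (path_dgcat A) x y n t) = dgDiff A x y n (e t)"
    and "e (dgComp (path_dgcat A) x y z p q s t) = dgComp A x y z p q (e s) (e t)"
    and "e (dgId (path_dgcat A) x) = dgId A x"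
  using assms by (auto simp: path_dgcat_def triple_module_def)

context dg_cat_infinite
begin

lemma dg_cat_path: "dg_cat R (path_dgcat A)"
  using dg_category_path by unfold_locales

lemma dg_functor_path_eval:
  assumes "e \<in> {start, finish}"
  shows "dg_functor R (path_dgcat A) A (path_eval A e)"
proof -
  interpret P: dg_cat R "path_dgcat A" by (rule dg_cat_path)
  show ?thesis
  proof (rule dg_functorI)
    show "dg_category R (path_dgcat A)" "dg_category R A"
      by (rule dg_category_path, rule dg_category)
  qed (auto simp: path_eval_def path_ends[OF assms] P.diff_closed P.comp_closed P.id_closed
      P.hom_group abelian_groupE(1) Module.module.smult_closed[OF P.hom_module]
      simp del: path_dgcat_simps(2-5))
qed

lemma dg_functor_path_const: "dg_functor R A (path_dgcat A) (path_const A)"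
proof (rule dg_functorI)
  show "dg_category R (path_dgcat A)" "dg_category R A"
    by (rule dg_category_path, rule dg_category)
  show "onObj (path_const A) \<in> dgObj A \<rightarrow>\<^sub>E dgObj (path_dgcat A)"
    by (auto simp: path_const_def)
  fix x y n
  show "\<not> (x \<in> dgObj A \<and> y \<in> dgObj A) \<Longrightarrow> onHom (path_const A) x y n = (\<lambda>_. undefined)"
    by (auto simp: path_const_def)
  assume x: "x \<in> dgObj A" and y: "y \<in> dgObj A"
  show "onHom (path_const A) x y n \<in> extensional (carrier (dgHom A x y n))"
    using x y by (simp add: path_const_def)
  interpret M: sign_module R "dgHom A x y n" using x y by (rule hom_sign_module)
  interpret N: sign_module R "dgHom A x y (n + 1)" using x y by (rule hom_sign_module)
  fix a assume a: "a \<in> carrier (dgHom A x y n)"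
  show "onHom (path_const A) x y n a
      \<in> carrier (dgHom (path_dgcat A) (onObj (path_const A) x) (onObj (path_const A) y) n)"
    using x y a by (simp add: path_const_apply)
  show "onHom (path_const A) x y (n - 1) (dgDiff A x y n a) =
      dgDiff (path_dgcat A) (onObj (path_const A) x) (onObj (path_const A) y) n (onHom (path_const A) x y n a)"
    using x y a diff_zero[OF x y, of "n + 1"]
    by (simp add: path_const_apply diff_closed M.minus_eq M.r_neg M.a_inv_zero)
  {
    fix r assume r: "r \<in> carrier R"
    show "onHom (path_const A) x y n (r \<odot>\<^bsub>dgHom A x y n\<^esub> a) =
        r \<odot>\<^bsub>dgHom (path_dgcat A) (onObj (path_const A) x) (onObj (path_const A) y) n\<^esub>
        onHom (path_const A) x y n a"
      using x y a r by (simp add: path_const_apply)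
  }
  fix b assume b: "b \<in> carrier (dgHom A x y n)"
  show "onHom (path_const A) x y n (a \<oplus>\<^bsub>dgHom A x y n\<^esub> b) = onHom (path_const A) x y n a
      \<oplus>\<^bsub>dgHom (path_dgcat A) (onObj (path_const A) x) (onObj (path_const A) y) n\<^esub>
      onHom (path_const A) x y n b"
    using x y a b by (simp add: path_const_apply)
next
  fix x y z p q g f
  assume x: "x \<in> dgObj A" and y: "y \<in> dgObj A" and z: "z \<in> dgObj A"
    and g: "g \<in> carrier (dgHom A y z p)" and f: "f \<in> carrier (dgHom A x y q)"
  interpret M: sign_module R "dgHom A x z (p + q + 1)" using x z by (rule hom_sign_module)
  have deg: "p + 1 + q = p + q + 1" "p + (q + 1) = p + q + 1" by simp_all
  show "onHom (path_const A) x z (p + q) (dgComp A x y z p q g f) =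
      dgComp (path_dgcat A) (onObj (path_const A) x) (onObj (path_const A) y) (onObj (path_const A) z) p q
        (onHom (path_const A) y z p g) (onHom (path_const A) x y q f)"
    using x y z g f comp_zero_left[OF x y z f, of "p + 1"] comp_zero_right[OF x y z g, of "q + 1"]
    by (simp add: path_const_apply comp_closed M.koszul_zero deg)
next
  fix x assume "x \<in> dgObj A"
  then show "onHom (path_const A) x x 0 (dgId A x) = dgId (path_dgcat A) (onObj (path_const A) x)"
    by (simp add: path_const_apply id_closed)
qed

lemma H0_isomorphic_refl:
  assumes "x \<in> dgObj A" shows "H0_isomorphic A x x"
  using assms id_closed diff_id comp_id_left unfolding H0_isomorphic_def
  by (intro bexI[of _ "dgId A x"]) (simp_all add: dg_cycles_def)

text \<open>A cycle \<open>(a, b, c)\<close> satisfies \<open>a - b = d c\<close>; it differs from the constant path at \<open>a\<close> by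
  the boundary of \<open>(0, - c, 0)\<close>.\<close>

lemma quasi_equivalence_path_const: "quasi_equivalence R A (path_dgcat A) (path_const A)"
proof -
  interpret P: dg_cat_infinite R "path_dgcat A" using dg_category_path by unfold_locales
  interpret F: dg_fun R A "path_dgcat A" "path_const A"
    using dg_functor_path_const by (rule dg_funI)
  have bij: "bij_betw (dg_coset_map (path_dgcat A) (path_const A) x y n) (dg_homology A x y n)
      (dg_homology (path_dgcat A) (onObj (path_const A) x) (onObj (path_const A) y) n)"
    if x: "x \<in> dgObj A" and y: "y \<in> dgObj A" for x y n
  proof (rule bij_betw_imageI)
    interpret M: sign_module R "dgHom A x y n" using x y by (rule hom_sign_module)
    interpret N: sign_module R "dgHom A x y (n + 1)" using x y by (rule hom_sign_module)
    interpret N2: sign_module R "dgHom A x y (n + 1 + 1)" using x y by (rule hom_sign_module)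
    let ?c = "\<lambda>a. triple a a \<zero>\<^bsub>dgHom A x y (n + 1)\<^esub>"
    note xy' = x[folded path_dgcat_simps(1)[of A]] y[folded path_dgcat_simps(1)[of A]]
    have cc: "?c a \<in> carrier (dgHom (path_dgcat A) x y n)" if "a \<in> carrier (dgHom A x y n)" for a
      using that by simp
    have map_coset: "dg_coset_map (path_dgcat A) (path_const A) x y n (dg_coset A x y n a) =
        dg_coset (path_dgcat A) x y n (?c a)" if "a \<in> carrier (dgHom A x y n)" for a
      using F.coset_map_coset[OF x y that] x y that by (simp add: path_const_apply)
    show "inj_on (dg_coset_map (path_dgcat A) (path_const A) x y n) (dg_homology A x y n)"
    proof (rule inj_onI)
      fix c c' assume "c \<in> dg_homology A x y n" "c' \<in> dg_homology A x y n"
        and eq: "dg_coset_map (path_dgcat A) (path_const A) x y n c =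
          dg_coset_map (path_dgcat A) (path_const A) x y n c'"
      then obtain a b where a: "a \<in> dg_cycles A x y n" "c = dg_coset A x y n a"
        and b: "b \<in> dg_cycles A x y n" "c' = dg_coset A x y n b" by (auto simp: dg_homology_def)
      note ab = cyclesD(1)[OF a(1)] cyclesD(1)[OF b(1)]
      have "dg_coset (path_dgcat A) x y n (?c a) = dg_coset (path_dgcat A) x y n (?c b)"
        using eq a(2) b(2) map_coset ab by simp
      then obtain k where k: "k \<in> carrier (dgHom (path_dgcat A) x y (n + 1))"
        "?c a = dgDiff (path_dgcat A) x y (n + 1) k \<oplus>\<^bsub>dgHom (path_dgcat A) x y n\<^esub> ?c b"
        using P.coset_eq_iff[OF xy' cc[OF ab(1)] cc[OF ab(2)]] by blast
      from k(1) obtain k0 k1 k2 where k': "k = triple k0 k1 k2" "k0 \<in> carrier (dgHom A x y (n + 1))"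
        unfolding path_dgcat_simps by (rule triple_module_cases)
      have "a = dgDiff A x y (n + 1) k0 \<oplus>\<^bsub>dgHom A x y n\<^esub> b" using k(2) by (simp add: k'(1))
      then show "c = c'" using coset_eq_iff[OF x y ab] k'(2) a b by blast
    qed
    show "dg_coset_map (path_dgcat A) (path_const A) x y n ` dg_homology A x y n =
        dg_homology (path_dgcat A) (onObj (path_const A) x) (onObj (path_const A) y) n"
    proof (intro equalityI subsetI)
      fix c assume "c \<in> dg_coset_map (path_dgcat A) (path_const A) x y n ` dg_homology A x y n"
      then obtain a where a: "a \<in> dg_cycles A x y n" "c = dg_coset (path_dgcat A) x y n (?c a)"
        using map_coset cyclesD(1) by (auto simp: dg_homology_def)
      have "?c a \<in> dg_cycles (path_dgcat A) x y n"
        using cyclesD[OF a(1)] diff_zero[OF x y, of "n + 1"]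
        by (simp add: dg_cycles_def M.minus_eq M.r_neg M.a_inv_zero)
      then show "c \<in> dg_homology (path_dgcat A) (onObj (path_const A) x) (onObj (path_const A) y) n"
        using a(2) x y by (simp add: dg_homology_def path_const_apply)
    next
      fix c assume "c \<in> dg_homology (path_dgcat A) (onObj (path_const A) x) (onObj (path_const A) y) n"
      then obtain t where t: "t \<in> dg_cycles (path_dgcat A) x y n" "c = dg_coset (path_dgcat A) x y n t"
        using x y by (auto simp: dg_homology_def path_const_apply)
      from P.cyclesD(1)[OF t(1)] obtain a b h where t': "t = triple a b h"
        and abh: "a \<in> carrier (dgHom A x y n)" "b \<in> carrier (dgHom A x y n)" "h \<in> carrier (dgHom A x y (n + 1))"
        unfolding path_dgcat_simps by (rule triple_module_cases)
      have dh: "dgDiff A x y (n + 1) h \<in> carrier (dgHom A x y n)" using x y abh by (simp add: diff_closed)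
      have da: "a \<in> dg_cycles A x y n"
        and abdh: "a \<ominus>\<^bsub>dgHom A x y n\<^esub> b \<ominus>\<^bsub>dgHom A x y n\<^esub> dgDiff A x y (n + 1) h = \<zero>\<^bsub>dgHom A x y n\<^esub>"
        using P.cyclesD(2)[OF t(1)] abh(1) by (simp_all add: t' dg_cycles_def)
      let ?k = "triple \<zero>\<^bsub>dgHom A x y (n + 1)\<^esub> (\<ominus>\<^bsub>dgHom A x y (n + 1)\<^esub> h) \<zero>\<^bsub>dgHom A x y (n + 1 + 1)\<^esub>"
      have "b = \<ominus>\<^bsub>dgHom A x y n\<^esub> dgDiff A x y (n + 1) h \<oplus>\<^bsub>dgHom A x y n\<^esub> a"
      proof -
        have "b = b \<oplus>\<^bsub>dgHom A x y n\<^esub>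
            (a \<ominus>\<^bsub>dgHom A x y n\<^esub> b \<ominus>\<^bsub>dgHom A x y n\<^esub> dgDiff A x y (n + 1) h)"
          using abh by (simp add: abdh)
        also have "\<dots> = b \<oplus>\<^bsub>dgHom A x y n\<^esub> (\<ominus>\<^bsub>dgHom A x y n\<^esub> b \<oplus>\<^bsub>dgHom A x y n\<^esub>
            (\<ominus>\<^bsub>dgHom A x y n\<^esub> dgDiff A x y (n + 1) h \<oplus>\<^bsub>dgHom A x y n\<^esub> a))"
          using abh dh by (simp add: M.minus_eq M.a_ac)
        also have "\<dots> = \<ominus>\<^bsub>dgHom A x y n\<^esub> dgDiff A x y (n + 1) h \<oplus>\<^bsub>dgHom A x y n\<^esub> a"
          using abh dh by (simp add: M.r_neg2)
        finally show ?thesis .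
      qed
      moreover have "dgDiff A x y (n + 1 + 1) \<zero>\<^bsub>dgHom A x y (n + 1 + 1)\<^esub> = \<zero>\<^bsub>dgHom A x y (n + 1)\<^esub>"
        using diff_zero[OF x y, of "n + 1 + 1"] by (metis add_diff_cancel_right')
      ultimately have "t = dgDiff (path_dgcat A) x y (n + 1) ?k \<oplus>\<^bsub>dgHom (path_dgcat A) x y n\<^esub> ?c a"
        using abh dh diff_zero[OF x y, of "n + 1"] diff_minus[OF x y abh(3)]
        by (simp add: t' N.minus_eq N.a_inv_zero)
      moreover have "?k \<in> carrier (dgHom (path_dgcat A) x y (n + 1))"
        using abh abelian_groupE(2)[OF hom_group[OF x y]] by simp
      ultimately have "c = dg_coset (path_dgcat A) x y n (?c a)"
        using t(2) P.coset_eq_iff[OF xy' P.cyclesD(1)[OF t(1)] cc[OF abh(1)]] by blast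
      then have "c = dg_coset_map (path_dgcat A) (path_const A) x y n (dg_coset A x y n a)"
        using map_coset abh(1) by simp
      then show "c \<in> dg_coset_map (path_dgcat A) (path_const A) x y n ` dg_homology A x y n"
        using da by (auto simp: dg_homology_def)
    qed
  qed
  have "\<exists>x\<in>dgObj A. H0_isomorphic (path_dgcat A) (onObj (path_const A) x) y"
    if "y \<in> dgObj (path_dgcat A)" for y
    using that P.H0_isomorphic_refl[OF that] by (intro bexI[of _ y]) (simp_all add: path_const_apply)
  then show ?thesis
    using bij dg_functor_path_const by (simp add: quasi_equivalence_def del: path_dgcat_simps(2-5))
qed

lemma path_eval_const:
  assumes "e \<in> {start, finish}"
  shows "dgfun_comp A (path_eval A e) (path_const A) = dgfun_id A"
  using assms dg_category
  by (intro dgfun_eqI[OF dg_functor_comp[OF dg_functor_path_const dg_functor_path_eval] dg_functor_id])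
     (auto simp: dgfun_comp_apply dgfun_id_apply path_const_apply path_eval_def
       abelian_groupE(2)[OF hom_group])

end

section \<open>Dg functors out of \<open>\<bold>k\<langle>v,w\<rangle>\<close> and out of \<open>C/v\<close>\<close>

context dg_cat
begin

text \<open>The image of the free generator of each graded piece of \<open>\<bold>k\<langle>v,w\<rangle>\<close> under the dg functor that sends
  its generator \<open>w\<close> to a given morphism. The value zero in the remaining degrees lets the functor be
  written as coefficient times generator everywhere.\<close>

definition vw_generator :: "int \<Rightarrow> 'o \<Rightarrow> 'o \<Rightarrow> 'u \<Rightarrow> bool \<Rightarrow> bool \<Rightarrow> int \<Rightarrow> 'u" where
  "vw_generator n x y w a b m = (let ob = (\<lambda>b. if b then y else x) in
     if a = b \<and> m = 0 then dgId A (ob a)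
     else if \<not> a \<and> b \<and> m = n then dgDiff A x y (n + 1) w
     else if \<not> a \<and> b \<and> m = n + 1 then w
     else \<zero>\<^bsub>dgHom A (ob a) (ob b) m\<^esub>)"

definition vw_functor :: "int \<Rightarrow> 'o \<Rightarrow> 'o \<Rightarrow> 'u \<Rightarrow> (bool, 'o, 'u) dgfun" where
  "vw_functor n x y w = (let ob = (\<lambda>b. if b then y else x) in \<lparr>
     onObj = ob,
     onHom = (\<lambda>a b m. restrict (\<lambda>r. r \<odot>\<^bsub>dgHom A (ob a) (ob b) m\<^esub> vw_generator n x y w a b m)
       (carrier (dgHom (k_vw R n) a b m)))\<rparr>)"

lemma vw_functor_apply:
  "onObj (vw_functor n x y w) b = (if b then y else x)"
  "r \<in> carrier (dgHom (k_vw R n) a b m) \<Longrightarrow> onHom (vw_functor n x y w) a b m r =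
     r \<odot>\<^bsub>dgHom A (if a then y else x) (if b then y else x) m\<^esub> vw_generator n x y w a b m"
  by (simp_all add: vw_functor_def)

text \<open>Since the functor multiplies coefficients with generators, compatibility with the differential and
  with composition only has to be seen on generators. That \<open>v\<close> goes to \<open>d w\<close> is forced by \<open>d w = v\<close> in
  \<open>\<bold>k\<langle>v,w\<rangle>\<close>.\<close>

lemma dg_functor_vw:
  assumes kvw: "dg_category R (k_vw R n)"
    and x: "x \<in> dgObj A" and y: "y \<in> dgObj A" and w: "w \<in> carrier (dgHom A x y (n + 1))"
  shows "dg_functor R (k_vw R n) A (vw_functor n x y w)"
proof -
  interpret V: dg_cat R "k_vw R n" using kvw by unfold_locales
  define ob where "ob b = (if b then y else x)" for b
  have ob: "ob b \<in> dgObj A" for b using x y by (simp add: ob_def)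
  let ?gen = "vw_generator n x y w"
  interpret M: Module.module R "dgHom A (ob a) (ob b) m" for a b m using ob ob by (rule hom_module)
  have dw: "dgDiff A x y (n + 1) w \<in> carrier (dgHom A x y n)" using x y w by (simp add: diff_closed)
  have gen: "?gen a b m \<in> carrier (dgHom A (ob a) (ob b) m)" for a b m
    using x y w dw id_closed abelian_groupE(2)[OF hom_group]
    by (auto simp: vw_generator_def ob_def Let_def)
  have carr: "r \<in> carrier R" if "r \<in> carrier (dgHom (k_vw R n) a b m)" for r a b m
    using that by (auto simp: k_vw_def scalar_module_def split: if_splits)
  have dgen: "dgDiff A (ob a) (ob b) m (?gen a b m) =
      (if \<not> a \<and> b \<and> m = n + 1 then dgDiff A x y (n + 1) w else \<zero>\<^bsub>dgHom A (ob a) (ob b) (m - 1)\<^esub>)" for a b m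
    using x y w diff_id diff_zero diff_diff[OF x y w, of n]
    by (auto simp: vw_generator_def ob_def Let_def)
  have on: "onHom (vw_functor n x y w) a b m r = r \<odot>\<^bsub>dgHom A (ob a) (ob b) m\<^esub> ?gen a b m"
    if "r \<in> carrier (dgHom (k_vw R n) a b m)" for a b m r
    using that by (simp add: vw_functor_apply ob_def)
  have onObj: "onObj (vw_functor n x y w) = ob"
    by (rule ext) (simp add: vw_functor_apply ob_def)
  show ?thesis
  proof (rule dg_functorI)
    show "dg_category R (k_vw R n)" "dg_category R A" by (fact kvw, fact dg_category)
    show "onObj (vw_functor n x y w) \<in> dgObj (k_vw R n) \<rightarrow>\<^sub>E dgObj A"
      using ob by (auto simp: onObj k_vw_def)
    fix a b m
    show "\<not> (a \<in> dgObj (k_vw R n) \<and> b \<in> dgObj (k_vw R n))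
        \<Longrightarrow> onHom (vw_functor n x y w) a b m = (\<lambda>_. undefined)" by (simp add: k_vw_def)
    assume a: "a \<in> dgObj (k_vw R n)" and b: "b \<in> dgObj (k_vw R n)"
    show "onHom (vw_functor n x y w) a b m \<in> extensional (carrier (dgHom (k_vw R n) a b m))"
      by (simp add: vw_functor_def)
    fix r assume r: "r \<in> carrier (dgHom (k_vw R n) a b m)"
    show "onHom (vw_functor n x y w) a b m r
        \<in> carrier (dgHom A (onObj (vw_functor n x y w) a) (onObj (vw_functor n x y w) b) m)"
      using carr[OF r] gen by (simp add: on[OF r] onObj)
    have "dgDiff (k_vw R n) a b m r = (if \<not> a \<and> b \<and> m = n + 1 then r else \<zero>\<^bsub>R\<^esub>)"
      by (simp add: k_vw_def)
    then show "onHom (vw_functor n x y w) a b (m - 1) (dgDiff (k_vw R n) a b m r) =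
        dgDiff A (onObj (vw_functor n x y w) a) (onObj (vw_functor n x y w) b) m
          (onHom (vw_functor n x y w) a b m r)"
      using carr[OF r] gen V.diff_closed[OF a b r refl] diff_smult[OF ob ob carr[OF r] gen]
        M.smult_l_null[of "?gen a b (m - 1)" a b "m - 1"]
      by (auto simp: on[OF r] on onObj dgen) (auto simp: ob_def vw_generator_def)
    {
      fix s assume s: "s \<in> carrier R"
      have "s \<odot>\<^bsub>dgHom (k_vw R n) a b m\<^esub> r = s \<otimes>\<^bsub>R\<^esub> r" by (simp add: k_vw_def scalar_module_def)
      moreover have "s \<odot>\<^bsub>dgHom (k_vw R n) a b m\<^esub> r \<in> carrier (dgHom (k_vw R n) a b m)"
        using Module.module.smult_closed[OF V.hom_module[OF a b]] r s by blast
      ultimately show "onHom (vw_functor n x y w) a b m (s \<odot>\<^bsub>dgHom (k_vw R n) a b m\<^esub> r) =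
          s \<odot>\<^bsub>dgHom A (onObj (vw_functor n x y w) a) (onObj (vw_functor n x y w) b) m\<^esub>
          onHom (vw_functor n x y w) a b m r"
        using carr[OF r] s gen by (simp add: on onObj r M.smult_assoc1)
    }
    fix s assume s: "s \<in> carrier (dgHom (k_vw R n) a b m)"
    have "r \<oplus>\<^bsub>dgHom (k_vw R n) a b m\<^esub> s = r \<oplus>\<^bsub>R\<^esub> s" by (simp add: k_vw_def scalar_module_def)
    moreover have "r \<oplus>\<^bsub>dgHom (k_vw R n) a b m\<^esub> s \<in> carrier (dgHom (k_vw R n) a b m)"
      using abelian_groupE(1)[OF V.hom_group[OF a b]] r s by blast
    ultimately show "onHom (vw_functor n x y w) a b m (r \<oplus>\<^bsub>dgHom (k_vw R n) a b m\<^esub> s) =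
        onHom (vw_functor n x y w) a b m r
        \<oplus>\<^bsub>dgHom A (onObj (vw_functor n x y w) a) (onObj (vw_functor n x y w) b) m\<^esub>
        onHom (vw_functor n x y w) a b m s"
      using carr[OF r] carr[OF s] gen by (simp add: on onObj r s M.smult_l_distr)
  next
    fix a b c p q s r
    assume a: "a \<in> dgObj (k_vw R n)" and b: "b \<in> dgObj (k_vw R n)" and c: "c \<in> dgObj (k_vw R n)"
      and s: "s \<in> carrier (dgHom (k_vw R n) b c p)" and r: "r \<in> carrier (dgHom (k_vw R n) a b q)"
    have sr: "dgComp (k_vw R n) a b c p q s r = s \<otimes>\<^bsub>R\<^esub> r" by (simp add: k_vw_def)
    have src: "s \<otimes>\<^bsub>R\<^esub> r \<in> carrier (dgHom (k_vw R n) a c (p + q))"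
      using V.comp_closed[OF a b c s r refl] by (simp add: sr)
    note R = carr[OF r] carr[OF s]
    have comp: "dgComp A (ob a) (ob b) (ob c) p q (s \<odot>\<^bsub>dgHom A (ob b) (ob c) p\<^esub> ?gen b c p)
        (r \<odot>\<^bsub>dgHom A (ob a) (ob b) q\<^esub> ?gen a b q) =
        (s \<otimes>\<^bsub>R\<^esub> r) \<odot>\<^bsub>dgHom A (ob a) (ob c) (p + q)\<^esub>
          dgComp A (ob a) (ob b) (ob c) p q (?gen b c p) (?gen a b q)"
      by (simp only: comp_smult_left[OF ob ob ob gen M.smult_closed[OF R(1) gen] R(2)]
          comp_smult_right[OF ob ob ob gen gen R(1)]
          M.smult_assoc1[OF R(2) R(1) comp_closed[OF ob ob ob gen gen refl]])
    \<comment> \<open>Unless one of the factors is an identity, one of the coefficients vanishes.\<close>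
    have "(s \<otimes>\<^bsub>R\<^esub> r) \<odot>\<^bsub>dgHom A (ob a) (ob c) (p + q)\<^esub> ?gen a c (p + q) =
        (s \<otimes>\<^bsub>R\<^esub> r) \<odot>\<^bsub>dgHom A (ob a) (ob c) (p + q)\<^esub>
          dgComp A (ob a) (ob b) (ob c) p q (?gen b c p) (?gen a b q)"
    proof -
      consider "a = b" "q = 0" | "b = c" "p = 0" | "s = \<zero>\<^bsub>R\<^esub>" | "r = \<zero>\<^bsub>R\<^esub>"
        using r s by (auto simp: k_vw_def scalar_module_def split: if_splits)
      then show ?thesis
      proof cases
        case 1
        then have "?gen a b q = dgId A (ob a)" by (simp add: vw_generator_def ob_def)
        then show ?thesis using 1 comp_id_right[OF ob ob gen] by simp
      next
        case 2
        then have "?gen b c p = dgId A (ob b)" by (simp add: vw_generator_def ob_def)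
        then show ?thesis using 2 comp_id_left[OF ob ob gen] by simp
      qed (use R gen comp_closed[OF ob ob ob gen gen refl, of a b c p q] in simp_all)
    qed
    then show "onHom (vw_functor n x y w) a c (p + q) (dgComp (k_vw R n) a b c p q s r) =
        dgComp A (onObj (vw_functor n x y w) a) (onObj (vw_functor n x y w) b) (onObj (vw_functor n x y w) c)
          p q (onHom (vw_functor n x y w) b c p s) (onHom (vw_functor n x y w) a b q r)"
      by (simp add: sr on[OF src] on[OF s] on[OF r] onObj comp)
  next
    fix a assume "a \<in> dgObj (k_vw R n)"
    have id: "dgId (k_vw R n) a = \<one>\<^bsub>R\<^esub>" by (simp add: k_vw_def)
    have "?gen a a 0 = dgId A (ob a)" by (simp add: vw_generator_def ob_def)
    then show "onHom (vw_functor n x y w) a a 0 (dgId (k_vw R n) a) =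
        dgId A (onObj (vw_functor n x y w) a)"
      using on[of "\<one>\<^bsub>R\<^esub>" a a 0] V.id_closed[of a] gen[of a a 0] by (simp add: id onObj k_vw_def)
  qed
qed

end

text \<open>As a dg category with two objects, \<open>\<bold>k\<langle>v,w\<rangle>\<close> is generated by \<open>w\<close>: the other generator is \<open>v = d w\<close>.\<close>

lemma dgfun_k_vw_eqI:
  fixes L L' :: "(bool, 'o, 'u) dgfun"
  assumes L: "dg_functor R (k_vw R n) A L" and L': "dg_functor R (k_vw R n) A L'"
    and obj: "\<And>b. onObj L b = onObj L' b"
    and gen: "onHom L False True (n + 1) \<one>\<^bsub>R\<^esub> = onHom L' False True (n + 1) \<one>\<^bsub>R\<^esub>"
  shows "L = L'"
proof (rule dgfun_eqI[OF L L'])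
  interpret L: dg_fun R "k_vw R n" A L using L by (rule dg_funI)
  interpret L': dg_fun R "k_vw R n" A L' using L' by (rule dg_funI)
  have O: "b \<in> dgObj (k_vw R n)" for b by (simp add: k_vw_def)
  interpret V: Module.module R "dgHom (k_vw R n) False False 0" by (rule L.A.hom_module[OF O O])
  fix a b m r
  assume r: "r \<in> carrier (dgHom (k_vw R n) a b m)"
  let ?on = "a = b \<and> m = 0 \<or> \<not> a \<and> b \<and> (m = n \<or> m = n + 1)"
  show "onHom L a b m r = onHom L' a b m r"
  proof (cases ?on)
    case True
    then have one: "\<one>\<^bsub>R\<^esub> \<in> carrier (dgHom (k_vw R n) a b m)" and R: "r \<in> carrier R"
      and smult: "r \<odot>\<^bsub>dgHom (k_vw R n) a b m\<^esub> \<one>\<^bsub>R\<^esub> = r"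
      using r by (auto simp: k_vw_def scalar_module_def)
    have "onHom L a b m \<one>\<^bsub>R\<^esub> = onHom L' a b m \<one>\<^bsub>R\<^esub>"
    proof -
      consider "a = b" "m = 0" | "\<not> a" "b" "m = n" | "\<not> a" "b" "m = n + 1" using True by blast
      then show ?thesis
      proof cases
        case 1
        then show ?thesis using L.onHom_id[OF O, of a] L'.onHom_id[OF O, of a] obj by (simp add: k_vw_def)
      next
        case 2
        have "\<one>\<^bsub>R\<^esub> \<in> carrier (dgHom (k_vw R n) False True (n + 1))"
          by (simp add: k_vw_def scalar_module_def)
        moreover have "dgDiff (k_vw R n) False True (n + 1) \<one>\<^bsub>R\<^esub> = \<one>\<^bsub>R\<^esub>" by (simp add: k_vw_def)
        ultimately have "onHom L False True n \<one>\<^bsub>R\<^esub> = onHom L' False True n \<one>\<^bsub>R\<^esub>"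
          using L.onHom_diff[OF O O, of "\<one>\<^bsub>R\<^esub>" False True "n + 1" n]
            L'.onHom_diff[OF O O, of "\<one>\<^bsub>R\<^esub>" False True "n + 1" n] gen obj by simp
        then show ?thesis using 2 by simp
      next
        case 3
        then show ?thesis using gen by simp
      qed
    qed
    then show ?thesis
      using L.onHom_smult[OF O O R one] L'.onHom_smult[OF O O R one] obj by (simp add: smult)
  next
    case False
    then have "r = \<zero>\<^bsub>dgHom (k_vw R n) a b m\<^esub>"
      using r by (simp only: k_vw_def scalar_module_def dgcat.simps partial_object.simps if_False singleton_iff ring.simps)
    then show ?thesis using L.onHom_zero[OF O O] L'.onHom_zero[OF O O] obj by simp
  qed
qed (rule obj)

text \<open>By its universal property, maps out of \<open>C/v\<close> under \<open>C\<close> correspond to the primitives of \<open>F(v)\<close>: every primitive is the image of the universal one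
  (\<open>ex_hom_with_value\<close>) under exactly one map (\<open>hom_eqI_value\<close>).\<close>

locale dg_C_over_v = closed_morphism R C X Y n v
  for R :: "'u::infinite ring" and C :: "('o, 'u) dgcat" and X Y :: 'o and n :: int and v :: 'u +
  fixes Cv :: "('o, 'u) dgcat" and I :: "('o, 'o, 'u) dgfun" and J :: "(bool, 'o, 'u) dgfun"
  assumes pushout: "dg_pushout R (k_v R n) C (k_vw R n) (k_v_classify R C X Y n v) (k_v_incl R n) Cv I J"
begin

lemma pushout_functors:
  "dg_functor R (k_v R n) C (k_v_classify R C X Y n v)" "dg_functor R (k_v R n) (k_vw R n) (k_v_incl R n)"
  "dg_functor R C Cv I" "dg_functor R (k_vw R n) Cv J"
  "dgfun_comp (k_v R n) I (k_v_classify R C X Y n v) = dgfun_comp (k_v R n) J (k_v_incl R n)"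
  using pushout by (simp_all add: dg_pushout_def)

lemma pushout_universal:
  fixes E :: "('o, 'u) dgcat"
  assumes "dg_functor R C E h" "dg_functor R (k_vw R n) E l"
    and "dgfun_comp (k_v R n) h (k_v_classify R C X Y n v) = dgfun_comp (k_v R n) l (k_v_incl R n)"
  shows "\<exists>!u. dg_functor R Cv E u \<and> dgfun_comp C u I = h \<and> dgfun_comp (k_vw R n) u J = l"
  by (rule pushout[unfolded dg_pushout_def, THEN conjunct2, THEN conjunct2, THEN conjunct2,
        THEN conjunct2, THEN conjunct2, rule_format]) (use assms in simp)

abbreviation Pv :: "('o, 'u) dg_under" where "Pv \<equiv> (Cv, I)"

definition universal_w :: 'u where "universal_w = onHom J False True (n + 1) \<one>\<^bsub>R\<^esub>"

lemma one_k_vw: "\<one>\<^bsub>R\<^esub> \<in> carrier (dgHom (k_vw R n) False True (n + 1))"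
    "dgDiff (k_vw R n) False True (n + 1) \<one>\<^bsub>R\<^esub> = \<one>\<^bsub>R\<^esub>"
    "b \<in> dgObj (k_vw R n)"
    "\<one>\<^bsub>R\<^esub> \<in> carrier (dgHom (k_v R n) False True n)"
    "b \<in> dgObj (k_v R n)"
proof -
  interpret Module.module R "dgHom C X Y n" using C.hom_module X Y by blast
  show "\<one>\<^bsub>R\<^esub> \<in> carrier (dgHom (k_vw R n) False True (n + 1))"
    "dgDiff (k_vw R n) False True (n + 1) \<one>\<^bsub>R\<^esub> = \<one>\<^bsub>R\<^esub>"
    "b \<in> dgObj (k_vw R n)"
    "\<one>\<^bsub>R\<^esub> \<in> carrier (dgHom (k_v R n) False True n)"
    "b \<in> dgObj (k_v R n)"
    by (simp_all add: k_vw_def k_v_def scalar_module_def)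
qed

lemma J_obj: "onObj J b = onObj I (if b then Y else X)"
proof -
  have "onObj (dgfun_comp (k_v R n) J (k_v_incl R n)) b =
      onObj (dgfun_comp (k_v R n) I (k_v_classify R C X Y n v)) b"
    by (simp only: pushout_functors(5))
  then show ?thesis by (simp add: dgfun_comp_apply one_k_vw k_v_incl_def k_v_classify_def Let_def)
qed

lemma J_v: "onHom J False True n \<one>\<^bsub>R\<^esub> = onHom I X Y n v"
proof -
  interpret Module.module R "dgHom C X Y n" using C.hom_module X Y by blast
  have "onHom (dgfun_comp (k_v R n) J (k_v_incl R n)) False True n \<one>\<^bsub>R\<^esub> =
      onHom (dgfun_comp (k_v R n) I (k_v_classify R C X Y n v)) False True n \<one>\<^bsub>R\<^esub>"
    by (simp only: pushout_functors(5))
  then show ?thesis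
    using v_closed
    by (simp add: dgfun_comp_apply one_k_vw k_v_incl_def k_v_classify_def Let_def)
qed

lemma Pv_ob: "Pv \<in> weOb K"
  using pushout_functors(3) by (simp add: under_ob_iff)

lemma universal_w_primitive: "universal_w \<in> primitives Pv"
proof -
  interpret J: dg_fun R "k_vw R n" Cv J using pushout_functors(4) by (rule dg_funI)
  show ?thesis
    using J.onHom_closed[OF one_k_vw(3,3,1)] J.onHom_diff[OF one_k_vw(3,3,1), of n]
    by (simp add: primitives_def universal_w_def J_obj J_v one_k_vw(2))
qed

lemma comp_J_value:
  "onHom (dgfun_comp (k_vw R n) G J) False True (n + 1) \<one>\<^bsub>R\<^esub> = hom_value Pv G universal_w"
  by (simp add: dgfun_comp_apply one_k_vw J_obj universal_w_def)

text \<open>The pushout glues \<open>F\<close> to the functor on \<open>\<bold>k\<langle>v,w\<rangle>\<close> that a primitive \<open>w\<close> classifies; they agree on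
  \<open>\<bold>k\<langle>v\<rangle>\<close> because \<open>d w = F(v)\<close>.\<close>

lemma ex_hom_with_value:
  assumes P: "P \<in> weOb K" and w: "w \<in> primitives P"
  shows "\<exists>G\<in>weHom K Pv P. hom_value Pv G universal_w = w"
proof -
  interpret F: dg_fun R C "fst P" "snd P" using P by (intro dg_funI) (simp add: under_ob_iff)
  note XY = under_obj(1,2)[OF P]
  let ?x = "onObj (snd P) X" and ?y = "onObj (snd P) Y"
  interpret M: Module.module R "dgHom (fst P) ?x ?y n" using F.B.hom_module XY by blast
  interpret M1: Module.module R "dgHom (fst P) ?x ?y (n + 1)" using F.B.hom_module XY by blast
  have wc: "w \<in> carrier (dgHom (fst P) ?x ?y (n + 1))"
    and dw: "dgDiff (fst P) ?x ?y (n + 1) w = onHom (snd P) X Y n v"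
    using w by (auto simp: primitives_def)
  let ?l = "F.B.vw_functor n ?x ?y w"
  have l: "dg_functor R (k_vw R n) (fst P) ?l"
    using pushout_functors(2) XY wc by (intro F.B.dg_functor_vw) (simp_all add: dg_functor_def)
  have "dgfun_comp (k_v R n) (snd P) (k_v_classify R C X Y n v) = dgfun_comp (k_v R n) ?l (k_v_incl R n)"
  proof (rule dgfun_eqI[OF dg_functor_comp[OF pushout_functors(1) F.dg_functor]
        dg_functor_comp[OF pushout_functors(2) l]])
    fix b assume "b \<in> dgObj (k_v R n)"
    then show "onObj (dgfun_comp (k_v R n) (snd P) (k_v_classify R C X Y n v)) b =
        onObj (dgfun_comp (k_v R n) ?l (k_v_incl R n)) b"
      by (simp add: dgfun_comp_apply k_v_incl_def k_v_classify_def Let_def F.B.vw_functor_apply)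
  next
    fix a b m r assume a: "a \<in> dgObj (k_v R n)" and b: "b \<in> dgObj (k_v R n)"
      and r: "r \<in> carrier (dgHom (k_v R n) a b m)"
    interpret incl: dg_fun R "k_v R n" "k_vw R n" "k_v_incl R n"
      using pushout_functors(2) by (rule dg_funI)
    have on: "onHom (k_v_incl R n) a b m r = r" "onObj (k_v_incl R n) a = a" "onObj (k_v_incl R n) b = b"
      using r by (simp_all add: k_v_incl_def)
    have r': "r \<in> carrier (dgHom (k_vw R n) a b m)" using incl.onHom_closed[OF a b r] by (simp add: on)
    have R: "r \<in> carrier R" using r by (auto simp: k_v_def scalar_module_def split: if_splits)
    define ob where "ob b = (if b then Y else X)" for b
    have ob: "ob b \<in> dgObj C" for b using X Y by (simp add: ob_def)
    let ?g = "if a = b \<and> m = 0 then dgId C (ob a) else if \<not> a \<and> b \<and> m = n then v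
      else \<zero>\<^bsub>dgHom C (ob a) (ob b) m\<^esub>"
    have g: "?g \<in> carrier (dgHom C (ob a) (ob b) m)"
      using v_closed C.id_closed[OF ob] abelian_groupE(2)[OF C.hom_group[OF ob ob]]
      by (auto simp: ob_def)
    have classify: "onHom (k_v_classify R C X Y n v) a b m r = r \<odot>\<^bsub>dgHom C (ob a) (ob b) m\<^esub> ?g"
      using r Module.module.smult_r_null[OF C.hom_module[OF ob[of a] ob[of b]] R, of m]
      by (auto simp: k_v_classify_def Let_def ob_def)
    have obj: "onObj (k_v_classify R C X Y n v) c = ob c" for c
      by (simp add: k_v_classify_def Let_def ob_def)
    have Fob: "(if c then ?y else ?x) = onObj (snd P) (ob c)" for c by (simp add: ob_def)
    \<comment> \<open>Only in the degree of \<open>w\<close> do the two generators differ, and there \<open>\<bold>k\<langle>v\<rangle>\<close> is zero.\<close>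
    have "onHom (snd P) (ob a) (ob b) m ?g = F.B.vw_generator n ?x ?y w a b m \<or>
        (r = \<zero>\<^bsub>R\<^esub> \<and> F.B.vw_generator n ?x ?y w a b m \<in> carrier (dgHom (fst P) (onObj (snd P) (ob a)) (onObj (snd P) (ob b)) m))"
    proof (cases "\<not> a \<and> b \<and> m = n + 1")
      case True
      then show ?thesis
        using r wc by (auto simp: k_v_def scalar_module_def F.B.vw_generator_def ob_def)
    next
      case False
      then show ?thesis
        using dw F.onHom_id[OF ob[of a]] F.onHom_zero[OF ob[of a] ob[of b], of m]
        by (auto simp: F.B.vw_generator_def ob_def)
    qed
    then show "onHom (dgfun_comp (k_v R n) (snd P) (k_v_classify R C X Y n v)) a b m r =
        onHom (dgfun_comp (k_v R n) ?l (k_v_incl R n)) a b m r"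
      using F.onHom_smult[OF ob ob R g] F.onHom_closed[OF ob ob g]
        Module.module.smult_l_null[OF F.B.hom_module[OF F.obj_closed[OF ob] F.obj_closed[OF ob]]]
      by (auto simp: dgfun_comp_apply a b r on classify obj F.B.vw_functor_apply r' Fob)
  qed
  then obtain u where u: "dg_functor R Cv (fst P) u" "dgfun_comp C u I = snd P"
    "dgfun_comp (k_vw R n) u J = ?l"
    using pushout_universal[OF F.dg_functor l] by blast
  have "hom_value Pv u universal_w = w"
    using comp_J_value[of u] wc one_k_vw(1)
    by (simp add: u(3) F.B.vw_functor_apply F.B.vw_generator_def)
  then show ?thesis using u(1,2) by (intro bexI[of _ u]) (simp_all add: under_hom_iff)
qed

lemma hom_eqI_value:
  assumes G: "G \<in> weHom K Pv P" and G': "G' \<in> weHom K Pv P"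
    and eq: "hom_value Pv G universal_w = hom_value Pv G' universal_w"
  shows "G = G'"
proof -
  have fG: "dg_functor R Cv (fst P) G" "dgfun_comp C G I = snd P"
    and fG': "dg_functor R Cv (fst P) G'" "dgfun_comp C G' I = snd P"
    using G G' by (auto simp: under_hom_iff)
  have F: "dg_functor R C (fst P) (snd P)"
    using dg_functor_comp[OF pushout_functors(3) fG(1)] fG(2) by simp
  have l: "dg_functor R (k_vw R n) (fst P) (dgfun_comp (k_vw R n) G J)"
    and l': "dg_functor R (k_vw R n) (fst P) (dgfun_comp (k_vw R n) G' J)"
    using dg_functor_comp pushout_functors(4) fG(1) fG'(1) by blast+
  have "onObj G (onObj J b) = onObj G' (onObj J b)" for b
    using under_hom_apply(1,2)[OF G] under_hom_apply(1,2)[OF G'] by (simp add: J_obj)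
  then have ll': "dgfun_comp (k_vw R n) G J = dgfun_comp (k_vw R n) G' J"
    using eq by (intro dgfun_k_vw_eqI[OF l l']) (simp_all add: dgfun_comp_apply(1) one_k_vw(3) comp_J_value)
  have "dgfun_comp (k_v R n) (snd P) (k_v_classify R C X Y n v) =
      dgfun_comp (k_v R n) (dgfun_comp (k_vw R n) G J) (k_v_incl R n)"
    using dgfun_comp_assoc[OF pushout_functors(1,3) fG(1)]
      dgfun_comp_assoc[OF pushout_functors(2,4) fG(1)] pushout_functors(5) fG(2) by simp
  then show ?thesis
    using pushout_universal[OF F l] fG fG' ll' by (metis (no_types))
qed

text \<open>The point is that two maps \<open>f\<close> and \<open>g\<close> with homologous values on the universal primitive agree in the
  homotopy category. If \<open>f\<close> and \<open>g\<close> take the values \<open>w\<^sub>f\<close> and \<open>w\<^sub>g\<close>, and \<open>w\<^sub>f = d h + w\<^sub>g\<close>, then the triple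
  \<open>(w\<^sub>f, w\<^sub>g, h)\<close> is a primitive of the constant path at \<open>F(v)\<close>. It therefore defines a map \<open>H\<close> to the path
  dg category, whose composites with the two evaluations are \<open>f\<close> and \<open>g\<close>. Both evaluations are
  inverse to the constant-path functor in the homotopy category, hence equal there.\<close>

sublocale homotopy_universal_element K "kappa X Y n v" "kappa_map X Y n" Pv "kappa_class Pv universal_w"
proof unfold_locales
  show "Pv \<in> weOb K" by (rule Pv_ob)
  show "kappa_class Pv universal_w \<in> kappa X Y n v Pv"
    using universal_w_primitive by (simp add: kappa_eq)
next
  fix P c assume P: "P \<in> weOb K" and "c \<in> kappa X Y n v P"
  then obtain w where w: "w \<in> primitives P" "c = kappa_class P w" by (auto simp: kappa_eq)
  then obtain G where "G \<in> weHom K Pv P" "hom_value Pv G universal_w = w"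
    using ex_hom_with_value P by blast
  then show "\<exists>f\<in>weHom K Pv P. kappa_map X Y n Pv P f (kappa_class Pv universal_w) = c"
    using kappa_map_class(2)[OF Pv_ob _ universal_w_primitive] w by blast
next
  fix P f g assume P: "P \<in> weOb K" and f: "f \<in> weHom K Pv P" and g: "g \<in> weHom K Pv P"
    and eq: "kappa_map X Y n Pv P f (kappa_class Pv universal_w) =
      kappa_map X Y n Pv P g (kappa_class Pv universal_w)"
  interpret F: dg_fun R C "fst P" "snd P" using P by (intro dg_funI) (simp add: under_ob_iff)
  interpret D: dg_cat_infinite R "fst P" by unfold_locales
  note XY = under_obj(1,2)[OF P]
  let ?x = "onObj (snd P) X" and ?y = "onObj (snd P) Y"
  interpret M: abelian_group "dgHom (fst P) ?x ?y (n + 1)" using F.B.hom_group XY by blast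
  interpret M0: abelian_group "dgHom (fst P) ?x ?y n" using F.B.hom_group XY by blast
  define wf where "wf = hom_value Pv f universal_w"
  define wg where "wg = hom_value Pv g universal_w"
  have wfg: "wf \<in> primitives P" "wg \<in> primitives P"
    using kappa_map_class(1)[OF Pv_ob _ universal_w_primitive] f g by (simp_all add: wf_def wg_def)
  have "kappa_class P wf = kappa_class P wg"
    using eq kappa_map_class(2)[OF Pv_ob _ universal_w_primitive] f g by (simp add: wf_def wg_def)
  then obtain h where h: "h \<in> carrier (dgHom (fst P) ?x ?y (n + 1 + 1))"
    and wf_eq: "wf = dgDiff (fst P) ?x ?y (n + 1 + 1) h \<oplus>\<^bsub>dgHom (fst P) ?x ?y (n + 1)\<^esub> wg"
    using wfg F.B.coset_eq_iff[OF XY, of wf "n + 1" wg] by (auto simp: kappa_class_def primitives_def)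
  have dh: "dgDiff (fst P) ?x ?y (n + 1 + 1) h \<in> carrier (dgHom (fst P) ?x ?y (n + 1))"
    using F.B.diff_closed[OF XY h, of "n + 1"] by simp
  have diff: "wf \<ominus>\<^bsub>dgHom (fst P) ?x ?y (n + 1)\<^esub> wg \<ominus>\<^bsub>dgHom (fst P) ?x ?y (n + 1)\<^esub>
      dgDiff (fst P) ?x ?y (n + 1 + 1) h = \<zero>\<^bsub>dgHom (fst P) ?x ?y (n + 1)\<^esub>"
    unfolding wf_eq using dh wfg by (simp add: primitives_def M.minus_eq M.a_assoc M.r_neg)
  let ?Q = "(path_dgcat (fst P), dgfun_comp C (path_const (fst P)) (snd P))"
  have Q: "?Q \<in> weOb K"
    using dg_functor_comp[OF F.dg_functor D.dg_functor_path_const] by (simp add: under_ob_iff)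
  have const: "path_const (fst P) \<in> weEq K P ?Q"
    using D.dg_functor_path_const D.quasi_equivalence_path_const by (simp add: under_weEq_iff under_hom_iff)
  have eval: "path_eval (fst P) e \<in> weHom K ?Q P" if "e \<in> {start, finish}" for e
    using D.dg_functor_path_eval[OF that] D.path_eval_const[OF that] dgfun_comp_id_left[OF F.dg_functor]
      dgfun_comp_assoc[OF F.dg_functor D.dg_functor_path_const D.dg_functor_path_eval[OF that]]
    by (simp add: under_hom_iff)
  have Qxy: "onObj (snd ?Q) X = ?x" "onObj (snd ?Q) Y = ?y"
    using XY X Y by (simp_all add: dgfun_comp_apply path_const_apply)
  have tc: "triple wf wg h \<in> carrier (dgHom (path_dgcat (fst P)) ?x ?y (n + 1))"
    using wfg h by (simp add: primitives_def)
  have "triple wf wg h \<in> primitives ?Q"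
    using tc wfg diff X Y XY v_closed F.onHom_closed[OF X Y v_closed]
    by (simp add: primitives_def Qxy dgfun_comp_apply path_const_apply)
  then obtain H where H: "H \<in> weHom K Pv ?Q" "hom_value Pv H universal_w = triple wf wg h"
    using ex_hom_with_value[OF Q] by blast
  have H_obj: "onObj H (onObj I X) = ?x" "onObj H (onObj I Y) = ?y"
    using under_hom_apply(1,2)[OF H(1)] Qxy by simp_all
  have val: "hom_value Pv (weComp K Pv ?Q P (path_eval (fst P) e) H) universal_w = e (triple wf wg h)"
    if "e \<in> {start, finish}" for e
    using H(2) universal_w_primitive tc XY under_obj(1,2)[OF Pv_ob]
    by (simp add: under_id_comp dgfun_comp_apply primitives_def path_eval_apply H_obj del: path_dgcat_simps(2))
  have f_eq: "weComp K Pv ?Q P (path_eval (fst P) start) H = f"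
    using val[of start] comp_hom[OF Pv_ob Q P H(1) eval[of start]] f
    by (intro hom_eqI_value[of _ P]) (simp_all add: wf_def)
  have g_eq: "weComp K Pv ?Q P (path_eval (fst P) finish) H = g"
    using val[of finish] comp_hom[OF Pv_ob Q P H(1) eval[of finish]] g
    by (intro hom_eqI_value[of _ P]) (simp_all add: wg_def)
  have "zigzag_eq K ?Q P [Fwd ?Q (path_eval (fst P) start) P] [Fwd ?Q (path_eval (fst P) finish) P]"
    using Q P const eval[of start] eval[of finish] D.path_eval_const
    by (intro zigzag_eq_of_common_section[of _ _ "path_const (fst P)"]) (simp_all add: under_id_comp)
  then have "zigzag_eq K Pv P ([Fwd Pv H ?Q] @ [Fwd ?Q (path_eval (fst P) start) P])
      ([Fwd Pv H ?Q] @ [Fwd ?Q (path_eval (fst P) finish) P])"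
    by (rule zigzag_eq_append_right[OF zigzag_single[OF Pv_ob Q H(1)]])
  then have mid: "zigzag_eq K Pv P [Fwd Pv H ?Q, Fwd ?Q (path_eval (fst P) start) P]
      [Fwd Pv H ?Q, Fwd ?Q (path_eval (fst P) finish) P]" by simp
  have left: "zigzag_eq K Pv P [Fwd Pv f P] [Fwd Pv H ?Q, Fwd ?Q (path_eval (fst P) start) P]"
    using ze_sym[OF ze_comp[OF Pv_ob Q P H(1) eval[of start]]] unfolding f_eq by simp
  have right: "zigzag_eq K Pv P [Fwd Pv H ?Q, Fwd ?Q (path_eval (fst P) finish) P] [Fwd Pv g P]"
    using ze_comp[OF Pv_ob Q P H(1) eval[of finish]] unfolding g_eq by simp
  show "zigzag_eq K Pv P [Fwd Pv f P] [Fwd Pv g P]"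
    by (rule ze_trans[OF left ze_trans[OF mid right]])
qed

end

section \<open>The representability theorem\<close>

theorem proposition3p3:
  fixes R :: "'u::infinite ring"
    and C :: "('o, 'u) dgcat"
    and X Y :: 'o and n :: int and v :: 'u
    and Cv :: "('o, 'u) dgcat" and I :: "('o, 'o, 'u) dgfun"
  assumes "cring R"
    and "dg_category R C" and "flat_dgcat R C"
    and "X \<in> dgObj C" and "Y \<in> dgObj C"
    and "v \<in> dg_cycles C X Y n"
    and "is_C_over_v R C X Y n v (Cv, I)"
  shows "\<exists>\<phi>.
    (\<forall>D F. dg_functor R C D F \<and> flat_dgcat R D \<longrightarrow>
       bij_betw (\<phi> (D, F)) (kappa X Y n v (D, F)) (Ho_Hom (under_dgCat R C) (Cv, I) (D, F))) \<and>
    (\<forall>D F D' F' G. dg_functor R C D F \<and> flat_dgcat R D \<and>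
       dg_functor R C D' F' \<and> flat_dgcat R D' \<and> G \<in> under_hom R C (D, F) (D', F') \<longrightarrow>
       (\<forall>c\<in>kappa X Y n v (D, F).
          \<phi> (D', F') (kappa_map X Y n (D, F) (D', F') G c) =
          Ho_postcomp (under_dgCat R C) (Cv, I) (D, F) (D', F') G (\<phi> (D, F) c)))"
proof -
  obtain J where "dg_pushout R (k_v R n) C (k_vw R n) (k_v_classify R C X Y n v) (k_v_incl R n) Cv I J"
    using assms(7) by (auto simp: is_C_over_v_def)
  then interpret dg_C_over_v R C X Y n v Cv I J
    using assms by unfold_locales
  have ob: "(D, F) \<in> weOb K" if "dg_functor R C D F" for D F
    using that by (simp add: under_ob_iff)
  have hom: "G \<in> weHom K P Q" if "G \<in> under_hom R C P Q" for G P Q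
    using that by (simp add: under_dgCat_def)
  show ?thesis
    using represent_bij represent_natural ob hom by (intro exI[of _ represent]) blast
qed

end
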